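(* Fix $V\in\mathfrak M_S$. The maximal Lie triple subsystems of $\mathfrak m_4^V$ are exactly the following: (1) $\mathfrak h_1\cap\mathfrak m_4^V$, for a principal subalgebra $\mathfrak h_1$ of $\mathfrak g_2$ adapted to $V$; (2) $\mathfrak h_2^\ell\cap\mathfrak m_4^V$, for a fixed $0\neq\ell\in V^\perp$; (3) $\mathfrak h_2^{u}\cap\mathfrak m_4^V$, for a fixed $0\neq u\in V$; (4) $\mathfrak h_4^W\cap\mathfrak m_4^V$, for a fixed $W\in\mathfrak M_S$ such that both $W\cap V$ and $W\cap V^\perp$ are nonzero.
   Context: Setup: Let $\langle\cdot,\cdot\rangle$ be the standard inner product on $\mathbb R^7$ with standard basis $e_1,\dots,e_7$, and let $\times$ be the anticommutative bilinear product on $\mathbb R^7$ determined by $e_i\times e_{i+1}=e_{i+3}$, $e_{i+1}\times e_{i+3}=e_i$, $e_{i+3}\times e_i=e_{i+1}$ (indices mod 7); it is a cross product. $G_2=\mathrm{Aut}(\mathbb R^7,\times)$, with Lie algebra $\mathfrak g_2=\mathrm{Der}(\mathbb R^7,\times)=\{d\in\mathfrak{gl}(7,\mathbb R): d(x\times y)=d(x)\times y+x\times d(y)\}$. $\mathfrak M_S=\{V\le\mathbb R^7:\dim V=3,\ V\times V\subseteq V\}$. For $0\neq u\in\mathbb R^7$: $\mathfrak h_2^u=\{d\in\mathfrak g_2:d(u)=0\}$. For $V\in\mathfrak M_S$: $\mathfrak h_4^V=\{d\in\mathfrak g_2: d(V^\perp)\subseteq V^\perp\}$ and $\mathfrak m_4^V=\{d\in\mathfrak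 g_2: d(V)\subseteq V^\perp,\ d(V^\perp)\subseteq V\}$; $\mathfrak g_2=\mathfrak h_4^V\oplus\mathfrak m_4^V$ is a $\mathbb Z_2$-grading, and $\mathfrak m_4^V$ is a Lie triple system under $[x,y,z]=[[x,y],z]$. A Lie triple subsystem of $\mathfrak m_4^V$ is a subspace $S$ with $[[S,S],S]\subseteq S$; it is maximal if it is proper and not properly contained in a proper Lie triple subsystem of $\mathfrak m_4^V$. A principal subalgebra of $\mathfrak g_2$ is a three-dimensional simple subalgebra $\mathfrak h$ whose complexification contains a principal (regular) nilpotent element of $\mathfrak g_2\otimes\mathbb C$ (one whose adjoint orbit is dense in the nilpotent variety). A principal subalgebra $\mathfrak h$ is adapted to $V\in\mathfrak M_S$ if $\mathfrak h=(\mathfrak h\cap\mathfrak h_4^V)\oplus(\mathfrak h\cap\mathfrak m_4^V)$. *)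

theory Defs
  imports "HOL-Analysis.Analysis"
begin

text \<open>Indices of R^7 are the elements of the numeral type 7 (= Z/7Z); the paper's basis
vector e_i corresponds to axis (of_nat i) 1, so index arithmetic is mod 7.\<close>

definition e7 :: "nat \<Rightarrow> real^7" where
  "e7 i = axis (of_nat i :: 7) 1"

text \<open>The bilinear anticommutative product determined by
 e_t x e_(t+1) = e_(t+3), e_(t+1) x e_(t+3) = e_t, e_(t+3) x e_t = e_(t+1) (indices mod 7),
 over an arbitrary commutative ring (used over the reals and over the complexes).\<close>
definition cross7 :: "'a::comm_ring_1^7 \<Rightarrow> 'a^7 \<Rightarrow> 'a^7" where
  "cross7 x y = (\<Sum>t\<in>(UNIV::7 set).
      (x$t * y$(t+1) - x$(t+1) * y$t) *s axis (t+3) 1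
    + (x$(t+1) * y$(t+3) - x$(t+3) * y$(t+1)) *s axis t 1
    + (x$(t+3) * y$t - x$t * y$(t+3)) *s axis (t+1) 1)"

definition lie :: "'a::comm_ring_1^7^7 \<Rightarrow> 'a^7^7 \<Rightarrow> 'a^7^7" where
  "lie a b = a ** b - b ** a"

definition g2 :: "(real^7^7) set" where
  "g2 = {d. \<forall>x y. d *v cross7 x y = cross7 (d *v x) y + cross7 x (d *v y)}"

definition MS :: "(real^7) set set" where
  "MS = {V. subspace V \<and> dim V = 3 \<and> (\<forall>x\<in>V. \<forall>y\<in>V. cross7 x y \<in> V)}"

definition perp :: "(real^7) set \<Rightarrow> (real^7) set" where
  "perp V = {x. \<forall>v\<in>V. inner v x = 0}"

definition h2 :: "real^7 \<Rightarrow> (real^7^7) set" where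
  "h2 u = {d\<in>g2. d *v u = 0}"

definition h4 :: "(real^7) set \<Rightarrow> (real^7^7) set" where
  "h4 V = {d\<in>g2. \<forall>x\<in>perp V. d *v x \<in> perp V}"

definition m4 :: "(real^7) set \<Rightarrow> (real^7^7) set" where
  "m4 V = {d\<in>g2. (\<forall>x\<in>V. d *v x \<in> perp V) \<and> (\<forall>x\<in>perp V. d *v x \<in> V)}"

definition LTS :: "(real^7) set \<Rightarrow> (real^7^7) set \<Rightarrow> bool" where
  "LTS V S \<longleftrightarrow> subspace S \<and> S \<subseteq> m4 V \<and>
     (\<forall>x\<in>S. \<forall>y\<in>S. \<forall>z\<in>S. lie (lie x y) z \<in> S)"

definition maximal_LTS :: "(real^7) set \<Rightarrow> (real^7^7) set \<Rightarrow> bool" where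
  "maximal_LTS V S \<longleftrightarrow> LTS V S \<and> S \<noteq> m4 V \<and>
     (\<forall>T. LTS V T \<and> T \<noteq> m4 V \<and> S \<subseteq> T \<longrightarrow> T = S)"

definition subalgebra :: "(real^7^7) set \<Rightarrow> bool" where
  "subalgebra h \<longleftrightarrow> subspace h \<and> h \<subseteq> g2 \<and> (\<forall>x\<in>h. \<forall>y\<in>h. lie x y \<in> h)"

definition simple_lie :: "(real^7^7) set \<Rightarrow> bool" where
  "simple_lie h \<longleftrightarrow> (\<exists>x\<in>h. \<exists>y\<in>h. lie x y \<noteq> 0) \<and>
     (\<forall>I. subspace I \<and> I \<subseteq> h \<and> (\<forall>x\<in>h. \<forall>y\<in>I. lie x y \<in> I) \<longrightarrow> I = {0} \<or> I = h)"

definition complexify :: "(real^7^7) set \<Rightarrow> (complex^7^7) set" where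
  "complexify S = {(\<chi> i j. Complex (A$i$j) (B$i$j)) | A B. A \<in> S \<and> B \<in> S}"

abbreviation g2C :: "(complex^7^7) set" where
  "g2C \<equiv> complexify g2"

definition nilpotent_elt :: "complex^7^7 \<Rightarrow> bool" where
  "nilpotent_elt X \<longleftrightarrow> X \<in> g2C \<and> (\<exists>k. \<forall>Y\<in>g2C. ((lie X) ^^ k) Y = 0)"

definition nilvariety :: "(complex^7^7) set" where
  "nilvariety = {X. nilpotent_elt X}"

text \<open>The complex group G2(C) = Aut(C^7, x), which acts on g2 (x) C as the adjoint group.\<close>
definition G2C :: "(complex^7^7) set" where
  "G2C = {g. invertible g \<and> (\<forall>x y. g *v cross7 x y = cross7 (g *v x) (g *v y))}"

definition adj_orbit :: "complex^7^7 \<Rightarrow> (complex^7^7) set" where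
  "adj_orbit N = {g ** N ** matrix_inv g | g. g \<in> G2C}"

definition principal_nilpotent :: "complex^7^7 \<Rightarrow> bool" where
  "principal_nilpotent N \<longleftrightarrow> nilpotent_elt N \<and> nilvariety \<subseteq> closure (adj_orbit N)"

definition principal_subalgebra :: "(real^7^7) set \<Rightarrow> bool" where
  "principal_subalgebra h \<longleftrightarrow> subalgebra h \<and> dim h = 3 \<and> simple_lie h \<and>
     (\<exists>N\<in>complexify h. principal_nilpotent N)"

definition adapted :: "(real^7^7) set \<Rightarrow> (real^7) set \<Rightarrow> bool" where
  "adapted h V \<longleftrightarrow> h = {a + b | a b. a \<in> h \<inter> h4 V \<and> b \<in> h \<inter> m4 V}"

end

theory Submission
  imports Defs
begin

text \<open>
  The symmetric pair \<open>(g2, h4 V)\<close> has rank two, and its restricted root system is of type \<open>G\<^sub>2\<close> with all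
  multiplicities one. Diagonalising \<open>d\<^sup>2\<close> on \<open>V\<close> for \<open>d \<in> m4 V\<close> gives orthonormal \<open>u\<^sub>1, u\<^sub>2, u\<^sub>3 = u\<^sub>1 \<times> u\<^sub>2\<close> in \<open>V\<close>
  and a unit vector \<open>l\<close> orthogonal to \<open>V\<close> with \<open>d u\<^sub>k = s\<^sub>k u\<^sub>k \<times> l\<close> and \<open>s\<^sub>1 + s\<^sub>2 + s\<^sub>3 = 0\<close>; the restricted roots are
  \<open>s\<^sub>k\<close> (short) and \<open>s\<^sub>i - s\<^sub>j\<close> (long).

  A triple subsystem \<open>S\<close> is stable under \<open>(ad H)\<^sup>2\<close> for \<open>H \<in> S\<close> and therefore splits along eigenvalues of roots.
  If \<open>S\<close> contains a Cartan subspace, its roots form a closed subsystem, which is proper only inside \<open>A\<^sub>2\<close> (long roots,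
  family 2) or \<open>A\<^sub>1 \<times> A\<^sub>1\<close> (family 4). If \<open>S\<close> contains a regular \<open>H\<close> but no Cartan subspace, every root vector in
  \<open>S\<close> would bring its coroot along, so \<open>S\<close> is the line through \<open>H\<close> unless two roots of different length agree on \<open>H\<close>;
  then \<open>H\<close> is proportional to \<open>(1, 2, -3)\<close> and \<open>S\<close> lies in a plane spanned by \<open>H\<close> and one further vector, which
  generates a principal subalgebra (family 1). If all elements are singular, quadratic constraints from \<open>[[x, H], x] \<in> S\<close>
  leave only families 2, 3 and 4.

  Conversely the members of the families have dimensions at most 3, and 5, 4, 4. The only inclusions that dimensions
  do not exclude are ruled out by looking at common kernels, and for family 1 by the fact that a principal nilpotent
  \<open>N\<close> satisfies \<open>N\<^sup>6 \<noteq> 0\<close> on \<open>\<complex>\<^sup>7\<close>, hence respects no direct sum decomposition.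

  Density of the principal orbit: a nilpotent complex derivation stabilises an isotropic flag, which a real automorphism
  moves to a standard one; this brings it into a fixed six-dimensional nilpotent algebra. There the elements with
  nonzero simple root coordinates are dense and form a single orbit, by unipotent elimination and a torus.
\<close>

section \<open>The cross product in coordinates\<close>

text \<open>Restricted roots can be read off only from diagonal elements, and different elements of
  one triple subsystem need different frames. So computations are made for the standard
  \<open>V0\<close>, any \<open>V\<close> is reached by an orthogonal automorphism built from three
  vectors, and the case split runs over the pairs \<open>(a, b)\<close> for which some element of
  \<open>S\<close> becomes \<open>D2 a b\<close> in some frame of \<open>V\<close>. Elements that
  are not diagonal in the frame at hand are tested by conditions that survive conjugation: a
  vanishing short root gives a kernel vector in \<open>V0\<close>, a vanishing long root a quartic
  relation on \<open>V0\<close>.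

  The constant 3/5 of family 1 is the condition that \<open>[[x, H], x]\<close> be a multiple of
  \<open>H = D2 1 2\<close>, where \<open>x\<close> combines the vectors of the two roots that agree
  on \<open>H\<close> up to sign.

  A gap lies between the definition of \<open>nilpotent_elt\<close>, which sees only the adjoint
  action, and the flags and sixth powers, which live on C^7. It is closed by a kernel vector
  \<open>w\<close> of \<open>X\<close>, which exists because \<open>X\<close> is skew of odd size:
  bracketing with \<open>X\<close> then acts on the derivation made from \<open>x\<close> and
  \<open>w\<close> through \<open>x\<close> alone.\<close>

lemma UNIV_7: "(UNIV::7 set) = {0,1,2,3,4,5,6}"
proof -
  have "x \<in> {0,1,2,3,4,5,6}" for x :: 7
  proof (cases x)
    case (of_int z)
    then have "z = 0 \<or> z = 1 \<or> z = 2 \<or> z = 3 \<or> z = 4 \<or> z = 5 \<or> z = 6" by auto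
    with of_int show ?thesis by auto
  qed
  then show ?thesis by blast
qed

lemma sum_7: "(\<Sum>t\<in>(UNIV::7 set). f t) = f 0 + f 1 + f 2 + f 3 + f 4 + f 5 + (f 6::'a::comm_monoid_add)"
  unfolding UNIV_7 by (simp add: add.assoc)

lemma forall_7: "(\<forall>t::7. P t) \<longleftrightarrow> P 0 \<and> P 1 \<and> P 2 \<and> P 3 \<and> P 4 \<and> P 5 \<and> P 6"
proof -
  have "(\<forall>t::7. P t) \<longleftrightarrow> (\<forall>t\<in>UNIV::7 set. P t)" by simp
  then show ?thesis unfolding UNIV_7 by simp
qed

lemma vec_eq_7: "(x::'a^7) = y \<longleftrightarrow> x$0 = y$0 \<and> x$1 = y$1 \<and> x$2 = y$2 \<and> x$3 = y$3 \<and> x$4 = y$4 \<and> x$5 = y$5 \<and> x$6 = y$6"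
  unfolding vec_eq_iff forall_7 ..

text \<open>Explicit tuples, nested for matrices, turn the identities below into finitely many
  polynomial identities between entries.\<close>

definition v7 :: "'a \<Rightarrow> 'a \<Rightarrow> 'a \<Rightarrow> 'a \<Rightarrow> 'a \<Rightarrow> 'a \<Rightarrow> 'a \<Rightarrow> 'a^7" where
  "v7 a b c d e f g = (\<chi> i. if i = 0 then a else if i = 1 then b else if i = 2 then c
     else if i = 3 then d else if i = 4 then e else if i = 5 then f else g)"

lemma v7_nth [simp]:
  "v7 a b c d e f g $ 0 = a" "v7 a b c d e f g $ 1 = b" "v7 a b c d e f g $ 2 = c"
  "v7 a b c d e f g $ 3 = d" "v7 a b c d e f g $ 4 = e" "v7 a b c d e f g $ 5 = f"
  "v7 a b c d e f g $ 6 = g"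
  by (simp_all add: v7_def)

lemma v7_eq_iff [simp]: "v7 a b c d e f g = v7 a' b' c' d' e' f' g' \<longleftrightarrow>
   a = a' \<and> b = b' \<and> c = c' \<and> d = d' \<and> e = e' \<and> f = f' \<and> g = g'"
  by (simp add: vec_eq_7)

lemma zero_v7: "0 = v7 0 0 0 0 0 0 0"
  by (simp add: vec_eq_7)

lemma v7_eq_0_iff [simp]: "v7 a b c d e f g = 0 \<longleftrightarrow>
   a = 0 \<and> b = 0 \<and> c = 0 \<and> d = 0 \<and> e = 0 \<and> f = 0 \<and> g = 0"
  by (simp add: vec_eq_7)

lemma v7_add [simp]: "v7 a b c d e f g + v7 a' b' c' d' e' f' g' = v7 (a+a') (b+b') (c+c') (d+d') (e+e') (f+f') (g+g')"
  by (simp add: vec_eq_7)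
lemma v7_diff [simp]: "v7 a b c d e f g - v7 a' b' c' d' e' f' g' = v7 (a-a') (b-b') (c-c') (d-d') (e-e') (f-f') (g-g')"
  by (simp add: vec_eq_7)
lemma v7_uminus [simp]: "- v7 a b c d e f g = v7 (-a) (-b) (-c) (-d) (-e) (-f) (-g)"
  by (simp add: vec_eq_7)
lemma v7_scaleR [simp]: "r *\<^sub>R v7 a b c d e f g = v7 (r *\<^sub>R a) (r *\<^sub>R b) (r *\<^sub>R c) (r *\<^sub>R d) (r *\<^sub>R e) (r *\<^sub>R f) (r *\<^sub>R g)"
  by (simp add: vec_eq_7)
lemma v7_smult [simp]: "r *s v7 a b c d e f g = v7 (r * a) (r * b) (r * c) (r * d) (r * e) (r * f) (r * g)"
  by (simp add: vec_eq_7)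

lemma axis_v7:
  "axis 0 r = v7 r 0 0 0 0 0 0" "axis 1 r = v7 0 r 0 0 0 0 0" "axis 2 r = v7 0 0 r 0 0 0 0"
  "axis 3 r = v7 0 0 0 r 0 0 0" "axis 4 r = v7 0 0 0 0 r 0 0" "axis 5 r = v7 0 0 0 0 0 r 0"
  "axis 6 r = v7 0 0 0 0 0 0 r"
  by (simp_all add: vec_eq_7 axis_def)

lemma matrix_vector_mult_v7:
  "v7 r0 r1 r2 r3 r4 r5 r6 *v x = v7 (\<Sum>k\<in>UNIV. r0$k * x$k) (\<Sum>k\<in>UNIV. r1$k * x$k) (\<Sum>k\<in>UNIV. r2$k * x$k)
     (\<Sum>k\<in>UNIV. r3$k * x$k) (\<Sum>k\<in>UNIV. r4$k * x$k) (\<Sum>k\<in>UNIV. r5$k * x$k) (\<Sum>k\<in>UNIV. r6$k * x$k)"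
  by (simp add: vec_eq_7 matrix_vector_mult_def)

lemma matrix_mult_v7:
  "v7 r0 r1 r2 r3 r4 r5 r6 ** B = v7 (r0 v* B) (r1 v* B) (r2 v* B) (r3 v* B) (r4 v* B) (r5 v* B) (r6 v* B)"
  by (simp add: vec_eq_7 matrix_matrix_mult_def vector_matrix_mult_def mult.commute)

lemma vector_matrix_mult_v7:
  "v7 a b c d e f g v* v7 r0 r1 r2 r3 r4 r5 (r6::'a::comm_semiring_1^7) = a *s r0 + b *s r1 + c *s r2 + d *s r3 + e *s r4 + f *s r5 + g *s r6"
  by (simp add: vec_eq_7 vector_matrix_mult_def sum_7 mult.commute)

lemma cross7_nth: "cross7 x y $ k = (x$(k+4) * y$(k+5) - x$(k+5) * y$(k+4))
    + (x$(k+1) * y$(k+3) - x$(k+3) * y$(k+1)) + (x$(k+2) * y$(k+6) - x$(k+6) * y$(k+2))"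
proof -
  have e: "(t + 3 = k) = (t = k + 4)" "(t + 1 = k) = (t = k + 6)" for t :: 7
  proof -
    have z: "(7::7) = 0" by simp
    have "k + 4 + 3 = k" using z by simp
    then have "t + 3 = k \<Longrightarrow> t = k + 4" by (metis add_right_cancel)
    moreover have "k + 4 + 3 = k" using z by simp
    ultimately show "(t + 3 = k) = (t = k + 4)" by auto
    have "k + 6 + 1 = k" using z by simp
    then show "(t + 1 = k) = (t = k + 6)" by (metis add_right_cancel)
  qed
  have d: "(\<Sum>t\<in>(UNIV::7 set). f t * (if P t then 1 else 0)) = f u" if "\<And>t. P t = (t = u)" for f :: "7 \<Rightarrow> 'a" and P u
    by (simp add: that if_distrib[of "\<lambda>z. _ * z"] cong: if_cong)
  have s: "(\<Sum>t\<in>(UNIV::7 set). f t * (if k = t + 3 then 1 else 0)) = f (k+4)"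
     "(\<Sum>t\<in>(UNIV::7 set). f t * (if k = t + 1 then 1 else 0)) = f (k+6)"
     "(\<Sum>t\<in>(UNIV::7 set). f t * (if k = t then 1 else 0)) = f k" for f :: "7 \<Rightarrow> 'a"
    by (rule d, metis e)+
  have ax: "axis t 1 $ k = (if k = t then 1 else (0::'a))" for t
    by (simp add: axis_def)
  have r: "k + 4 + 1 = k + 5" "k + 6 + 1 = k" "k + 6 + 3 = k + 2" "k + 4 + 3 = k"
    by (simp_all only: add.assoc) simp_all
  show ?thesis
    unfolding cross7_def sum_component vector_add_component vector_smult_component ax sum.distrib s r
    by (simp only: add.assoc)
qed

lemma cross7_v7: "cross7 x y = v7
   (x$4 * y$5 - x$5 * y$4 + (x$1 * y$3 - x$3 * y$1) + (x$2 * y$6 - x$6 * y$2))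
   (x$5 * y$6 - x$6 * y$5 + (x$2 * y$4 - x$4 * y$2) + (x$3 * y$0 - x$0 * y$3))
   (x$6 * y$0 - x$0 * y$6 + (x$3 * y$5 - x$5 * y$3) + (x$4 * y$1 - x$1 * y$4))
   (x$0 * y$1 - x$1 * y$0 + (x$4 * y$6 - x$6 * y$4) + (x$5 * y$2 - x$2 * y$5))
   (x$1 * y$2 - x$2 * y$1 + (x$5 * y$0 - x$0 * y$5) + (x$6 * y$3 - x$3 * y$6))
   (x$2 * y$3 - x$3 * y$2 + (x$6 * y$1 - x$1 * y$6) + (x$0 * y$4 - x$4 * y$0))
   (x$3 * y$4 - x$4 * y$3 + (x$0 * y$2 - x$2 * y$0) + (x$1 * y$5 - x$5 * y$1))"
proof -
  have n: "(7::7) = 0" "(8::7) = 1" "(9::7) = 2" "(10::7) = 3" "(11::7) = 4" "(12::7) = 5" by simp_all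
  show ?thesis unfolding vec_eq_7 cross7_nth by (simp add: n)
qed

text \<open>Bilinear, not Hermitian, over the complex numbers: null vectors exist there, and they
  carry the flags used for nilpotent elements.\<close>

definition dot7 :: "'a::comm_ring_1^7 \<Rightarrow> 'a^7 \<Rightarrow> 'a" where
  "dot7 x y = x$0*y$0 + x$1*y$1 + x$2*y$2 + x$3*y$3 + x$4*y$4 + x$5*y$5 + x$6*y$6"

lemma inner_eq_dot7: "inner x y = dot7 x (y::real^7)"
  by (simp add: inner_vec_def sum_7 dot7_def)

section \<open>Identities of the cross product and its bilinear form\<close>

lemma cross7_add_left: "cross7 (x + y) z = cross7 x z + cross7 y z"
  and cross7_add_right: "cross7 x (y + z) = cross7 x y + cross7 x z"
  and cross7_diff_left: "cross7 (x - y) z = cross7 x z - cross7 y z"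
  and cross7_diff_right: "cross7 x (y - z) = cross7 x y - cross7 x z"
  and cross7_smult_left: "cross7 (c *s x) y = c *s cross7 x y"
  and cross7_smult_right: "cross7 x (c *s y) = c *s cross7 x y"
  and cross7_minus_left: "cross7 (- x) y = - cross7 x y"
  and cross7_minus_right: "cross7 x (- y) = - cross7 x y"
  and cross7_anticomm: "cross7 x y = - cross7 y x"
  and cross7_self: "cross7 x x = 0"
  and cross7_0_left: "cross7 0 y = 0" and cross7_0_right: "cross7 x 0 = 0"
  unfolding cross7_v7 by (simp_all add: algebra_simps)

lemma dot7_add_left: "dot7 (x + y) z = dot7 x z + dot7 y z"
  and dot7_add_right: "dot7 x (y + z) = dot7 x y + dot7 x z"
  and dot7_diff_left: "dot7 (x - y) z = dot7 x z - dot7 y z"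
  and dot7_diff_right: "dot7 x (y - z) = dot7 x y - dot7 x z"
  and dot7_smult_left: "dot7 (c *s x) y = c * dot7 x y"
  and dot7_smult_right: "dot7 x (c *s y) = c * dot7 x y"
  and dot7_minus_left: "dot7 (- x) y = - dot7 x y"
  and dot7_minus_right: "dot7 x (- y) = - dot7 x y"
  and dot7_0_left: "dot7 0 y = 0" and dot7_0_right: "dot7 x 0 = 0"
  and dot7_commute: "dot7 x y = dot7 y x"
  unfolding dot7_def by (simp_all add: algebra_simps)

lemma dot7_cross7: "dot7 (cross7 x y) z = dot7 x (cross7 y z)"
  unfolding cross7_v7 dot7_def by (simp add: algebra_simps)

lemma cross7_cross7_same: "cross7 x (cross7 x y) = dot7 x y *s x - dot7 x x *s y"
  unfolding cross7_v7 dot7_def by (simp add: vec_eq_7 algebra_simps)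

lemma cross7_cross7_polar:
  "cross7 x (cross7 y z) + cross7 y (cross7 x z) = dot7 x z *s y + dot7 y z *s x - (2 * dot7 x y) *s z"
proof -
  have "cross7 (x + y) (cross7 (x + y) z) = dot7 (x + y) z *s (x + y) - dot7 (x + y) (x + y) *s z"
    by (rule cross7_cross7_same)
  then show ?thesis
    using cross7_cross7_same[of x z] cross7_cross7_same[of y z]
    by (simp add: cross7_add_left cross7_add_right dot7_add_left dot7_add_right dot7_commute[of y x]
        vector_add_ldistrib vec_eq_7 algebra_simps)
qed

lemma cross7_cross7_orth: "dot7 x y = 0 \<Longrightarrow> cross7 x (cross7 x y) = - (dot7 x x *s y)"
  by (simp add: cross7_cross7_same)

lemma cross7_swap: "dot7 x y = 0 \<Longrightarrow> dot7 x z = 0 \<Longrightarrow> dot7 y z = 0 \<Longrightarrow>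
   cross7 x (cross7 y z) = - cross7 y (cross7 x z)"
  using cross7_cross7_polar[of x y z] by (simp add: eq_neg_iff_add_eq_0)

lemma dot7_cross7_self: "dot7 x (cross7 x y) = 0" "dot7 x (cross7 y x) = 0"
  by (simp_all add: dot7_cross7[symmetric] cross7_self dot7_0_left) 
     (metis cross7_anticomm cross7_self dot7_0_left dot7_cross7 dot7_minus_right neg_0_equal_iff_equal)

text \<open>An orthonormal pair and its product multiply like the quaternion units.\<close>

lemma cross7_triple:
  assumes "dot7 x y = 0" "dot7 x x = 1" "dot7 y y = 1" "cross7 x y = z"
  shows "cross7 y z = x" "cross7 z x = y" "dot7 z z = 1" "dot7 x z = 0" "dot7 y z = 0"
proof -
  have yx: "dot7 y x = 0" using assms(1) by (simp add: dot7_commute)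
  have "cross7 y z = - cross7 y (cross7 y x)"
    using cross7_anticomm[of x y] assms(4) by (simp add: cross7_minus_right)
  then show 1: "cross7 y z = x" using assms yx by (simp add: cross7_cross7_orth)
  have "cross7 z x = - cross7 x (cross7 x y)"
    by (simp add: assms(4)) (rule cross7_anticomm)
  then show "cross7 z x = y" unfolding cross7_cross7_orth[OF assms(1)] using assms(2) by simp
  have "dot7 z z = dot7 (cross7 x y) z" by (simp add: assms(4))
  also have "\<dots> = 1" unfolding dot7_cross7 1 using assms by simp
  finally show "dot7 z z = 1" .
  show "dot7 x z = 0" "dot7 y z = 0" using dot7_cross7_self assms(4) by metis+
qed

section \<open>Automorphisms from basic triples\<close>

definition frame7 :: "'a::comm_ring_1^7 \<Rightarrow> 'a^7 \<Rightarrow> 'a^7 \<Rightarrow> 'a^7^7" where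
  "frame7 a b c = transpose (v7 a b c (cross7 a b) (cross7 b c) (cross7 c (cross7 a b)) (cross7 a c))"

definition aut7 :: "'a::comm_ring_1^7^7 \<Rightarrow> bool" where
  "aut7 g \<longleftrightarrow> transpose g ** g = mat 1 \<and> (\<forall>x y. g *v cross7 x y = cross7 (g *v x) (g *v y))"

definition basic7 :: "'a::comm_ring_1^7 \<Rightarrow> 'a^7 \<Rightarrow> 'a^7 \<Rightarrow> bool" where
  "basic7 a b c \<longleftrightarrow> dot7 a a = 1 \<and> dot7 b b = 1 \<and> dot7 c c = 1 \<and> dot7 a b = 0 \<and> dot7 a c = 0 \<and> dot7 b c = 0
     \<and> dot7 (cross7 a b) c = 0"

lemma transpose_v7_mult: "transpose (v7 r0 r1 r2 r3 r4 r5 r6) *v x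
   = x$0 *s r0 + x$1 *s r1 + x$2 *s r2 + x$3 *s r3 + x$4 *s r4 + x$5 *s r5 + x$6 *s (r6::'a::comm_ring_1^7)"
  by (simp add: vec_eq_iff matrix_vector_mult_def transpose_def sum_7 mult.commute)

lemma transpose_v7_orthogonal: "transpose (transpose (v7 r0 r1 r2 r3 r4 r5 r6)) ** transpose (v7 r0 r1 r2 r3 r4 r5 (r6::'a::comm_ring_1^7)) =
  (let d = (\<lambda>x. v7 (dot7 x r0) (dot7 x r1) (dot7 x r2) (dot7 x r3) (dot7 x r4) (dot7 x r5) (dot7 x r6)) in
    v7 (d r0) (d r1) (d r2) (d r3) (d r4) (d r5) (d r6))"
  by (simp add: vec_eq_7 Let_def matrix_matrix_mult_def transpose_def sum_7 dot7_def)

lemma mat_v7: "mat r = v7 (v7 r 0 0 0 0 0 0) (v7 0 r 0 0 0 0 0) (v7 0 0 r 0 0 0 0) (v7 0 0 0 r 0 0 0)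
   (v7 0 0 0 0 r 0 0) (v7 0 0 0 0 0 r 0) (v7 0 0 0 0 0 0 r)"
  by (simp add: vec_eq_7 mat_def)

text \<open>The columns are forced by e3 = e0 x e1, e4 = e1 x e2, e5 = e2 x e3, e6 = e0 x e2. Three
  orthogonal vectors anti-associate (\<open>cross7_swap\<close>), which supplies the products not
  fixed by this definition. Each of the seven lines of the Fano plane then gets its cyclic products
  from \<open>cross7_triple\<close>, and orthonormality is read off the completed table.\<close>

lemma aut7_frame7:
  fixes a b c :: "'a::comm_ring_1^7"
  assumes "basic7 a b c"
  shows "aut7 (frame7 a b c)"
proof -
  note b = assms[unfolded basic7_def]
  define f3 f4 f5 f6 where f: "f3 = cross7 a b" "f4 = cross7 b c" "f5 = cross7 c f3" "f6 = cross7 a c"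
  have aa: "dot7 a a = 1" "dot7 b b = 1" "dot7 c c = 1" "dot7 a b = 0" "dot7 a c = 0" "dot7 b c = 0" "dot7 f3 c = 0"
    "dot7 b a = 0" "dot7 c a = 0" "dot7 c b = 0" "dot7 c f3 = 0"
    using b by (simp_all add: f dot7_commute[of b a] dot7_commute[of c a] dot7_commute[of c b] dot7_commute[of c "cross7 a b"])
  note t0 = cross7_triple[OF aa(4,1,2) f(1)[symmetric]]
  note t1 = cross7_triple[OF aa(6,2,3) f(2)[symmetric]]
  note t2 = cross7_triple[OF aa(11,3) t0(3) f(3)[symmetric]]
  note t6 = cross7_triple[OF aa(5,1,3) f(4)[symmetric]]
  have m: "cross7 y x = - z" if "cross7 x y = z" for x y z :: "'a^7"
    using that cross7_anticomm by metis
  have af4: "dot7 a f4 = 0" by (simp add: f(2) dot7_cross7[symmetric] aa f(1)[symmetric])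
  have bf6: "dot7 b f6 = 0" using aa(7)
    by (metis af4 cross7_anticomm dot7_commute dot7_cross7 dot7_minus_left f(2) f(4) neg_0_equal_iff_equal)
  have f5a: "f5 = cross7 a f4"
    using cross7_swap[of c a b] aa by (simp add: f cross7_anticomm[of c b] cross7_minus_right)
  have f5b: "f5 = - cross7 b f6"
    using cross7_swap[of a b c] aa f5a by (simp add: f)
  have t3: "cross7 f3 f4 = f6"
  proof -
    have "cross7 f3 f4 = - cross7 b (cross7 f3 c)"
      unfolding f(2) by (rule cross7_swap) (use aa t0(5) dot7_commute in metis)+
    also have "cross7 f3 c = cross7 b f6"
      using f5b m[OF f(3)[symmetric]] by simp
    finally show ?thesis using bf6 aa by (simp add: cross7_cross7_orth)
  qed
  have f4a: "dot7 f4 a = 0" and f6b: "dot7 f6 b = 0" using af4 bf6 by (simp_all add: dot7_commute)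
  have t4: "cross7 f4 f5 = a"
    using t1(3) f4a cross7_cross7_orth[of f4 a]
    by (simp add: f5a cross7_anticomm[of a f4] cross7_minus_right)
  have t5: "cross7 f5 f6 = b"
    using t6(3) f6b cross7_cross7_orth[of f6 b]
    by (simp add: f5b cross7_minus_left cross7_anticomm[of b f6] cross7_anticomm[of "cross7 f6 b" f6])
  have f34: "dot7 f3 f4 = 0"
    by (simp add: f(1) dot7_cross7 t1 aa f cross7_cross7_orth dot7_minus_right)
  note T3 = cross7_triple[OF f34 t0(3) t1(3) t3]
  have f45: "dot7 f4 f5 = 0" unfolding f5a by (rule dot7_cross7_self)
  note T4 = cross7_triple[OF f45 t1(3) t2(3) t4]
  have f56: "dot7 f5 f6 = 0" unfolding f5b dot7_minus_left by (simp add: dot7_commute[of _ f6] dot7_cross7_self)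
  note T5 = cross7_triple[OF f56 t2(3) t6(3) t5]
  note tt = f(1)[symmetric] f(2)[symmetric] f(3)[symmetric] f(4)[symmetric] t0(1,2) t1(1,2) t2(1,2) t6(1,2) t3 T3(1,2) t4 T4(1,2) t5 T5(1,2)
  note mm = tt[THEN m]
  have fr: "frame7 a b c = transpose (v7 a b c f3 f4 f5 f6)"
    by (simp add: frame7_def f)
  have dd: "dot7 x y = 0" if "cross7 x z = y" for x y z :: "'a^7"
    using that dot7_cross7_self by metis
  note dots = tt[THEN dd] mm[THEN dd, unfolded dot7_minus_right neg_equal_0_iff_equal]
  have "transpose (frame7 a b c) ** frame7 a b c = mat 1"
    unfolding fr transpose_v7_orthogonal Let_def mat_v7
    using dots aa t0(3) t1(3) t2(3) t6(3) by (simp add: dot7_commute)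
  moreover have "frame7 a b c *v cross7 x y = cross7 (frame7 a b c *v x) (frame7 a b c *v y)" for x y
    unfolding fr transpose_v7_mult
    unfolding cross7_v7[of x y] v7_nth
    by (simp only: cross7_add_left cross7_add_right cross7_smult_left cross7_smult_right tt mm cross7_self)
      (simp add: vec_eq_iff algebra_simps)
  ultimately show ?thesis unfolding aut7_def by blast
qed

section \<open>Derivations\<close>

definition der7 :: "'a::comm_ring_1^7^7 \<Rightarrow> bool" where
  "der7 d \<longleftrightarrow> (\<forall>x y. d *v cross7 x y = cross7 (d *v x) y + cross7 x (d *v y))"

lemma g2_iff_der7: "d \<in> g2 \<longleftrightarrow> der7 d"
  by (simp add: g2_def der7_def)

text \<open>Differentiating \<open>cross7_cross7_same\<close> in two ways leaves a multiple of
  \<open>x\<close> equal to \<open>2 * dot7 x (d *v x)\<close> times \<open>y\<close>, for every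
  \<open>y\<close>. A nonzero factor would make all vectors parallel to \<open>x\<close>; so it
  vanishes, and polarisation gives skewness.\<close>

lemma der7_skew_vec:
  fixes d :: "real^7^7"
  assumes "der7 d"
  shows "dot7 (d *v x) y = - dot7 x (d *v y)"
proof -
  have key: "(dot7 (d *v x) y + dot7 x (d *v y)) *s x = (2 * dot7 x (d *v x)) *s y" for x y
  proof -
    have D: "d *v cross7 u v = cross7 (d *v u) v + cross7 u (d *v v)" for u v
      using assms by (simp add: der7_def)
    have "d *v cross7 x (cross7 x y) =
        cross7 (d *v x) (cross7 x y) + cross7 x (cross7 (d *v x) y) + cross7 x (cross7 x (d *v y))"
      by (simp add: D cross7_add_right)
    also have "\<dots> = dot7 (d *v x) y *s x + dot7 x y *s (d *v x) - (2 * dot7 x (d *v x)) *s y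
        + (dot7 x (d *v y) *s x - dot7 x x *s (d *v y))"
      using cross7_cross7_polar[of "d *v x" x y] cross7_cross7_same[of x "d *v y"]
      by (simp add: dot7_commute[of "d *v x" x])
    also have "d *v cross7 x (cross7 x y) = dot7 x y *s (d *v x) - dot7 x x *s (d *v y)"
      by (simp add: cross7_cross7_same matrix_vector_mult_diff_distrib vector_scalar_commute)
    finally show ?thesis
      by (simp add: algebra_simps vec_eq_iff)
  qed
  have self: "dot7 x (d *v x) = 0" for x
  proof (rule ccontr)
    define t where "t = 2 * dot7 x (d *v x)"
    assume "dot7 x (d *v x) \<noteq> 0"
    then have t: "t \<noteq> 0" by (simp add: t_def)
    have a: "(dot7 (d *v x) (axis i 1) + dot7 x (d *v axis i 1)) * x$j = t * axis i 1 $ j" for i j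
      using arg_cong[OF key[of x "axis i 1"], of "\<lambda>z. z $ j"] unfolding t_def by (simp add: algebra_simps)
    have *: "x$j = 0" if "j \<noteq> i" for i j
    proof -
      have "dot7 (d *v x) (axis i 1) + dot7 x (d *v axis i 1) \<noteq> 0"
        using a[of i i] t by (auto simp: axis_def)
      then show ?thesis using a[of i j] that by (simp add: axis_def)
    qed
    have "x$j = 0" for j
      using *[of j 0] *[of j 1] by (cases "j = 0") auto
    then have "x = 0" by (simp add: vec_eq_iff)
    then show False using t by (simp add: t_def dot7_0_left)
  qed
  have "dot7 (x + y) (d *v (x + y)) = 0" by (rule self)
  then show ?thesis using self[of x] self[of y]
    by (simp add: matrix_vector_right_distrib dot7_add_left dot7_add_right dot7_commute[of "d *v x"])
qed

lemma matrix_vector_axis: "d *v axis i (1::'a::comm_ring_1) = column i d"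
  by (simp add: vec_eq_iff matrix_vector_mult_def axis_def column_def if_distrib cong: if_cong)

lemma dot7_axis: "dot7 x (axis i 1) = x $ i"
proof -
  have "\<forall>i. dot7 x (axis i 1) = x $ i"
    unfolding forall_7 dot7_def by (simp add: axis_v7)
  then show ?thesis by blast
qed

lemma der7_skew:
  fixes d :: "real^7^7"
  assumes "der7 d"
  shows "d$j$i = - d$i$j"
  using der7_skew_vec[OF assms, of "axis i 1" "axis j 1"]
  by (simp add: dot7_axis dot7_commute[of "axis i 1"] matrix_vector_axis column_def)

text \<open>One relation for each \<open>k\<close>: the entries \<open>d$i$j\<close> over the three
  pairs with e_i x e_j = e_k add up to zero. These seven relations cut the 21 entries of a skew
  matrix down to 14.\<close>

lemma der7_relations:
  fixes d :: "real^7^7"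
  assumes "der7 d"
  shows "d$1$3 + d$2$6 + d$4$5 = 0" "d$2$4 + d$3$0 + d$5$6 = 0" "d$3$5 + d$4$1 + d$6$0 = 0"
    "d$4$6 + d$5$2 + d$0$1 = 0" "d$5$0 + d$6$3 + d$1$2 = 0" "d$6$1 + d$0$4 + d$2$3 = 0" "d$0$2 + d$1$5 + d$3$4 = 0"
proof -
  have D: "d *v cross7 (axis i 1) (axis j 1) = cross7 (d *v axis i 1) (axis j 1) + cross7 (axis i 1) (d *v axis j 1)" for i j
    using assms by (simp add: der7_def)
  have e: "(d *v cross7 (axis i 1) (axis j 1)) $ k = (cross7 (d *v axis i 1) (axis j 1) + cross7 (axis i 1) (d *v axis j 1)) $ k" for i j k
    by (simp add: D)
  note sk = der7_skew[OF assms]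
  note ee = matrix_vector_mult_def sum_7 cross7_v7 axis_v7
  show "d$1$3 + d$2$6 + d$4$5 = 0" using e[of 1 2 5] sk[of 4 5] sk[of 1 3] sk[of 2 6] by (simp add: ee)
  show "d$2$4 + d$3$0 + d$5$6 = 0" using e[of 2 3 6] sk[of 5 6] sk[of 2 4] sk[of 3 0] by (simp add: ee)
  show "d$3$5 + d$4$1 + d$6$0 = 0" using e[of 3 4 0] sk[of 6 0] sk[of 3 5] sk[of 4 1] by (simp add: ee)
  show "d$4$6 + d$5$2 + d$0$1 = 0" using e[of 4 5 1] sk[of 0 1] sk[of 4 6] sk[of 5 2] by (simp add: ee)
  show "d$5$0 + d$6$3 + d$1$2 = 0" using e[of 5 6 2] sk[of 1 2] sk[of 5 0] sk[of 6 3] by (simp add: ee)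
  show "d$6$1 + d$0$4 + d$2$3 = 0" using e[of 6 0 3] sk[of 2 3] sk[of 6 1] sk[of 0 4] by (simp add: ee)
  show "d$0$2 + d$1$5 + d$3$4 = 0" using e[of 0 1 4] sk[of 3 4] sk[of 0 2] sk[of 1 5] by (simp add: ee)
qed

text \<open>The general derivation, parametrised by fourteen of its entries below the diagonal.\<close>
definition G14 where
  "G14 d40 d42 d43 d50 d51 d52 d53 d54 d60 d61 d62 d63 d64 d65 =
    v7 (v7 0 (d64 - d52) (d43 + d51) (- d42 - d65) (- d40) (- d50) (- d60))
       (v7 (d52 - d64) 0 (- d50 - d63) (d54 + d62) (d60 - d53) (- d51) (- d61))
       (v7 (- d43 - d51) (d50 + d63) 0 (d40 - d61) (- d42) (- d52) (- d62))
       (v7 (d42 + d65) (- d54 - d62) (d61 - d40) 0 (- d43) (- d53) (- d63))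
       (v7 d40 (d53 - d60) d42 d43 0 (- d54) (- d64))
       (v7 d50 d51 d52 d53 d54 0 (- d65))
       (v7 d60 d61 d62 d63 d64 d65 (0::'a::comm_ring_1))"

lemma der7_G14: "der7 (G14 d40 d42 d43 d50 d51 d52 d53 d54 d60 d61 d62 d63 d64 d65)"
  unfolding der7_def G14_def
  by (simp add: matrix_vector_mult_v7 sum_7 cross7_v7) (simp add: algebra_simps)

lemma der7_imp_G14:
  fixes d :: "real^7^7"
  assumes "der7 d"
  shows "d = G14 (d$4$0) (d$4$2) (d$4$3) (d$5$0) (d$5$1) (d$5$2) (d$5$3) (d$5$4) (d$6$0) (d$6$1) (d$6$2) (d$6$3) (d$6$4) (d$6$5)"
proof -
  note sk = der7_skew[OF assms]
  note r = der7_relations[OF assms]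
  have z: "d$i$i = 0" for i using sk[of i i] by simp
  show ?thesis
    unfolding G14_def vec_eq_7 v7_nth
    using r by (simp add: z sk[of 0 1] sk[of 0 2] sk[of 0 3] sk[of 0 4] sk[of 0 5] sk[of 0 6] 
       sk[of 1 2] sk[of 1 3] sk[of 1 4] sk[of 1 5] sk[of 1 6] sk[of 2 3] sk[of 2 4] sk[of 2 5] sk[of 2 6]
       sk[of 3 4] sk[of 3 5] sk[of 3 6] sk[of 4 5] sk[of 4 6] sk[of 5 6])
qed

lemma matrix_mult_diff_left: "(A::'a::comm_ring_1^7^7) ** (B - C) = A ** B - A ** C"
  and matrix_mult_diff_right: "(B - C) ** (A::'a::comm_ring_1^7^7) = B ** A - C ** A"
  by (simp_all add: vec_eq_iff matrix_matrix_mult_def algebra_simps sum_subtractf)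

lemma lie_jacobi: "lie (lie x y) z = lie (lie x z) y - lie (lie y z) (x::'a::comm_ring_1^7^7)"
  by (simp add: lie_def matrix_mult_diff_left matrix_mult_diff_right matrix_mul_assoc)

section \<open>The standard symmetric pair\<close>

text \<open>The span of the axes 0, 1, 3, closed because these indices form a line of the Fano
  plane.\<close>

definition V0 :: "(real^7) set" where
  "V0 = {x. x$2 = 0 \<and> x$4 = 0 \<and> x$5 = 0 \<and> x$6 = 0}"

lemma perp_V0: "perp V0 = {x. x$0 = 0 \<and> x$1 = 0 \<and> x$3 = 0}"
proof -
  have "x$0 = 0 \<and> x$1 = 0 \<and> x$3 = 0" if "\<forall>v\<in>V0. inner v x = 0" for x
  proof -
    have "axis 0 1 \<in> V0" "axis 1 1 \<in> V0" "axis 3 1 \<in> V0" by (simp_all add: V0_def axis_v7)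
    then have "inner (axis 0 1) x = 0" "inner (axis 1 1) x = 0" "inner (axis 3 1) x = 0" using that by blast+
    then show ?thesis by (simp add: inner_axis')
  qed
  then show ?thesis by (auto simp: perp_def V0_def inner_eq_dot7 dot7_def)
qed

text \<open>
  With \<open>u\<^sub>1, u\<^sub>2, u\<^sub>3, l\<close> the basis vectors of index 0, 1, 3, 2, the numbers \<open>s1, s2\<close> are coordinates on a Cartan
  subspace, \<open>pk\<close> belongs to the short root \<open>s\<^sub>k\<close>, and \<open>q1, q2, q3\<close> to the long roots
  \<open>s\<^sub>2 - s\<^sub>3, s\<^sub>1 - s\<^sub>3, s\<^sub>1 - s\<^sub>2\<close>, where \<open>s\<^sub>3 = - s\<^sub>1 - s\<^sub>2\<close>.
\<close>
definition M8 :: "real \<Rightarrow> real \<Rightarrow> real \<Rightarrow> real \<Rightarrow> real \<Rightarrow> real \<Rightarrow> real \<Rightarrow> real \<Rightarrow> real^7^7" where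
  "M8 s1 s2 p1 q1 p2 q2 p3 q3 =
    v7 (v7 0 0 (2*p1) 0 (- p3 - q3) (- p2 - q2) (- s1))
       (v7 0 0 (- 2*p2) 0 (- s2) (- p1 - q1) (p3 - q3))
       (v7 (- 2*p1) (2*p2) 0 (2*p3) 0 0 0)
       (v7 0 0 (- 2*p3) 0 (q1 - p1) (- s1 - s2) (q2 - p2))
       (v7 (p3 + q3) s2 0 (p1 - q1) 0 0 0)
       (v7 (p2 + q2) (p1 + q1) 0 (s1 + s2) 0 0 0)
       (v7 s1 (q3 - p3) 0 (p2 - q2) 0 0 0)"

lemma M8_mult: "M8 s1 s2 p1 q1 p2 q2 p3 q3 *v x = v7
   (2*p1 * x$2 - (p3 + q3) * x$4 - (p2 + q2) * x$5 - s1 * x$6)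
   (- 2*p2 * x$2 - s2 * x$4 - (p1 + q1) * x$5 + (p3 - q3) * x$6)
   (- 2*p1 * x$0 + 2*p2 * x$1 + 2*p3 * x$3)
   (- 2*p3 * x$2 + (q1 - p1) * x$4 - (s1 + s2) * x$5 + (q2 - p2) * x$6)
   ((p3 + q3) * x$0 + s2 * x$1 + (p1 - q1) * x$3)
   ((p2 + q2) * x$0 + (p1 + q1) * x$1 + (s1 + s2) * x$3)
   (s1 * x$0 + (q3 - p3) * x$1 + (p2 - q2) * x$3)"
  unfolding M8_def matrix_vector_mult_v7 by (simp add: sum_7 algebra_simps)

lemma m4_V0: "d \<in> m4 V0 \<longleftrightarrow> (\<exists>s1 s2 p1 q1 p2 q2 p3 q3. d = M8 s1 s2 p1 q1 p2 q2 p3 q3)"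
proof
  assume d: "d \<in> m4 V0"
  then have "der7 d" by (simp add: m4_def g2_iff_der7)
  from der7_imp_G14[OF this] obtain d40 d42 d43 d50 d51 d52 d53 d54 d60 d61 d62 d63 d64 d65
    where G: "d = G14 d40 d42 d43 d50 d51 d52 d53 d54 d60 d61 d62 d63 d64 d65" by blast
  have a: "axis 0 1 \<in> V0" "axis 1 1 \<in> V0" "axis 3 1 \<in> V0" "axis 2 1 \<in> perp V0" "axis 4 1 \<in> perp V0" "axis 5 1 \<in> perp V0" "axis 6 1 \<in> perp V0"
    unfolding perp_V0 by (simp_all add: V0_def axis_v7)
  have "d *v axis 2 1 \<in> V0" "d *v axis 4 1 \<in> V0" "d *v axis 5 1 \<in> V0" 
    using d a by (simp_all add: m4_def)
  then have "d42 = 0 \<and> d52 = 0 \<and> d62 = 0 \<and> d54 = 0 \<and> d64 = 0 \<and> d65 = 0"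
    unfolding G G14_def V0_def by (simp add: matrix_vector_axis column_def)
  then have "d = M8 d60 (d53 - d60) ((d51 + d43)/2) ((d51 - d43)/2) ((d50 + d63)/2) ((d50 - d63)/2) ((d40 - d61)/2) ((d40 + d61)/2)"
    unfolding G G14_def M8_def by (simp add: field_simps)
  then show "\<exists>s1 s2 p1 q1 p2 q2 p3 q3. d = M8 s1 s2 p1 q1 p2 q2 p3 q3" by blast
next
  assume "\<exists>s1 s2 p1 q1 p2 q2 p3 q3. d = M8 s1 s2 p1 q1 p2 q2 p3 q3"
  then obtain s1 s2 p1 q1 p2 q2 p3 q3 where d: "d = M8 s1 s2 p1 q1 p2 q2 p3 q3" by blast
  have "d = G14 (p3 + q3) 0 (p1 - q1) (p2 + q2) (p1 + q1) 0 (s1 + s2) 0 s1 (q3 - p3) 0 (p2 - q2) 0 0"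
    unfolding d M8_def G14_def by simp
  then have "d \<in> g2" using der7_G14 g2_iff_der7 by metis
  then show "d \<in> m4 V0" unfolding m4_def perp_V0 
    by (simp add: V0_def d M8_mult)
qed

lemma M8_in_m4: "M8 s1 s2 p1 q1 p2 q2 p3 q3 \<in> m4 V0"
  using m4_V0 by blast

lemma M8_add: "M8 s1 s2 p1 q1 p2 q2 p3 q3 + M8 s1' s2' p1' q1' p2' q2' p3' q3'
    = M8 (s1 + s1') (s2 + s2') (p1 + p1') (q1 + q1') (p2 + p2') (q2 + q2') (p3 + p3') (q3 + q3')"
  and M8_diff: "M8 s1 s2 p1 q1 p2 q2 p3 q3 - M8 s1' s2' p1' q1' p2' q2' p3' q3'
    = M8 (s1 - s1') (s2 - s2') (p1 - p1') (q1 - q1') (p2 - p2') (q2 - q2') (p3 - p3') (q3 - q3')"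
  and M8_scaleR: "r *\<^sub>R M8 s1 s2 p1 q1 p2 q2 p3 q3 = M8 (r * s1) (r * s2) (r * p1) (r * q1) (r * p2) (r * q2) (r * p3) (r * q3)"
  and M8_0: "M8 0 0 0 0 0 0 0 0 = 0"
  unfolding M8_def by (simp_all add: algebra_simps zero_v7)

lemma M8_eq_iff: "M8 s1 s2 p1 q1 p2 q2 p3 q3 = M8 s1' s2' p1' q1' p2' q2' p3' q3' \<longleftrightarrow>
   s1 = s1' \<and> s2 = s2' \<and> p1 = p1' \<and> q1 = q1' \<and> p2 = p2' \<and> q2 = q2' \<and> p3 = p3' \<and> q3 = q3'"
  unfolding M8_def by auto

lemma M8_eq_0_iff: "M8 s1 s2 p1 q1 p2 q2 p3 q3 = 0 \<longleftrightarrow>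
   s1 = 0 \<and> s2 = 0 \<and> p1 = 0 \<and> q1 = 0 \<and> p2 = 0 \<and> q2 = 0 \<and> p3 = 0 \<and> q3 = 0"
  unfolding M8_0[symmetric] M8_eq_iff ..

abbreviation D2 :: "real \<Rightarrow> real \<Rightarrow> real^7^7" where
  "D2 a b \<equiv> M8 a b 0 0 0 0 0 0"

lemma lie_M8_D2:
  "lie (M8 s t p1 q1 p2 q2 p3 q3) (D2 a b) =
    G14 0 (2*b*p2) 0 0 0 (2*(a+b)*p3) 0 (a*(p1 - q1) - 2*b*q1) 0 0 (-2*a*p1) 0 ((a+b)*p3 + (a-b)*q3) (2*a*q2 + b*(q2 - p2))"
  unfolding lie_def M8_def G14_def matrix_mult_v7 vector_matrix_mult_v7
  by (simp add: algebra_simps)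

text \<open>The operator is minus the square of ad H for \<open>H = D2 a b\<close>. The factors are
  the squares of the six restricted roots at \<open>H\<close>, with third coordinate
  \<open>- a - b\<close>, so the splitting along eigenvalues cannot tell a root from its
  negative.\<close>

lemma lie_lie_D2:
  "lie (lie (D2 a b) (M8 s t p1 q1 p2 q2 p3 q3)) (D2 a b) =
    M8 0 0 (a^2*p1) ((a+2*b)^2*q1) (b^2*p2) ((2*a+b)^2*q2) ((a+b)^2*p3) ((a-b)^2*q3)"
proof -
  have *: "lie (D2 a b) (M8 s t p1 q1 p2 q2 p3 q3) = - lie (M8 s t p1 q1 p2 q2 p3 q3) (D2 a b)"
    by (simp add: lie_def)
  show ?thesis
    unfolding * lie_M8_D2 unfolding lie_def M8_def G14_def v7_uminus matrix_mult_v7 vector_matrix_mult_v7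
    by (simp add: algebra_simps power2_eq_square)
qed

lemma lie_lie_M8:
  "lie (lie (M8 0 0 p1 q1 p2 q2 p3 q3) (D2 a b)) (M8 0 0 p1' q1' p2' q2' p3' q3') = M8
     (4*a*p1*p1' + 2*(a+b)*p3*p3' + (4*a+2*b)*q2*q2' + 2*(a-b)*q3*q3' - 2*b*p2*p2')
     (2*(a+b)*p3*p3' + (2*a+4*b)*q1*q1' + 2*(b-a)*q3*q3' + 4*b*p2*p2' - 2*a*p1*p1')
     (2*a*(p2'*p3 + p3'*q2) + a*(p3*q2' - p2'*q3) + 2*b*(p2*p3' + p2'*p3) + b*(p2*q3' + p2'*q3 + p3*q2' + p3'*q2))
     (3*a*p2'*p3 - 2*a*q2*q3' - a*q2'*q3 + 3*b*(p2'*p3 - p2*p3') + b*(q2'*q3 - q2*q3'))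
     (a*(p1*q3' + p1'*q3) - 2*a*(p1*p3' + p1'*p3) - a*(p3*q1' + p3'*q1) - 2*b*(p1'*p3 + p3'*q1) - b*(p1'*q3 + p3*q1'))
     (3*a*(p1*p3' - p1'*p3) + a*(q1'*q3 - q1*q3') - 3*b*p1'*p3 - 2*b*q1*q3' - b*q1'*q3)
     (2*a*(p1*p2' - p1'*q2) + a*(p2'*q1 - p1*q2') + 2*b*(p2'*q1 - p1'*p2) + b*(p2*q1' - p1'*q2))
     (a*(q1*q2' + 2*q1'*q2 - 3*p1*p2') + b*(2*q1*q2' + q1'*q2 - 3*p1'*p2))"
  unfolding lie_M8_D2 unfolding lie_def M8_def G14_def matrix_mult_v7 vector_matrix_mult_v7
  by (simp add: algebra_simps)

lemma lie_lie_M8_D2: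
  "lie (lie (M8 0 0 p1 q1 p2 q2 p3 q3) (M8 0 0 p1' q1' p2' q2' p3' q3')) (D2 a b) = M8 0 0
     (a * ((p2*q3' - p2'*q3) + (q2*p3' - q2'*p3) - 2*(p2*p3' - p2'*p3)))
     (- (a+2*b) * (3*(p2*p3' - p2'*p3) + (q2*q3' - q2'*q3)))
     (b * (2*(p1*p3' - p1'*p3) + (p1*q3' - p1'*q3) - (q1*p3' - q1'*p3)))
     ((2*a+b) * (3*(p1*p3' - p1'*p3) - (q1*q3' - q1'*q3)))
     ((a+b) * (2*(p1*p2' - p1'*p2) + (p1*q2' - p1'*q2) + (q1*p2' - q1'*p2)))
     ((b-a) * (3*(p1*p2' - p1'*p2) + (q1*q2' - q1'*q2)))"
  unfolding lie_jacobi[of _ _ "D2 a b"] lie_lie_M8 M8_diff M8_eq_iff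
  by (simp add: algebra_simps)

section \<open>Triple subsystems of the standard pair\<close>

text \<open>Applying \<open>T - l\<close> for the first eigenvalue \<open>l\<close> deletes its term
  and rescales every other one by a nonzero \<open>m - l\<close>. The shortened sum still lies in
  \<open>S\<close>, so induction on the length puts the other terms into \<open>S\<close>, and the
  first one follows by subtraction.\<close>

lemma eigenvector_components_in_subspace:
  fixes T :: "'a::real_vector \<Rightarrow> 'a"
  assumes S: "subspace S" and T: "linear T" "\<And>x. x \<in> S \<Longrightarrow> T x \<in> S"
  shows "\<lbrakk>distinct (map fst xs); \<forall>(l, v)\<in>set xs. T v = l *\<^sub>R v; sum_list (map snd xs) \<in> S\<rbrakk>
     \<Longrightarrow> \<forall>(l, v)\<in>set xs. v \<in> S"
proof (induction "length xs" arbitrary: xs)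
  case (Suc n)
  obtain l v zs where xs: "xs = (l, v) # zs" using Suc.hyps(2) by (cases xs) auto
  define ys where "ys = map (\<lambda>(m, w). (m, (m - l) *\<^sub>R w)) zs"
  have ev: "T v = l *\<^sub>R v" "\<forall>(m, w)\<in>set zs. T w = m *\<^sub>R w"
    using Suc.prems(2) xs by auto
  have Ts: "T (sum_list (map snd zs)) - l *\<^sub>R sum_list (map snd zs) = sum_list (map snd ys)"
    using ev(2) unfolding ys_def
    by (induction zs) (auto simp: linear_0[OF T(1)] linear_add[OF T(1)] algebra_simps)
  let ?s = "sum_list (map snd xs)"
  have "T ?s - l *\<^sub>R ?s \<in> S"
    using Suc.prems(3) T(2) S by (meson subspace_diff subspace_scale)
  moreover have "T ?s - l *\<^sub>R ?s = sum_list (map snd ys)"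
    unfolding Ts[symmetric] by (simp add: xs linear_add[OF T(1)] ev(1) algebra_simps)
  ultimately have ysS: "sum_list (map snd ys) \<in> S" by simp
  have fs: "map fst ys = map fst zs" unfolding ys_def by (induction zs) auto
  have "\<forall>(m, w)\<in>set ys. w \<in> S"
  proof (rule Suc.hyps(1))
    show "n = length ys" using Suc.hyps(2) xs by (simp add: ys_def)
    show "distinct (map fst ys)" unfolding fs using Suc.prems(1) xs by simp
    show "\<forall>(l, v)\<in>set ys. T v = l *\<^sub>R v"
      using ev(2) by (auto simp: ys_def linear_scale[OF T(1)])
  qed (rule ysS)
  moreover have "m \<noteq> l" if "(m, w) \<in> set zs" for m w
    using that Suc.prems(1) xs by (force simp: image_iff)
  ultimately have zsS: "w \<in> S" if "(m, w) \<in> set zs" for m w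
  proof -
    have "(m - l) *\<^sub>R w \<in> S" using that \<open>\<forall>(m, w)\<in>set ys. w \<in> S\<close> by (force simp: ys_def)
    then have "inverse (m - l) *\<^sub>R ((m - l) *\<^sub>R w) \<in> S" using S subspace_scale by blast
    then show ?thesis using \<open>\<And>m w. (m, w) \<in> set zs \<Longrightarrow> m \<noteq> l\<close>[OF that] by simp
  qed
  have "sum_list ws \<in> S" if "\<forall>w\<in>set ws. w \<in> S" for ws
    using that by (induction ws) (auto simp: subspace_0[OF S] intro: subspace_add[OF S])
  moreover have "\<forall>w\<in>set (map snd zs). w \<in> S" using zsS by auto
  ultimately have "sum_list (map snd zs) \<in> S" by blast
  then have "?s - sum_list (map snd zs) \<in> S" using Suc.prems(3) S subspace_diff by blast
  then have "v \<in> S" by (simp add: xs)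
  then show ?case using zsS by (auto simp: xs)
qed simp

lemma linear_lie_lie: "linear (\<lambda>x. lie (lie d x) (d::real^7^7))"
  by (rule linearI) (simp_all add: lie_def vec_eq_iff matrix_matrix_mult_def algebra_simps sum.distrib sum_distrib_left sum_subtractf)

definition std_family2 :: "(real^7^7) set" where "std_family2 = {M8 s t 0 q1 0 q2 0 q3 | s t q1 q2 q3. True}"
definition std_family3 :: "(real^7^7) set" where "std_family3 = {M8 0 t 0 q p (-p) r (-r) | t q p r. True}"
text \<open>This and the next two are the systems A1 x A1: a short root together with the long root
  orthogonal to it.\<close>

definition std_family4a :: "(real^7^7) set" where "std_family4a = {M8 s t p q 0 0 0 0 | s t p q. True}"
definition std_family4b :: "(real^7^7) set" where "std_family4b = {M8 s t 0 0 p q 0 0 | s t p q. True}"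
definition std_family4c :: "(real^7^7) set" where "std_family4c = {M8 s t 0 0 0 0 p q | s t p q. True}"
text \<open>Spanned by \<open>D2 1 2\<close> and a combination of the vectors of the short root
  \<open>s\<^sub>1\<close> and the long root \<open>s\<^sub>1 - s\<^sub>2\<close>, which take the
  values 1 and -1 there. It is used with \<open>c^2 = 3/5\<close>.\<close>

definition std_family1 :: "real \<Rightarrow> (real^7^7) set" where "std_family1 c = {M8 r (2*r) (c*q) 0 0 0 0 q | r q. True}"

locale std_lts =
  fixes S :: "(real^7^7) set"
  assumes LTS: "LTS V0 S"
begin

lemma sub: "subspace S" and tri: "\<lbrakk>x \<in> S; y \<in> S; z \<in> S\<rbrakk> \<Longrightarrow> lie (lie x y) z \<in> S"
  and S_m4: "S \<subseteq> m4 V0"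
  using LTS by (auto simp: LTS_def)

lemma S_M8: "x \<in> S \<Longrightarrow> \<exists>s1 s2 p1 q1 p2 q2 p3 q3. x = M8 s1 s2 p1 q1 p2 q2 p3 q3"
  using S_m4 m4_V0 by blast

lemma scale: "x \<in> S \<Longrightarrow> r *\<^sub>R x \<in> S" and plus: "x \<in> S \<Longrightarrow> y \<in> S \<Longrightarrow> x + y \<in> S"
  and minus: "x \<in> S \<Longrightarrow> y \<in> S \<Longrightarrow> x - y \<in> S"
  using sub by (simp_all add: subspace_scale subspace_add subspace_diff)

lemma components:
  assumes "D2 a b \<in> S" "distinct (map fst xs)" "\<forall>(l, v)\<in>set xs. lie (lie (D2 a b) v) (D2 a b) = l *\<^sub>R v"
    "sum_list (map snd xs) \<in> S"
  shows "list_all (\<lambda>v. v \<in> S) (map snd xs)"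
  using eigenvector_components_in_subspace[OF sub linear_lie_lie, of "D2 a b" xs] assms tri
  by (auto simp: list_all_iff)

lemma D2_full:
  assumes "D2 a b \<in> S" "D2 c d \<in> S" "a * d \<noteq> b * c"
  shows "D2 x y \<in> S"
proof -
  define e where "e = a * d - b * c"
  have e: "e \<noteq> 0" using assms(3) by (simp add: e_def)
  have "((x * d - y * c) / e) *\<^sub>R D2 a b + ((a * y - b * x) / e) *\<^sub>R D2 c d \<in> S"
    using assms plus scale by blast
  moreover have "((x * d - y * c) / e) *\<^sub>R D2 a b + ((a * y - b * x) / e) *\<^sub>R D2 c d = D2 x y"
  proof -
    have "x * e = (x * d - y * c) * a + (a * y - b * x) * c" "y * e = (x * d - y * c) * b + (a * y - b * x) * d"
      by (simp_all add: e_def algebra_simps)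
    then have "x = ((x * d - y * c) * a + (a * y - b * x) * c) / e" "y = ((x * d - y * c) * b + (a * y - b * x) * d) / e"
      using e by (simp_all add: field_simps)
    then show ?thesis unfolding M8_scaleR M8_add M8_eq_iff by (simp add: add_divide_distrib)
  qed
  ultimately show ?thesis by simp
qed

lemma unit_component:
  "M8 0 0 p 0 0 0 0 0 \<in> S \<Longrightarrow> p \<noteq> 0 \<Longrightarrow> M8 0 0 1 0 0 0 0 0 \<in> S"
  "M8 0 0 0 p 0 0 0 0 \<in> S \<Longrightarrow> p \<noteq> 0 \<Longrightarrow> M8 0 0 0 1 0 0 0 0 \<in> S"
  "M8 0 0 0 0 p 0 0 0 \<in> S \<Longrightarrow> p \<noteq> 0 \<Longrightarrow> M8 0 0 0 0 1 0 0 0 \<in> S"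
  "M8 0 0 0 0 0 p 0 0 \<in> S \<Longrightarrow> p \<noteq> 0 \<Longrightarrow> M8 0 0 0 0 0 1 0 0 \<in> S"
  "M8 0 0 0 0 0 0 p 0 \<in> S \<Longrightarrow> p \<noteq> 0 \<Longrightarrow> M8 0 0 0 0 0 0 1 0 \<in> S"
  "M8 0 0 0 0 0 0 0 p \<in> S \<Longrightarrow> p \<noteq> 0 \<Longrightarrow> M8 0 0 0 0 0 0 0 1 \<in> S"
  using scale[of _ "1/p"] by (force simp: M8_scaleR)+

lemma regular_components:
  assumes D: "D2 a b \<in> S"
    and dist: "distinct [0, a^2, (a+2*b)^2, b^2, (2*a+b)^2, (a+b)^2, (a-b)^2]"
    and X: "M8 s t p1 q1 p2 q2 p3 q3 \<in> S"
  shows "D2 s t \<in> S" "M8 0 0 p1 0 0 0 0 0 \<in> S" "M8 0 0 0 q1 0 0 0 0 \<in> S" "M8 0 0 0 0 p2 0 0 0 \<in> S"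
    "M8 0 0 0 0 0 q2 0 0 \<in> S" "M8 0 0 0 0 0 0 p3 0 \<in> S" "M8 0 0 0 0 0 0 0 q3 \<in> S"
  using components[OF D, of "[(0, D2 s t), (a^2, M8 0 0 p1 0 0 0 0 0), ((a+2*b)^2, M8 0 0 0 q1 0 0 0 0), (b^2, M8 0 0 0 0 p2 0 0 0),
     ((2*a+b)^2, M8 0 0 0 0 0 q2 0 0), ((a+b)^2, M8 0 0 0 0 0 0 p3 0), ((a-b)^2, M8 0 0 0 0 0 0 0 q3)]"] dist X
  by (simp_all add: lie_lie_D2 M8_scaleR M8_add M8_0)

lemma cartan_case:
  assumes D: "D2 1 0 \<in> S" "D2 0 1 \<in> S" and ne: "S \<noteq> m4 V0"
  shows "S \<subseteq> std_family2 \<or> S \<subseteq> std_family4a \<or> S \<subseteq> std_family4b \<or> S \<subseteq> std_family4c"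
proof -
  have Dxy: "D2 x y \<in> S" for x y using D2_full[OF D] by simp
  \<comment> \<open>At (3, 5) the roots take the values 3, 13, 5, 11, 8, -2 up to sign, with
    distinct nonzero squares; hence \<open>S\<close> is determined by which of the six root vectors
    it contains.\<close>
  note rc = regular_components[OF Dxy[of 3 5], simplified]
  define P1 Q1 P2 Q2 P3 Q3 where PQ: "P1 \<longleftrightarrow> M8 0 0 1 0 0 0 0 0 \<in> S" "Q1 \<longleftrightarrow> M8 0 0 0 1 0 0 0 0 \<in> S"
     "P2 \<longleftrightarrow> M8 0 0 0 0 1 0 0 0 \<in> S" "Q2 \<longleftrightarrow> M8 0 0 0 0 0 1 0 0 \<in> S"
     "P3 \<longleftrightarrow> M8 0 0 0 0 0 0 1 0 \<in> S" "Q3 \<longleftrightarrow> M8 0 0 0 0 0 0 0 1 \<in> S"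
  have nz: "(p1 \<noteq> 0 \<longrightarrow> P1) \<and> (q1 \<noteq> 0 \<longrightarrow> Q1) \<and> (p2 \<noteq> 0 \<longrightarrow> P2) \<and> (q2 \<noteq> 0 \<longrightarrow> Q2) \<and> (p3 \<noteq> 0 \<longrightarrow> P3) \<and> (q3 \<noteq> 0 \<longrightarrow> Q3)"
    if "M8 s t p1 q1 p2 q2 p3 q3 \<in> S" for s t p1 q1 p2 q2 p3 q3
    using rc[OF that] unit_component unfolding PQ by blast
  have br: "M8 0 0 p1 q1 p2 q2 p3 q3 \<in> S \<Longrightarrow> M8 0 0 p1' q1' p2' q2' p3' q3' \<in> S \<Longrightarrow>
      lie (lie (M8 0 0 p1 q1 p2 q2 p3 q3) (M8 0 0 p1' q1' p2' q2' p3' q3')) (D2 3 5) \<in> S" for p1 q1 p2 q2 p3 q3 p1' q1' p2' q2' p3' q3'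
    using tri Dxy by blast
  note br = nz[OF br[unfolded lie_lie_M8_D2]]
  have b0: "P1 \<Longrightarrow> P2 \<Longrightarrow> P3 \<and> Q3"
    using br[of 1 0 0 0 0 0 0 0 1 0 0 0] by (simp add: PQ(1,3))
  have b1: "P1 \<Longrightarrow> P3 \<Longrightarrow> P2 \<and> Q2"
    using br[of 1 0 0 0 0 0 0 0 0 0 1 0] by (simp add: PQ(1,5))
  have b2: "P2 \<Longrightarrow> P3 \<Longrightarrow> P1 \<and> Q1"
    using br[of 0 0 1 0 0 0 0 0 0 0 1 0] by (simp add: PQ(3,5))
  have b3: "P1 \<Longrightarrow> Q2 \<Longrightarrow> P3"
    using br[of 1 0 0 0 0 0 0 0 0 1 0 0] by (simp add: PQ(1,4))
  have b4: "P1 \<Longrightarrow> Q3 \<Longrightarrow> P2"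
    using br[of 1 0 0 0 0 0 0 0 0 0 0 1] by (simp add: PQ(1,6))
  have b5: "Q1 \<Longrightarrow> P2 \<Longrightarrow> P3"
    using br[of 0 1 0 0 0 0 0 0 1 0 0 0] by (simp add: PQ(2,3))
  have b6: "Q1 \<Longrightarrow> P3 \<Longrightarrow> P2"
    using br[of 0 1 0 0 0 0 0 0 0 0 1 0] by (simp add: PQ(2,5))
  have b7: "P2 \<Longrightarrow> Q3 \<Longrightarrow> P1"
    using br[of 0 0 1 0 0 0 0 0 0 0 0 1] by (simp add: PQ(3,6))
  have b8: "Q2 \<Longrightarrow> P3 \<Longrightarrow> P1"
    using br[of 0 0 0 1 0 0 0 0 0 0 1 0] by (simp add: PQ(4,5))
  \<comment> \<open>Closure under brackets has become propositional: all six roots, no short root,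
    or only the two roots of a single index.\<close>
  from b0 b1 b2 b3 b4 b5 b6 b7 b8 have cases: "(P1 \<and> Q1 \<and> P2 \<and> Q2 \<and> P3 \<and> Q3) \<or> (\<not> P1 \<and> \<not> P2 \<and> \<not> P3)
     \<or> (\<not> P2 \<and> \<not> Q2 \<and> \<not> P3 \<and> \<not> Q3) \<or> (\<not> P1 \<and> \<not> Q1 \<and> \<not> P3 \<and> \<not> Q3) \<or> (\<not> P1 \<and> \<not> Q1 \<and> \<not> P2 \<and> \<not> Q2)" by blast
  have "\<not> (P1 \<and> Q1 \<and> P2 \<and> Q2 \<and> P3 \<and> Q3)"
  proof
    assume a: "P1 \<and> Q1 \<and> P2 \<and> Q2 \<and> P3 \<and> Q3"
    have "M8 s t p1 q1 p2 q2 p3 q3 \<in> S" for s t p1 q1 p2 q2 p3 q3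
    proof -
      have "D2 s t + (p1 *\<^sub>R M8 0 0 1 0 0 0 0 0 + (q1 *\<^sub>R M8 0 0 0 1 0 0 0 0 + (p2 *\<^sub>R M8 0 0 0 0 1 0 0 0
         + (q2 *\<^sub>R M8 0 0 0 0 0 1 0 0 + (p3 *\<^sub>R M8 0 0 0 0 0 0 1 0 + q3 *\<^sub>R M8 0 0 0 0 0 0 0 1))))) \<in> S"
        using a unfolding PQ by (intro plus scale Dxy) auto
      then show ?thesis by (simp add: M8_scaleR M8_add)
    qed
    then have "m4 V0 \<subseteq> S" by (auto simp: m4_V0)
    then show False using ne S_m4 by blast
  qed
  with cases consider "\<not> P1 \<and> \<not> P2 \<and> \<not> P3" | "\<not> P2 \<and> \<not> Q2 \<and> \<not> P3 \<and> \<not> Q3" | "\<not> P1 \<and> \<not> Q1 \<and> \<not> P3 \<and> \<not> Q3" | "\<not> P1 \<and> \<not> Q1 \<and> \<not> P2 \<and> \<not> Q2"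
    by blast
  then show ?thesis
  proof cases
    case 1 
    have "x \<in> std_family2" if x: "x \<in> S" for x
    proof -
      obtain s t p1 q1 p2 q2 p3 q3 where "x = M8 s t p1 q1 p2 q2 p3 q3" using S_M8[OF x] by blast
      then show ?thesis using nz x 1 unfolding std_family2_def by blast
    qed
    then show ?thesis by blast
  next
    case 2 
    have "x \<in> std_family4a" if x: "x \<in> S" for x
    proof -
      obtain s t p1 q1 p2 q2 p3 q3 where "x = M8 s t p1 q1 p2 q2 p3 q3" using S_M8[OF x] by blast
      then show ?thesis using nz x 2 unfolding std_family4a_def by blast
    qed
    then show ?thesis by blast
  next
    case 3
    have "x \<in> std_family4b" if x: "x \<in> S" for x
    proof -
      obtain s t p1 q1 p2 q2 p3 q3 where "x = M8 s t p1 q1 p2 q2 p3 q3" using S_M8[OF x] by blast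
      then show ?thesis using nz x 3 unfolding std_family4b_def by blast
    qed
    then show ?thesis by blast
  next
    case 4
    have "x \<in> std_family4c" if x: "x \<in> S" for x
    proof -
      obtain s t p1 q1 p2 q2 p3 q3 where "x = M8 s t p1 q1 p2 q2 p3 q3" using S_M8[OF x] by blast
      then show ?thesis using nz x 4 unfolding std_family4c_def by blast
    qed
    then show ?thesis by blast
  qed
qed

end

section \<open>Subsystems meeting the standard Cartan subspace only in a line\<close>

context std_lts begin

lemma cartan_full: "D2 a b \<in> S \<Longrightarrow> D2 c d \<in> S \<Longrightarrow> a * d \<noteq> b * c \<Longrightarrow> D2 1 0 \<in> S \<and> D2 0 1 \<in> S"
  using D2_full by blast

text \<open>A root vector in \<open>S\<close> forces its coroot into \<open>S\<close>, so the root vanishes unless the coroot is parallel to \<open>D2 a b\<close>.\<close>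
lemma root_component_vanishes:
  assumes D: "D2 a b \<in> S" and nf: "\<not> (D2 1 0 \<in> S \<and> D2 0 1 \<in> S)"
    and nz: "a \<noteq> 0" "b \<noteq> 0" "a + b \<noteq> 0" "a \<noteq> b" "2*a + b \<noteq> 0" "a + 2*b \<noteq> 0"
  shows "M8 0 0 p 0 0 0 0 0 \<in> S \<Longrightarrow> p = 0" "M8 0 0 0 p 0 0 0 0 \<in> S \<Longrightarrow> p = 0"
    "M8 0 0 0 0 p 0 0 0 \<in> S \<Longrightarrow> p = 0" "M8 0 0 0 0 0 p 0 0 \<in> S \<Longrightarrow> p = 0"
    "M8 0 0 0 0 0 0 p 0 \<in> S \<Longrightarrow> p = 0" "M8 0 0 0 0 0 0 0 p \<in> S \<Longrightarrow> p = 0"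
proof -
  have par: "a * d = b * c" if "D2 c d \<in> S" for c d using cartan_full[OF D that] nf by blast
  have t: "M8 0 0 p1 q1 p2 q2 p3 q3 \<in> S \<Longrightarrow> lie (lie (M8 0 0 p1 q1 p2 q2 p3 q3) (D2 a b)) (M8 0 0 p1 q1 p2 q2 p3 q3) \<in> S"
    for p1 q1 p2 q2 p3 q3 using tri D by blast
  note t = t[unfolded lie_lie_M8]
  { assume "M8 0 0 p 0 0 0 0 0 \<in> S"
    from par[OF t[OF this, simplified]] have "p * p * (a * (a + 2 * b)) = 0" by algebra
    then show "p = 0" using nz by simp }
  { assume "M8 0 0 0 p 0 0 0 0 \<in> S"
    from par[OF t[OF this, simplified]] have "p * p * (a * (a + 2 * b)) = 0" by algebra
    then show "p = 0" using nz by simp }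
  { assume "M8 0 0 0 0 p 0 0 0 \<in> S"
    from par[OF t[OF this, simplified]] have "p * p * (b * (2*a + b)) = 0" by algebra
    then show "p = 0" using nz by simp }
  { assume "M8 0 0 0 0 0 p 0 0 \<in> S"
    from par[OF t[OF this, simplified]] have "p * p * (b * (2 * a + b)) = 0" by algebra
    then show "p = 0" using nz by simp }
  { assume "M8 0 0 0 0 0 0 p 0 \<in> S"
    from par[OF t[OF this, simplified]] have "p * p * ((a + b) * (a - b)) = 0" by algebra
    then show "p = 0" using nz by simp }
  { assume "M8 0 0 0 0 0 0 0 p \<in> S"
    from par[OF t[OF this, simplified]] have "p * p * ((a - b) * (a + b)) = 0" by algebra
    then show "p = 0" using nz by simp }
qed

text \<open>\<open>nz\<close> keeps all roots nonzero; two roots of equal length can agree up to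
  sign only where another root vanishes. \<open>co\<close> excludes the multiples of the six
  permutations of (1, 2, -3), where a short root agrees with a long one. So the six squares differ,
  every root component vanishes, and \<open>S\<close> consists of diagonal elements, which family 2
  contains.\<close>

lemma regular_case:
  assumes D: "D2 a b \<in> S" and nf: "\<not> (D2 1 0 \<in> S \<and> D2 0 1 \<in> S)"
    and nz: "a \<noteq> 0" "b \<noteq> 0" "a + b \<noteq> 0" "a \<noteq> b" "2*a + b \<noteq> 0" "a + 2*b \<noteq> 0"
    and co: "b \<noteq> 2*a" "a \<noteq> 2*b" "3*b \<noteq> -2*a" "a \<noteq> -3*b" "3*a \<noteq> -2*b" "b \<noteq> -3*a"
  shows "S \<subseteq> std_family2"
proof
  have f: "3*a + b \<noteq> 0" "2*a - b \<noteq> 0" "a + 3*b \<noteq> 0" "2*a + 3*b \<noteq> 0" "a - 2*b \<noteq> 0" "3*a + 2*b \<noteq> 0" "a - b \<noteq> 0"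
    using co(6) co(1) co(4) co(3) co(2) co(5) nz(4) by linarith+
  have ne: "x \<noteq> y" if "x - y = z" "z \<noteq> 0" for x y z :: real using that by auto
  have n0: "a^2 \<noteq> (a+2*b)^2"
    by (rule ne[of _ _ "-4*b*(a+b)"]) (simp add: power2_eq_square algebra_simps, use nz f in simp)
  have n1: "a^2 \<noteq> b^2"
    by (rule ne[of _ _ "(a-b)*(a+b)"]) (simp add: power2_eq_square algebra_simps, use nz f in simp)
  have n2: "a^2 \<noteq> (2*a+b)^2"
    by (rule ne[of _ _ "-((a+b)*(3*a+b))"]) (simp add: power2_eq_square algebra_simps, use nz f in simp)
  have n3: "a^2 \<noteq> (a+b)^2"
    by (rule ne[of _ _ "-b*(2*a+b)"]) (simp add: power2_eq_square algebra_simps, use nz f in simp)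
  have n4: "a^2 \<noteq> (a-b)^2"
    by (rule ne[of _ _ "b*(2*a-b)"]) (simp add: power2_eq_square algebra_simps, use nz f in simp)
  have n5: "(a+2*b)^2 \<noteq> b^2"
    by (rule ne[of _ _ "(a+b)*(a+3*b)"]) (simp add: power2_eq_square algebra_simps, use nz f in simp)
  have n6: "(a+2*b)^2 \<noteq> (2*a+b)^2"
    by (rule ne[of _ _ "-3*(a-b)*(a+b)"]) (simp add: power2_eq_square algebra_simps, use nz f in simp)
  have n7: "(a+2*b)^2 \<noteq> (a+b)^2"
    by (rule ne[of _ _ "b*(2*a+3*b)"]) (simp add: power2_eq_square algebra_simps, use nz f in simp)
  have n8: "(a+2*b)^2 \<noteq> (a-b)^2"
    by (rule ne[of _ _ "3*b*(2*a+b)"]) (simp add: power2_eq_square algebra_simps, use nz f in simp)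
  have n9: "b^2 \<noteq> (2*a+b)^2"
    by (rule ne[of _ _ "-4*a*(a+b)"]) (simp add: power2_eq_square algebra_simps, use nz f in simp)
  have n10: "b^2 \<noteq> (a+b)^2"
    by (rule ne[of _ _ "-a*(a+2*b)"]) (simp add: power2_eq_square algebra_simps, use nz f in simp)
  have n11: "b^2 \<noteq> (a-b)^2"
    by (rule ne[of _ _ "-a*(a-2*b)"]) (simp add: power2_eq_square algebra_simps, use nz f in simp)
  have n12: "(2*a+b)^2 \<noteq> (a+b)^2"
    by (rule ne[of _ _ "a*(3*a+2*b)"]) (simp add: power2_eq_square algebra_simps, use nz f in simp)
  have n13: "(2*a+b)^2 \<noteq> (a-b)^2"
    by (rule ne[of _ _ "3*a*(a+2*b)"]) (simp add: power2_eq_square algebra_simps, use nz f in simp)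
  have n14: "(a+b)^2 \<noteq> (a-b)^2"
    by (rule ne[of _ _ "4*a*b"]) (simp add: power2_eq_square algebra_simps, use nz f in simp)
  have dist: "distinct [0, a^2, (a+2*b)^2, b^2, (2*a+b)^2, (a+b)^2, (a-b)^2]"
    using nz f n0 n1 n2 n3 n4 n5 n6 n7 n8 n9 n10 n11 n12 n13 n14 by simp
  fix x assume x: "x \<in> S"
  obtain s t p1 q1 p2 q2 p3 q3 where xe: "x = M8 s t p1 q1 p2 q2 p3 q3" using S_M8[OF x] by blast
  note c = regular_components[OF D dist x[unfolded xe]]
  note v = root_component_vanishes[OF D nf nz]
  have "p1 = 0" "p2 = 0" "p3 = 0" using v(1)[OF c(2)] v(3)[OF c(4)] v(5)[OF c(6)] by auto
  then show "x \<in> std_family2" unfolding xe std_family2_def by blast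
qed

text \<open>At (1, 2) only the \<open>p1\<close> and \<open>q3\<close> components share an
  eigenvalue, so they may occur together. The diagonal element \<open>[[x, H], x]\<close> must be
  parallel to \<open>H\<close>, which is the quadratic relation \<open>quad\<close>.\<close>

lemma principal_case:
  assumes D: "D2 1 2 \<in> S" and nf: "\<not> (D2 1 0 \<in> S \<and> D2 0 1 \<in> S)"
  obtains c where "c\<^sup>2 = 3/5" "S \<subseteq> std_family1 c"
proof -
  have nz: "(1::real) \<noteq> 0" "(2::real) \<noteq> 0" "(1::real) + 2 \<noteq> 0" "(1::real) \<noteq> 2" "2*(1::real) + 2 \<noteq> 0" "(1::real) + 2*2 \<noteq> 0" by simp_all
  note v = root_component_vanishes[OF D nf nz]
  have par: "d = 2 * c" if "D2 c d \<in> S" for c d using cartan_full[OF D that] nf by auto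
  have form: "t = 2 * s \<and> q1 = 0 \<and> p2 = 0 \<and> q2 = 0 \<and> p3 = 0 \<and> M8 0 0 p1 0 0 0 0 q3 \<in> S"
    if X: "M8 s t p1 q1 p2 q2 p3 q3 \<in> S" for s t p1 q1 p2 q2 p3 q3
  proof -
    have c: "D2 s t \<in> S \<and> M8 0 0 p1 0 0 0 0 q3 \<in> S \<and> M8 0 0 0 q1 0 0 0 0 \<in> S \<and> M8 0 0 0 0 p2 0 0 0 \<in> S \<and> M8 0 0 0 0 0 q2 0 0 \<in> S \<and> M8 0 0 0 0 0 0 p3 0 \<in> S"
      using components[OF D, of "[(0, D2 s t), (1, M8 0 0 p1 0 0 0 0 q3), (25, M8 0 0 0 q1 0 0 0 0), (4, M8 0 0 0 0 p2 0 0 0),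
        (16, M8 0 0 0 0 0 q2 0 0), (9, M8 0 0 0 0 0 0 p3 0)]"] X
      by (simp add: lie_lie_D2 M8_scaleR M8_add M8_0)
    then show ?thesis using par v by blast
  qed
  have quad: "5 * p^2 = 3 * q^2" if Y: "M8 0 0 p 0 0 0 0 q \<in> S" for p q
  proof -
    have "lie (lie (M8 0 0 p 0 0 0 0 q) (D2 1 2)) (M8 0 0 p 0 0 0 0 q) \<in> S" using tri D Y by blast
    from par[OF this[unfolded lie_lie_M8, simplified]] show ?thesis by (simp add: power2_eq_square)
  qed
  show ?thesis
  proof (cases "\<exists>p q. M8 0 0 p 0 0 0 0 q \<in> S \<and> q \<noteq> 0")
    case True
    then obtain p q where Y: "M8 0 0 p 0 0 0 0 q \<in> S" and q: "q \<noteq> 0" by blast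
    define c where "c = p / q"
    have p: "p = c * q" using q by (simp add: c_def)
    have c2: "c^2 = 3/5" using quad[OF Y] q by (simp add: p power_mult_distrib)
    have "x \<in> std_family1 c" if x: "x \<in> S" for x
    proof -
      obtain s t p1 q1 p2 q2 p3 q3 where xe: "x = M8 s t p1 q1 p2 q2 p3 q3" using S_M8[OF x] by blast
      note f = form[OF x[unfolded xe]]
      then have Y': "M8 0 0 p1 0 0 0 0 q3 \<in> S" by blast
      \<comment> \<open>The relation holds for the sum as well, so its polar form vanishes and the
        second vector is a multiple of the first.\<close>
      have "5 * (p + p1)^2 = 3 * (q + q3)^2"
        using plus[OF Y Y'] by (intro quad) (simp add: M8_add)
      then have "5 * p * p1 = 3 * q * q3" using quad[OF Y] quad[OF Y'] by (simp add: power2_sum algebra_simps)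
      then have "5 * c * p1 = 3 * q3" using q by (simp add: p)
      then have "5 * c^2 * p1 = 3 * c * q3" by (simp add: power2_eq_square mult.assoc mult.left_commute)
      then have "p1 = c * q3" by (simp add: c2)
      then show ?thesis using f unfolding xe std_family1_def by blast
    qed
    then show ?thesis using that c2 by blast
  next
    case False
    \<comment> \<open>Here \<open>S\<close> lies on the line of \<open>D2 1 2\<close>, and either
      square root would serve.\<close>
    define c where "c = sqrt (3/5)"
    have c2: "c^2 = 3/5" by (simp add: c_def)
    have "x \<in> std_family1 c" if x: "x \<in> S" for x
    proof -
      obtain s t p1 q1 p2 q2 p3 q3 where xe: "x = M8 s t p1 q1 p2 q2 p3 q3" using S_M8[OF x] by blast
      note f = form[OF x[unfolded xe]]
      then have Y': "M8 0 0 p1 0 0 0 0 q3 \<in> S" by blast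
      then have q3: "q3 = 0" using False by blast
      then have "p1 = c * q3" using quad[OF Y'] by simp
      then show ?thesis using f unfolding xe std_family1_def by blast
    qed
    then show ?thesis using that c2 by blast
  qed
qed

text \<open>(1, 1, -2) is the coroot of the short root \<open>s\<^sub>3\<close>; among the roots
  only \<open>s\<^sub>1 - s\<^sub>2\<close> vanishes there. For \<open>x\<close> in an eigenspace,
  \<open>[[x, H], x]\<close> commutes with \<open>H\<close>, and \<open>cent\<close> turns this into
  quadratic equations whose only solution on the eigenvalues 1 and 9 is zero.\<close>

lemma short_coroot_case:
  assumes D: "D2 1 1 \<in> S" and cent: "\<And>s t q. M8 s t 0 0 0 0 0 q \<in> S \<Longrightarrow> s = t \<and> q = 0"
  shows "S \<subseteq> std_family4c"
proof
  fix x assume x: "x \<in> S"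
  obtain s t p1 q1 p2 q2 p3 q3 where xe: "x = M8 s t p1 q1 p2 q2 p3 q3" using S_M8[OF x] by blast
  have c: "M8 0 0 p1 0 p2 0 0 0 \<in> S \<and> M8 0 0 0 q1 0 q2 0 0 \<in> S"
    using components[OF D, of "[(0, M8 s t 0 0 0 0 0 q3), (1, M8 0 0 p1 0 p2 0 0 0), (9, M8 0 0 0 q1 0 q2 0 0), (4, M8 0 0 0 0 0 0 p3 0)]"] x[unfolded xe]
    by (simp add: lie_lie_D2 M8_scaleR M8_add M8_0)
  have "lie (lie (M8 0 0 p1 0 p2 0 0 0) (D2 1 1)) (M8 0 0 p1 0 p2 0 0 0) \<in> S" using tri D c by blast
  then have "M8 (4*p1*p1 - 2*p2*p2) (4*p2*p2 - 2*p1*p1) 0 0 0 0 0 (-6*p1*p2) \<in> S"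
    unfolding lie_lie_M8 by (simp add: algebra_simps)
  from cent[OF this] have p: "p1 = 0 \<and> p2 = 0" by auto
  have "lie (lie (M8 0 0 0 q1 0 q2 0 0) (D2 1 1)) (M8 0 0 0 q1 0 q2 0 0) \<in> S" using tri D c by blast
  then have "M8 (6*q2*q2) (6*q1*q1) 0 0 0 0 0 (6*q1*q2) \<in> S"
    unfolding lie_lie_M8 by (simp add: algebra_simps)
  from cent[OF this] have "q1 = 0 \<and> q2 = 0" by auto
  then show "x \<in> std_family4c" using p unfolding xe std_family4c_def by blast
qed

text \<open>(0, 1, -1) is the coroot of the long root \<open>s\<^sub>2 - s\<^sub>3\<close>. The
  eigenvalue 1 has a four-dimensional eigenspace, where \<open>cent\<close> gives the two quadratic
  equations \<open>eqs\<close>. Everything depends on the sums \<open>p2 + q2\<close> and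
  \<open>p3 + q3\<close>, which record the action on axis 0: if they vanish throughout, that axis is
  a common kernel; otherwise \<open>S\<close> is at most a plane with a common kernel vector
  orthogonal to \<open>V0\<close>.\<close>

lemma long_coroot_case:
  assumes D: "D2 0 1 \<in> S" and cent: "\<And>s t p. M8 s t p 0 0 0 0 0 \<in> S \<Longrightarrow> s = 0 \<and> p = 0"
  shows "S \<subseteq> std_family3 \<or> (\<exists>y z. (y \<noteq> 0 \<or> z \<noteq> 0) \<and> (\<forall>x\<in>S. x *v v7 0 0 y 0 0 0 z = 0))"
proof -
  have comp: "s = 0 \<and> p1 = 0 \<and> M8 0 0 0 q1 0 0 0 0 \<in> S \<and> M8 0 0 0 0 p2 q2 p3 q3 \<in> S"
    if X: "M8 s t p1 q1 p2 q2 p3 q3 \<in> S" for s t p1 q1 p2 q2 p3 q3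
    using components[OF D, of "[(0, M8 s t p1 0 0 0 0 0), (4, M8 0 0 0 q1 0 0 0 0), (1, M8 0 0 0 0 p2 q2 p3 q3)]"] X cent[of s t p1]
    by (simp add: lie_lie_D2 M8_scaleR M8_add M8_0)
  have eqs: "(p3 - q3) * (p3 + q3) = (p2 - q2) * (p2 + q2) \<and> p2 * (p3 + q3) + p3 * (p2 + q2) = 0"
    if Y: "M8 0 0 0 0 p2 q2 p3 q3 \<in> S" for p2 q2 p3 q3
  proof -
    have "lie (lie (M8 0 0 0 0 p2 q2 p3 q3) (D2 0 1)) (M8 0 0 0 0 p2 q2 p3 q3) \<in> S" using tri D Y by blast
    then have "M8 (2*p3*p3 + 2*q2*q2 - 2*q3*q3 - 2*p2*p2) (2*p3*p3 + 2*q3*q3 + 4*p2*p2) (4*p2*p3 + 2*p2*q3 + 2*p3*q2) 0 0 0 0 0 \<in> S"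
      unfolding lie_lie_M8 by (simp add: algebra_simps)
    from cent[OF this] show ?thesis by (simp add: algebra_simps)
  qed
  show ?thesis
  proof (cases "\<forall>p2 q2 p3 q3. M8 0 0 0 0 p2 q2 p3 q3 \<in> S \<longrightarrow> p2 + q2 = 0 \<and> p3 + q3 = 0")
    case True
    have "x \<in> std_family3" if x: "x \<in> S" for x
    proof -
      obtain s t p1 q1 p2 q2 p3 q3 where xe: "x = M8 s t p1 q1 p2 q2 p3 q3" using S_M8[OF x] by blast
      note c = comp[OF x[unfolded xe]]
      have "p2 + q2 = 0 \<and> p3 + q3 = 0" using c True by blast
      then have "q2 = - p2 \<and> q3 = - p3" by simp
      then show ?thesis using c unfolding xe std_family3_def by blast
    qed
    then show ?thesis by blast
  next
    case False
    then obtain p2 q2 p3 q3 where Y: "M8 0 0 0 0 p2 q2 p3 q3 \<in> S" and AB: "p2 + q2 \<noteq> 0 \<or> p3 + q3 \<noteq> 0" by blast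
    \<comment> \<open>If the pair of sums took all values, \<open>eqs\<close> would determine the
      elements over (1, 0) and (0, 1) up to nothing but the values 1/2 and 0, and their sum would
      violate \<open>eqs\<close>.\<close>
    have indep: "(p2 + q2) * (p3' + q3') = (p2' + q2') * (p3 + q3)" if Y': "M8 0 0 0 0 p2' q2' p3' q3' \<in> S" for p2' q2' p3' q3'
    proof (rule ccontr)
      define A B A' B' where AB: "A = p2 + q2" "B = p3 + q3" "A' = p2' + q2'" "B' = p3' + q3'"
      define e where "e = A * B' - A' * B"
      assume "(p2 + q2) * (p3' + q3') \<noteq> (p2' + q2') * (p3 + q3)"
      then have e: "e \<noteq> 0" by (simp add: e_def AB)
      have z: "\<exists>p r. M8 0 0 0 0 p (x - p) r (y - r) \<in> S" for x y
      proof -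
        define k k' where "k = (x * B' - y * A') / e" "k' = (A * y - B * x) / e"
        have kx: "k * A + k' * A' = x" "k * B + k' * B' = y"
        proof -
          have "(x * B' - y * A') * A + (A * y - B * x) * A' = x * e" "(x * B' - y * A') * B + (A * y - B * x) * B' = y * e"
            by (simp_all add: e_def algebra_simps)
          then show "k * A + k' * A' = x" "k * B + k' * B' = y"
            using e unfolding k_k'_def by (simp_all add: add_divide_distrib[symmetric])
        qed
        have "k *\<^sub>R M8 0 0 0 0 p2 q2 p3 q3 + k' *\<^sub>R M8 0 0 0 0 p2' q2' p3' q3' \<in> S" using Y Y' plus scale by blast
        moreover have "k * q2 + k' * q2' = x - (k * p2 + k' * p2')" "k * q3 + k' * q3' = y - (k * p3 + k' * p3')"
          using kx unfolding AB by (simp_all add: algebra_simps)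
        ultimately show ?thesis unfolding M8_scaleR M8_add by auto
      qed
      obtain p r where 1: "M8 0 0 0 0 p (1 - p) r (0 - r) \<in> S" using z by blast
      obtain p' r' where 2: "M8 0 0 0 0 p' (0 - p') r' (1 - r') \<in> S" using z by blast
      have "p = 1/2" "r = 0" "p' = 0" "r' = 1/2" using eqs[OF 1] eqs[OF 2] by simp_all
      then have "M8 0 0 0 0 (1/2) (1/2) (1/2) (1/2) = M8 0 0 0 0 p (1 - p) r (0 - r) + M8 0 0 0 0 p' (0 - p') r' (1 - r')"
        by (simp add: M8_add M8_eq_iff)
      then have "M8 0 0 0 0 (1/2) (1/2) (1/2) (1/2) \<in> S" using plus[OF 1 2] by simp
      from eqs[OF this] show False by simp
    qed
    \<comment> \<open>Bracketing with this root vector sends the pair of sums \<open>(A, B)\<close>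
      to \<open>(-2 B, 2 A)\<close>, which is not parallel to it.\<close>
    have q1: "q1 = 0" if "M8 0 0 0 q1 0 0 0 0 \<in> S" for q1
    proof (rule ccontr)
      assume "q1 \<noteq> 0"
      then have "M8 0 0 0 1 0 0 0 0 \<in> S" using that unit_component(2) by blast
      then have "lie (lie (M8 0 0 0 1 0 0 0 0) (D2 0 1)) (M8 0 0 0 0 p2 q2 p3 q3) \<in> S" using tri D Y by blast
      then have "M8 0 0 0 0 (-2*p3) (-2*q3) (2*p2) (2*q2) \<in> S" unfolding lie_lie_M8 by simp
      from indep[OF this] have "(p2 + q2)^2 + (p3 + q3)^2 = 0" by (simp add: algebra_simps power2_eq_square)
      then show False using AB by simp
    qed
    \<comment> \<open>Subtracting \<open>k\<close> times the fixed element leaves one with both sums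
      zero. Polarising \<open>eqs\<close> against the fixed element gives a linear system with
      determinant \<open>A^2 + B^2\<close>, so the remainder vanishes.\<close>
    have kap: "\<exists>k. p2' = k * p2 \<and> q2' = k * q2 \<and> p3' = k * p3 \<and> q3' = k * q3" if Y': "M8 0 0 0 0 p2' q2' p3' q3' \<in> S" for p2' q2' p3' q3'
    proof -
      obtain k where k: "p2' + q2' = k * (p2 + q2)" "p3' + q3' = k * (p3 + q3)"
      proof (cases "p2 + q2 = 0")
        case False
        then show ?thesis using that[of "(p2' + q2')/(p2 + q2)"] indep[OF Y'] by (simp add: field_simps)
      next
        case True
        then show ?thesis using that[of "(p3' + q3')/(p3 + q3)"] indep[OF Y'] AB by simp
      qed
      define p r where "p = p2' - k * p2" "r = p3' - k * p3"
      have "M8 0 0 0 0 p2' q2' p3' q3' - k *\<^sub>R M8 0 0 0 0 p2 q2 p3 q3 \<in> S" using Y Y' minus scale by blast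
      moreover have "q2' - k * q2 = - p" "q3' - k * q3 = - r" using k unfolding p_r_def by (simp_all add: algebra_simps)
      ultimately have Z: "M8 0 0 0 0 p (- p) r (- r) \<in> S" by (simp add: M8_scaleR M8_diff p_r_def)
      have YZ: "M8 0 0 0 0 (p2 + p) (q2 + - p) (p3 + r) (q3 + - r) \<in> S" using plus[OF Y Z] by (simp add: M8_add)
      define A B where AB': "A = p2 + q2" "B = p3 + q3"
      have "B * r = A * p" "A * r + B * p = 0"
        using eqs[OF YZ] eqs[OF Y] unfolding AB' by (simp_all add: algebra_simps)
      then have "(A^2 + B^2) * r = 0" "(A^2 + B^2) * p = 0" by algebra+
      moreover have "A^2 + B^2 \<noteq> 0" using AB unfolding AB' by (simp add: sum_power2_eq_zero_iff)
      ultimately have "p = 0" "r = 0" by auto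
      then show ?thesis using \<open>q2' - k * q2 = - p\<close> \<open>q3' - k * q3 = - r\<close> unfolding p_r_def by (intro exI[of _ k]) simp
    qed
    have det: "p2 * (p2 - q2) + p3 * (p3 - q3) = 0"
    proof -
      have "(p2 + q2) * (p2 * (p2 - q2) + p3 * (p3 - q3)) = 0" "(p3 + q3) * (p2 * (p2 - q2) + p3 * (p3 - q3)) = 0"
        using eqs[OF Y] by algebra+
      then show ?thesis using AB by auto
    qed
    \<comment> \<open>A nonzero solution of two linear equations in two unknowns, whose determinant
      is zero by \<open>det\<close>.\<close>
    obtain y z where yz: "y \<noteq> 0 \<or> z \<noteq> 0" and k1: "- 2 * p2 * y + (p3 - q3) * z = 0" and k2: "- 2 * p3 * y + (q2 - p2) * z = 0"
    proof (cases "p3 - q3 \<noteq> 0 \<or> p2 \<noteq> 0")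
      case True
      show ?thesis
        by (rule that[of "p3 - q3" "2 * p2"]) (use True det in \<open>simp_all add: algebra_simps\<close>)
    next
      case F: False
      show ?thesis
      proof (cases "q2 - p2 \<noteq> 0 \<or> p3 \<noteq> 0")
        case True
        show ?thesis
          by (rule that[of "q2 - p2" "2 * p3"]) (use F True det in \<open>simp_all add: algebra_simps\<close>)
      next
        case False
        show ?thesis by (rule that[of 1 0]) (use F False in auto)
      qed
    qed
    have "x *v v7 0 0 y 0 0 0 z = 0" if x: "x \<in> S" for x
    proof -
      obtain s t p1' q1' p2' q2' p3' q3' where xe: "x = M8 s t p1' q1' p2' q2' p3' q3'" using S_M8[OF x] by blast
      note c = comp[OF x[unfolded xe]]
      have "q1' = 0" using c q1 by blast
      moreover obtain k where "p2' = k * p2" "q2' = k * q2" "p3' = k * p3" "q3' = k * q3" using c kap by blast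
      moreover have "k * (- 2 * p2 * y + (p3 - q3) * z) = 0" "k * (- 2 * p3 * y + (q2 - p2) * z) = 0" using k1 k2 by simp_all
      ultimately show ?thesis using c unfolding xe M8_mult by (simp add: algebra_simps)
    qed
    then show ?thesis using yz by blast
  qed
qed

end

section \<open>Automorphisms and frames\<close>

declare transpose_matrix_vector [simp del]

text \<open>The transpose stands for the inverse: it agrees with it on \<open>aut7\<close> and keeps
  the map visibly polynomial.\<close>

definition conj7 :: "'a::comm_ring_1^7^7 \<Rightarrow> 'a^7^7 \<Rightarrow> 'a^7^7" where
  "conj7 g d = g ** d ** transpose g"

lemma aut7D:
  fixes g :: "'a::field^7^7"
  assumes "aut7 g"
  shows "transpose g ** g = mat 1" "g ** transpose g = mat 1" "g *v cross7 x y = cross7 (g *v x) (g *v y)"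
  using assms matrix_left_right_inverse[of "transpose g" g] by (auto simp: aut7_def)

lemma aut7_inverse_vec:
  fixes g :: "'a::field^7^7"
  assumes "aut7 g"
  shows "transpose g *v (g *v x) = x" "g *v (transpose g *v x) = x"
  by (simp_all add: matrix_vector_mul_assoc aut7D[OF assms])

lemma aut7_transpose:
  fixes g :: "'a::field^7^7"
  assumes "aut7 g"
  shows "aut7 (transpose g)"
proof -
  have "transpose g *v cross7 x y = cross7 (transpose g *v x) (transpose g *v y)" for x y
    using arg_cong[OF aut7D(3)[OF assms, of "transpose g *v x" "transpose g *v y"], of "\<lambda>z. transpose g *v z"]
    by (simp add: aut7_inverse_vec[OF assms])
  then show ?thesis unfolding aut7_def by (simp add: transpose_transpose aut7D[OF assms])
qed

lemma aut7_mult: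
  fixes g h :: "'a::field^7^7"
  assumes "aut7 g" "aut7 h"
  shows "aut7 (g ** h)"
proof -
  have "transpose (g ** h) ** (g ** h) = transpose h ** (transpose g ** g) ** h"
    by (simp add: matrix_transpose_mul matrix_mul_assoc)
  then show ?thesis using assms unfolding aut7_def
    by (simp add: aut7D[OF assms(1)] aut7D[OF assms(2)] flip: matrix_vector_mul_assoc)
qed

lemma conj7_mult: "conj7 (g ** h) d = conj7 g (conj7 h d)"
  by (simp add: conj7_def matrix_transpose_mul matrix_mul_assoc)

lemma conj7_transpose:
  fixes g :: "'a::field^7^7"
  assumes "aut7 g"
  shows "conj7 g (conj7 (transpose g) d) = d" "conj7 (transpose g) (conj7 g d) = d"
  unfolding conj7_mult[symmetric] aut7D[OF assms] by (simp_all add: conj7_def transpose_mat)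

lemma conj7_mult_vec:
  fixes g :: "'a::field^7^7"
  assumes "aut7 g"
  shows "conj7 g d *v (g *v x) = g *v (d *v x)" "conj7 g d *v x = g *v (d *v (transpose g *v x))"
proof -
  show "conj7 g d *v x = g *v (d *v (transpose g *v x))" for x
    by (simp add: conj7_def matrix_vector_mul_assoc matrix_mul_assoc)
  then show "conj7 g d *v (g *v x) = g *v (d *v x)" by (simp add: aut7_inverse_vec[OF assms])
qed

lemma conj7_lie:
  fixes g :: "'a::field^7^7"
  assumes "aut7 g"
  shows "lie (conj7 g x) (conj7 g y) = conj7 g (lie x y)"
proof -
  have "conj7 g x ** conj7 g y = g ** x ** (transpose g ** g) ** y ** transpose g" for x y
    by (simp add: conj7_def matrix_mul_assoc)
  then have "conj7 g x ** conj7 g y = conj7 g (x ** y)" for x y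
    by (simp add: aut7D[OF assms] conj7_def matrix_mul_assoc)
  moreover have "conj7 g (x - y) = conj7 g x - conj7 g y" for x y
    by (simp add: conj7_def matrix_mult_diff_left matrix_mult_diff_right)
  ultimately show ?thesis by (simp add: lie_def)
qed

lemma linear_conj7: "linear (conj7 (g::real^7^7))"
  by (rule linearI) (simp_all add: conj7_def vec_eq_iff matrix_matrix_mult_def sum.distrib sum_distrib_left sum_distrib_right algebra_simps)

lemma inj_conj7: "aut7 (g::real^7^7) \<Longrightarrow> inj (conj7 g)"
  by (rule inj_on_inverseI[of _ "conj7 (transpose g)"]) (simp add: conj7_transpose)

lemma dim_conj7: "aut7 (g::real^7^7) \<Longrightarrow> dim (conj7 g ` S) = dim S"
  by (rule dim_image_eq[OF linear_conj7]) (meson inj_conj7 inj_on_subset subset_UNIV)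

lemma der7_conj7:
  fixes g :: "'a::field^7^7"
  assumes g: "aut7 g"
  shows "der7 (conj7 g d) \<longleftrightarrow> der7 d"
proof -
  have 1: "der7 (conj7 g d)" if g: "aut7 g" and d: "der7 d" for g d :: "'a^7^7"
  proof -
    have "conj7 g d *v cross7 x y = cross7 (conj7 g d *v x) y + cross7 x (conj7 g d *v y)" for x y
    proof -
      have "d *v cross7 a b = cross7 (d *v a) b + cross7 a (d *v b)" for a b using d by (simp add: der7_def)
      then show ?thesis
        by (simp add: conj7_mult_vec(2)[OF g] aut7D(3)[OF g] aut7D(3)[OF aut7_transpose[OF g]] aut7_inverse_vec[OF g] matrix_vector_right_distrib)
    qed
    then show ?thesis by (simp add: der7_def)
  qed
  show ?thesis using 1[OF g] 1[OF aut7_transpose[OF g], of "conj7 g d"] by (auto simp: conj7_transpose[OF g])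
qed

lemma dot7_aut7:
  fixes g :: "'a::field^7^7"
  assumes "aut7 g"
  shows "dot7 (g *v x) (g *v y) = dot7 x y"
proof -
  have d: "dot7 x y = (\<Sum>i\<in>UNIV. x$i * y$i)" for x y :: "'a^7" by (simp add: dot7_def sum_7)
  have a: "dot7 (A *v x) y = dot7 x (transpose A *v y)" for A :: "'a^7^7" and x y
    unfolding d matrix_vector_mult_def transpose_def
    by (simp add: sum_distrib_left sum_distrib_right) (subst sum.swap, simp add: mult_ac)
  show ?thesis by (simp add: a aut7_inverse_vec[OF assms])
qed

section \<open>Transport of subspaces and subalgebras along automorphisms\<close>

abbreviation img :: "real^7^7 \<Rightarrow> (real^7) set \<Rightarrow> (real^7) set" where
  "img g V \<equiv> (*v) g ` V"

lemma perp_img: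
  assumes g: "aut7 g"
  shows "perp (img g V) = img g (perp V)"
proof -
  have "x \<in> img g (perp V)" if x: "x \<in> perp (img g V)" for x
  proof (rule image_eqI[of _ _ "transpose g *v x"])
    show "transpose g *v x \<in> perp V" unfolding perp_def
    proof (safe)
      fix v assume "v \<in> V"
      then have "dot7 (g *v v) x = 0" using x by (simp add: perp_def inner_eq_dot7)
      then have "dot7 (g *v v) (g *v (transpose g *v x)) = 0" by (simp add: aut7_inverse_vec[OF g])
      then show "inner v (transpose g *v x) = 0" by (simp add: dot7_aut7[OF g] inner_eq_dot7)
    qed
  qed (simp add: aut7_inverse_vec[OF g])
  moreover have "g *v y \<in> perp (img g V)" if "y \<in> perp V" for y
    using that by (auto simp: perp_def inner_eq_dot7 dot7_aut7[OF g])
  ultimately show ?thesis by blast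
qed

lemma img_iff:
  assumes "aut7 g"
  shows "g *v x \<in> img g U \<longleftrightarrow> x \<in> U"
  by (metis (no_types, lifting) assms aut7_inverse_vec(1) image_iff)

lemma conj7_m4: assumes "aut7 g" shows "conj7 g d \<in> m4 (img g V) \<longleftrightarrow> d \<in> m4 V"
  unfolding m4_def g2_iff_der7 perp_img[OF assms]
  by (simp add: der7_conj7[OF assms] conj7_mult_vec(1)[OF assms] img_iff[OF assms])

lemma conj7_h4: assumes "aut7 g" shows "conj7 g d \<in> h4 (img g V) \<longleftrightarrow> d \<in> h4 V"
  unfolding h4_def g2_iff_der7 perp_img[OF assms]
  by (simp add: der7_conj7[OF assms] conj7_mult_vec(1)[OF assms] img_iff[OF assms])

lemma conj7_h2: assumes "aut7 g" shows "conj7 g d \<in> h2 (g *v u) \<longleftrightarrow> d \<in> h2 u"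
proof -
  have "g *v y = 0 \<longleftrightarrow> y = 0" for y using aut7_inverse_vec(1)[OF assms, of y] by (metis matrix_vector_mult_0_right)
  then show ?thesis
    unfolding h2_def g2_iff_der7 by (simp add: der7_conj7[OF assms] conj7_mult_vec(1)[OF assms])
qed

lemma conj7_image_eq:
  fixes g :: "real^7^7"
  assumes "aut7 g" "\<And>d. conj7 g d \<in> B \<longleftrightarrow> d \<in> A"
  shows "conj7 g ` A = B"
proof -
  have "d \<in> conj7 g ` A" if "d \<in> B" for d
    by (rule image_eqI[of _ _ "conj7 (transpose g) d"]) (use that assms(2)[of "conj7 (transpose g) d"] in \<open>simp_all add: conj7_transpose[OF assms(1)]\<close>)
  then show ?thesis using assms(2) by blast
qed

lemma LTS_conj7:
  assumes g: "aut7 g" and S: "LTS V S"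
  shows "LTS (img g V) (conj7 g ` S)"
  unfolding LTS_def
proof (intro conjI ballI)
  show "subspace (conj7 g ` S)" using S by (simp add: LTS_def linear_subspace_image[OF linear_conj7])
  show "conj7 g ` S \<subseteq> m4 (img g V)" using S conj7_m4[OF g] by (auto simp: LTS_def)
  fix x y z assume "x \<in> conj7 g ` S" "y \<in> conj7 g ` S" "z \<in> conj7 g ` S"
  then show "lie (lie x y) z \<in> conj7 g ` S" using S by (auto simp: conj7_lie[OF g] LTS_def)
qed

lemma img_transpose: "aut7 g \<Longrightarrow> img (transpose g) (img g V) = V" "aut7 g \<Longrightarrow> img g (img (transpose g) V) = V"
  by (auto simp: image_image aut7_inverse_vec)

section \<open>Frames adapted to a subspace in \<open>MS\<close>\<close>

lemma frame7_axis:
  "frame7 a b c *v axis 0 1 = a" "frame7 a b c *v axis 1 1 = b" "frame7 a b c *v axis 2 1 = c"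
  "frame7 a b c *v axis 3 1 = cross7 a b" "frame7 a b c *v axis 4 1 = cross7 b c"
  "frame7 a b c *v axis 5 1 = cross7 c (cross7 a b)" "frame7 a b c *v axis 6 1 = cross7 a c"
  unfolding frame7_def transpose_v7_mult by (simp_all add: axis_v7)

lemma linear_mult_vec: "linear ((*v) (g::real^7^7))"
  by (rule matrix_vector_mul_linear)

lemma dim_img: "aut7 g \<Longrightarrow> dim (img g U) = dim U"
  by (rule dim_image_eq[OF linear_mult_vec]) (metis aut7_inverse_vec(1) inj_onI)

lemma dim_V0: "subspace V0" "dim V0 = 3"
proof -
  have V: "V0 = {x. \<forall>i. i \<notin> {0,1,3} \<longrightarrow> x$i = 0}"
    unfolding V0_def forall_7 by simp
  show "dim V0 = 3" unfolding V dim_vec_eq[symmetric] dim_substandard_cart by simp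
  show "subspace V0" unfolding V0_def subspace_def by simp
qed

lemma V0_MS: "V0 \<in> MS"
  unfolding MS_def using dim_V0 by (auto simp: V0_def cross7_v7)

lemma MS_img:
  assumes "aut7 g" "W \<in> MS"
  shows "img g W \<in> MS"
proof -
  have "subspace (img g W)" using assms(2) linear_subspace_image[OF linear_mult_vec] by (simp add: MS_def)
  then show ?thesis using assms(2) unfolding MS_def
    by (auto simp: dim_img[OF assms(1)] aut7D(3)[OF assms(1), symmetric])
qed

text \<open>This reduces every \<open>V\<close> to \<open>V0\<close> while leaving the choice of the
  orthonormal pair and of the normal vector free; the diagonalisation and the treatment of families
  2 to 4 exploit that freedom.\<close>

lemma frame_V0:
  assumes V: "V \<in> MS" and u: "u1 \<in> V" "u2 \<in> V" "dot7 u1 u1 = 1" "dot7 u2 u2 = 1" "dot7 u1 u2 = 0"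
    and l: "l \<in> perp V" "dot7 l l = 1"
  shows "aut7 (frame7 u1 u2 l)" "img (frame7 u1 u2 l) V0 = V"
proof -
  have c: "cross7 u1 u2 \<in> V" and sV: "subspace V" and dV: "dim V = 3" using V u by (auto simp: MS_def)
  have "dot7 v l = 0" if "v \<in> V" for v using l that by (simp add: perp_def inner_eq_dot7)
  then have "basic7 u1 u2 l" unfolding basic7_def using u l c by blast
  then show g: "aut7 (frame7 u1 u2 l)" by (rule aut7_frame7)
  have "frame7 u1 u2 l *v x \<in> V" if "x \<in> V0" for x
  proof -
    have "frame7 u1 u2 l *v x = x$0 *\<^sub>R u1 + x$1 *\<^sub>R u2 + x$3 *\<^sub>R cross7 u1 u2"
      using that unfolding frame7_def transpose_v7_mult V0_def by (simp add: scalar_mult_eq_scaleR)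
    then show ?thesis using u c sV by (simp add: subspace_add subspace_scale)
  qed
  then have sub: "img (frame7 u1 u2 l) V0 \<subseteq> V" by blast
  show "img (frame7 u1 u2 l) V0 = V"
    by (rule subspace_dim_equal[OF linear_subspace_image[OF linear_mult_vec dim_V0(1)] sV sub])
       (simp add: dim_img[OF g] dim_V0 dV)
qed

text \<open>The first variation at a maximum vanishes: comparing \<open>u\<close> with
  \<open>u + t *s v\<close> gives \<open>2 * t * c <= t^2 * K\<close> for all
  \<open>t\<close>.\<close>

lemma maximizer_orthogonal:
  fixes H :: "real^7^7"
  assumes U: "subspace U" and u: "u \<in> U" "dot7 u u = 1"
    and max: "\<And>w. w \<in> U \<Longrightarrow> dot7 (H *v w) (H *v w) \<le> dot7 (H *v u) (H *v u) * dot7 w w"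
    and v: "v \<in> U" "dot7 u v = 0"
  shows "dot7 (H *v u) (H *v v) = 0"
proof (rule ccontr)
  define c K where "c = dot7 (H *v u) (H *v v)" and "K = dot7 (H *v u) (H *v u) * dot7 v v - dot7 (H *v v) (H *v v)"
  assume "dot7 (H *v u) (H *v v) \<noteq> 0"
  then have c: "c \<noteq> 0" by (simp add: c_def)
  have K: "0 \<le> K" using max[OF v(1)] by (simp add: K_def)
  have ineq: "2 * t * c \<le> t^2 * K" for t
  proof -
    have "u + t *s v \<in> U" using U u v by (simp add: subspace_add subspace_scale scalar_mult_eq_scaleR)
    from max[OF this] show ?thesis
      by (simp add: matrix_vector_right_distrib vector_scalar_commute dot7_add_left dot7_add_right dot7_smult_left dot7_smult_right
           dot7_commute[of v u] dot7_commute[of "H *v v" "H *v u"] u(2) v(2) c_def K_def power2_eq_square algebra_simps)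
  qed
  \<comment> \<open>Small enough that \<open>r * K < 2\<close>; then \<open>t = c * r\<close>
    contradicts the inequality.\<close>
  define r where "r = 1 / (K + 1)"
  have r: "r > 0" "r * K < 2" using K by (simp_all add: r_def field_simps)
  have "(c^2 * r) * 2 \<le> (c^2 * r) * (r * K)"
    using ineq[of "c * r"] by (simp add: power2_eq_square algebra_simps)
  moreover have "c^2 * r > 0" using c r by simp
  ultimately have "2 \<le> r * K" by (simp only: mult_le_cancel_left_pos)
  then show False using r by simp
qed

lemma exists_maximizer:
  fixes H :: "real^7^7"
  assumes U: "subspace U" "U \<noteq> {0}"
  obtains u where "u \<in> U" "dot7 u u = 1"
    "\<And>w. w \<in> U \<Longrightarrow> dot7 (H *v w) (H *v w) \<le> dot7 (H *v u) (H *v u) * dot7 w w"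
proof -
  have nrm: "dot7 x x = (norm x)^2" for x :: "real^7"
    by (simp add: inner_eq_dot7[symmetric] power2_norm_eq_inner)
  obtain x where x: "x \<in> U" "x \<noteq> 0" using U subspace_0 by blast
  have "(1 / norm x) *\<^sub>R x \<in> U \<inter> sphere 0 1" using x U(1) by (simp add: subspace_scale)
  then have ne: "U \<inter> sphere 0 1 \<noteq> {}" by blast
  have cp: "compact (U \<inter> sphere 0 1)" using closed_subspace[OF U(1)] by (simp add: closed_Int_compact)
  have "continuous_on (U \<inter> sphere 0 1) (\<lambda>w. norm (H *v w))"
    by (intro continuous_on_norm linear_continuous_on) (simp add: linear_conv_bounded_linear[symmetric] linear_mult_vec)
  from continuous_attains_sup[OF cp ne this] obtain u where u: "u \<in> U" "norm u = 1"
    and m: "\<And>w. w \<in> U \<Longrightarrow> norm w = 1 \<Longrightarrow> norm (H *v w) \<le> norm (H *v u)" by auto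
  show ?thesis
  proof (rule that[OF u(1)])
    show "dot7 u u = 1" by (simp add: nrm u)
    fix w assume w: "w \<in> U"
    show "dot7 (H *v w) (H *v w) \<le> dot7 (H *v u) (H *v u) * dot7 w w"
    proof (cases "w = 0")
      case False
      have "norm (H *v ((1 / norm w) *\<^sub>R w)) \<le> norm (H *v u)"
        by (rule m) (use w False U(1) in \<open>auto simp: subspace_scale\<close>)
      then have "norm (H *v w) \<le> norm (H *v u) * norm w"
        using False by (simp add: matrix_vector_mult_scaleR field_simps)
      then show ?thesis unfolding nrm power_mult_distrib[symmetric] by (simp add: power_mono)
    qed (simp add: dot7_0_left)
  qed
qed

lemma MS_frame_exists:
  assumes V: "V \<in> MS" and u: "u \<in> V" "dot7 u u = 1"
  obtains u2 l where "u2 \<in> V" "dot7 u2 u2 = 1" "dot7 u u2 = 0" "l \<in> perp V" "dot7 l l = 1"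
proof -
  have sV: "subspace V" and dV: "dim V = 3" using V by (auto simp: MS_def)
  \<comment> \<open>For the zero matrix the maximiser is simply some unit vector.\<close>
  have unit: "\<exists>x\<in>U. dot7 x x = 1" if "subspace U" "U \<noteq> {0}" for U :: "(real^7) set"
    using exists_maximizer[OF that, of 0] by blast
  have sp: "subspace {x. dot7 u x = 0}" by (simp add: subspace_def dot7_0_right dot7_add_right dot7_smult_right flip: scalar_mult_eq_scaleR)
  have "V \<inter> {x. dot7 u x = 0} \<noteq> {0}"
  proof
    assume z: "V \<inter> {x. dot7 u x = 0} = {0}"
    have "x \<in> span {u}" if x: "x \<in> V" for x
    proof -
      have "x - dot7 u x *s u \<in> V" using x u sV by (simp add: subspace_diff subspace_scale scalar_mult_eq_scaleR)
      moreover have "dot7 u (x - dot7 u x *s u) = 0" using u by (simp add: dot7_diff_right dot7_smult_right)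
      ultimately have "x - dot7 u x *s u \<in> V \<inter> {x. dot7 u x = 0}" by blast
      then have "x - dot7 u x *s u = 0" unfolding z by blast
      then have "x = dot7 u x *s u" by (simp only: right_minus_eq)
      then show ?thesis unfolding scalar_mult_eq_scaleR by (metis span_base span_scale singletonI)
    qed
    then have "dim V \<le> dim (span {u})" by (intro dim_subset) blast
    then show False using dV dim_le_card'[of "{u}"] by (simp add: dim_span)
  qed
  then obtain u2 where u2: "u2 \<in> V" "dot7 u u2 = 0" "dot7 u2 u2 = 1" using unit subspace_inter[OF sV sp] by blast
  have spp: "subspace (perp V)" unfolding perp_def by (simp add: subspace_def inner_right_distrib)
  have "span V \<noteq> UNIV"
  proof
    assume "span V = UNIV"
    then have "dim V = DIM(real^7)" by (metis dim_UNIV dim_span)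
    then show False using dV by simp
  qed
  from span_not_UNIV_orthogonal[OF this] obtain l0 where "l0 \<noteq> 0" "\<And>v. v \<in> V \<Longrightarrow> inner l0 v = 0"
    by (meson span_base)
  then have "l0 \<in> perp V" "l0 \<noteq> 0" by (auto simp: perp_def inner_commute)
  then obtain l where "l \<in> perp V" "dot7 l l = 1" using unit spp by blast
  then show ?thesis using that u2 by blast
qed

definition framed :: "(real^7) set \<Rightarrow> real^7^7 \<Rightarrow> bool" where
  "framed V g \<longleftrightarrow> aut7 g \<and> img g V0 = V"

lemma framed_pull:
  assumes "framed V g" "H \<in> m4 V"
  shows "conj7 (transpose g) H \<in> m4 V0"
  using assms conj7_m4[of g "conj7 (transpose g) H" V0] by (simp add: framed_def conj7_transpose)

text \<open>A singular value decomposition on \<open>V\<close>: \<open>u1\<close> maximises the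
  length of \<open>H *v w\<close> on \<open>V\<close>, \<open>u2\<close> on the part of
  \<open>V\<close> orthogonal to \<open>u1\<close>, and \<open>u3\<close> is their product, so the
  three images are orthogonal. With \<open>l\<close> fixed by the first image, the entries of
  \<open>M8\<close> and this orthogonality leave only \<open>s1\<close> and
  \<open>s2\<close>.\<close>

lemma m4_diagonalize:
  assumes V: "V \<in> MS" and H: "H \<in> m4 V" "H \<noteq> 0"
  obtains g a b where "framed V g" "H = conj7 g (D2 a b)"
proof -
  have sV: "subspace V" and dV: "dim V = 3" and cV: "\<And>x y. x \<in> V \<Longrightarrow> y \<in> V \<Longrightarrow> cross7 x y \<in> V" using V by (auto simp: MS_def)
  have nV: "V \<noteq> {0}" using dV by auto
  obtain u1 where u1: "u1 \<in> V" "dot7 u1 u1 = 1"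
    and m1: "\<And>w. w \<in> V \<Longrightarrow> dot7 (H *v w) (H *v w) \<le> dot7 (H *v u1) (H *v u1) * dot7 w w"
    using exists_maximizer[OF sV nV] by blast
  define U where "U = V \<inter> {x. dot7 u1 x = 0}"
  have sU: "subspace U" unfolding U_def
    by (rule subspace_inter[OF sV]) (simp add: subspace_def dot7_0_right dot7_add_right dot7_smult_right flip: scalar_mult_eq_scaleR)
  obtain v2 l0 where v2: "v2 \<in> V" "dot7 v2 v2 = 1" "dot7 u1 v2 = 0" and l0: "l0 \<in> perp V" "dot7 l0 l0 = 1"
    using MS_frame_exists[OF V u1] by blast
  have "v2 \<in> U" "v2 \<noteq> 0" using v2 by (auto simp: U_def dot7_0_left)
  then have "U \<noteq> {0}" by blast
  then obtain u2 where u2: "u2 \<in> U" "dot7 u2 u2 = 1"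
    and m2: "\<And>w. w \<in> U \<Longrightarrow> dot7 (H *v w) (H *v w) \<le> dot7 (H *v u2) (H *v u2) * dot7 w w"
    using exists_maximizer[OF sU] by blast
  have u2V: "u2 \<in> V" and o12: "dot7 u1 u2 = 0" using u2 by (auto simp: U_def)
  define u3 where "u3 = cross7 u1 u2"
  have u3: "u3 \<in> V" "dot7 u1 u3 = 0" "dot7 u2 u3 = 0" using cV u1 u2V by (simp_all add: u3_def dot7_cross7_self)
  have h12: "dot7 (H *v u1) (H *v u2) = 0" by (rule maximizer_orthogonal[OF sV u1 m1 u2V o12])
  have h13: "dot7 (H *v u1) (H *v u3) = 0" by (rule maximizer_orthogonal[OF sV u1 m1 u3(1,2)])
  have u3U: "u3 \<in> U" using u3 by (simp add: U_def)
  have h23: "dot7 (H *v u2) (H *v u3) = 0" by (rule maximizer_orthogonal[OF sU u2 m2 u3U u3(3)])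
  have dp: "dot7 x x > 0" if "x \<noteq> 0" for x :: "real^7" using that by (simp add: inner_eq_dot7[symmetric])
  have Hu1: "H *v u1 \<noteq> 0"
  proof
    assume "H *v u1 = 0"
    then have z: "H *v w = 0" if "w \<in> V" for w
      using m1[OF that] dp[of "H *v w"] by (metis dot7_0_left mult_zero_left not_less)
    have f: "framed V (frame7 u1 u2 l0)" unfolding framed_def using frame_V0[OF V u1(1) u2V u1(2) u2(2) o12 l0] by blast
    obtain s1 s2 p1 q1 p2 q2 p3 q3 where X: "conj7 (transpose (frame7 u1 u2 l0)) H = M8 s1 s2 p1 q1 p2 q2 p3 q3"
      using framed_pull[OF f H(1)] m4_V0 by blast
    have "M8 s1 s2 p1 q1 p2 q2 p3 q3 *v axis i 1 = 0" if "frame7 u1 u2 l0 *v axis i 1 \<in> V" for i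
      unfolding X[symmetric] using f z[OF that] by (simp add: framed_def conj7_mult_vec(2) aut7_transpose transpose_transpose)
    note zz = this
    have "M8 s1 s2 p1 q1 p2 q2 p3 q3 *v axis 0 1 = 0" "M8 s1 s2 p1 q1 p2 q2 p3 q3 *v axis 1 1 = 0" "M8 s1 s2 p1 q1 p2 q2 p3 q3 *v axis 3 1 = 0"
      by (rule zz, use u1(1) u2V u3(1) in \<open>simp only: frame7_axis u3_def\<close>)+
    then have "M8 s1 s2 p1 q1 p2 q2 p3 q3 = 0"
      unfolding M8_mult M8_eq_0_iff axis_v7 by auto
    then have "conj7 (frame7 u1 u2 l0) (conj7 (transpose (frame7 u1 u2 l0)) H) = 0" unfolding X by (simp add: conj7_def)
    then show False using f H(2) by (simp add: framed_def conj7_transpose)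
  qed
  define n where "n = sqrt (dot7 (H *v u1) (H *v u1))"
  have n: "n > 0" "n^2 = dot7 (H *v u1) (H *v u1)" using dp[OF Hu1] by (simp_all add: n_def)
  \<comment> \<open>Chosen so that \<open>cross7 u1 l\<close> is the normalised image of
    \<open>u1\<close>; in the frame, axis 0 then goes to \<open>n\<close> times axis 6, as for a
    diagonal element.\<close>
  define l where "l = (- 1 / n) *s cross7 u1 (H *v u1)"
  have HV: "H *v u1 \<in> perp V" using H(1) u1 by (simp add: m4_def)
  have ou: "dot7 u1 (H *v u1) = 0" using HV u1 by (simp add: perp_def inner_eq_dot7)
  have lV: "l \<in> perp V"
  proof -
    have "dot7 v l = 0" if "v \<in> V" for v
      using HV cV[OF that u1(1)] by (simp add: l_def dot7_smult_right dot7_minus_right dot7_cross7[symmetric] perp_def inner_eq_dot7)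
    then show ?thesis by (simp add: perp_def inner_eq_dot7)
  qed
  have cl: "cross7 u1 l = (1 / n) *s (H *v u1)"
    unfolding l_def cross7_smult_right cross7_cross7_orth[OF ou] u1(2) by simp
  have l1: "dot7 l l = 1"
  proof -
    have "dot7 l l = (1 / n) * (1 / n) * dot7 (cross7 u1 (H *v u1)) (cross7 u1 (H *v u1))"
      by (simp add: l_def dot7_smult_left dot7_smult_right dot7_minus_left dot7_minus_right)
    also have "dot7 (cross7 u1 (H *v u1)) (cross7 u1 (H *v u1)) = - dot7 (cross7 (H *v u1) u1) (cross7 u1 (H *v u1))"
      by (subst (1) cross7_anticomm) (rule dot7_minus_left)
    also have "\<dots> = - dot7 (H *v u1) (cross7 u1 (cross7 u1 (H *v u1)))" by (simp add: dot7_cross7)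
    also have "\<dots> = n^2" unfolding cross7_cross7_orth[OF ou] u1(2) by (simp add: dot7_minus_right n)
    finally show ?thesis using n by (simp add: power2_eq_square)
  qed
  define g where "g = frame7 u1 u2 l"
  have f: "framed V g" unfolding framed_def g_def using frame_V0[OF V u1(1) u2V u1(2) u2(2) o12 lV l1] by blast
  then have g: "aut7 g" by (simp add: framed_def)
  obtain s1 s2 p1 q1 p2 q2 p3 q3 where X: "conj7 (transpose g) H = M8 s1 s2 p1 q1 p2 q2 p3 q3"
    using framed_pull[OF f H(1)] m4_V0 by blast
  have Xv: "M8 s1 s2 p1 q1 p2 q2 p3 q3 *v x = transpose g *v (H *v (g *v x))" for x
    unfolding X[symmetric] by (simp add: conj7_mult_vec(2)[OF aut7_transpose[OF g]] transpose_transpose)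
  have Xd: "dot7 (M8 s1 s2 p1 q1 p2 q2 p3 q3 *v x) (M8 s1 s2 p1 q1 p2 q2 p3 q3 *v y) = dot7 (H *v (g *v x)) (H *v (g *v y))" for x y
    unfolding Xv by (rule dot7_aut7[OF aut7_transpose[OF g]])
  have "H *v u1 = n *s (g *v axis 6 1)" using n by (simp add: g_def frame7_axis cl)
  then have "M8 s1 s2 p1 q1 p2 q2 p3 q3 *v axis 0 1 = n *s axis 6 1"
    unfolding Xv by (simp add: g_def frame7_axis(1) vector_scalar_commute aut7_inverse_vec[OF g, unfolded g_def])
  then have e0: "p1 = 0" "p3 + q3 = 0" "p2 + q2 = 0" "s1 = n" unfolding M8_mult axis_v7 by simp_all
  have "dot7 (M8 s1 s2 p1 q1 p2 q2 p3 q3 *v axis 0 1) (M8 s1 s2 p1 q1 p2 q2 p3 q3 *v axis 1 1) = 0"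
    "dot7 (M8 s1 s2 p1 q1 p2 q2 p3 q3 *v axis 0 1) (M8 s1 s2 p1 q1 p2 q2 p3 q3 *v axis 3 1) = 0"
    "dot7 (M8 s1 s2 p1 q1 p2 q2 p3 q3 *v axis 1 1) (M8 s1 s2 p1 q1 p2 q2 p3 q3 *v axis 3 1) = 0"
    unfolding Xd unfolding g_def frame7_axis u3_def[symmetric] by (rule h12 h13 h23)+
  then have o: "n * (q3 - p3) = 0" "n * (p2 - q2) = 0" "4*p2*p3 + s2*(p1 - q1) + (p1 + q1)*(s1 + s2) + (q3-p3)*(p2-q2) = 0"
    unfolding M8_mult axis_v7 dot7_def using e0 by (simp_all add: algebra_simps)
  have "q3 = 0" "p3 = 0" "q2 = 0" "p2 = 0" using o(1,2) e0 n by auto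
  moreover from this o(3) e0 n have "q1 = 0" by (simp add: algebra_simps)
  ultimately have "conj7 (transpose g) H = D2 s1 s2" using X e0 by simp
  then have "H = conj7 g (D2 s1 s2)" using conj7_transpose(1)[OF g, of H] by simp
  then show ?thesis using that f by blast
qed

section \<open>Diagonal pairs of a subsystem and their permutations\<close>

abbreviation pull :: "real^7^7 \<Rightarrow> (real^7^7) set \<Rightarrow> (real^7^7) set" where
  "pull g S \<equiv> conj7 (transpose g) ` S"

lemma framed_compose: "framed V g \<Longrightarrow> aut7 t \<Longrightarrow> img t V0 = V0 \<Longrightarrow> framed V (g ** t)"
  unfolding framed_def by (auto simp: aut7_mult matrix_vector_mul_assoc[symmetric] image_image[symmetric, of "(*v) g" "(*v) t"])

lemma pull_compose: "pull (g ** t) S = pull t (pull g S)"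
  by (simp add: image_image conj7_mult matrix_transpose_mul)

text \<open>The frame may depend on the pair, so two pairs need not come from a common Cartan
  subspace.\<close>

definition diag_in :: "(real^7) set \<Rightarrow> (real^7^7) set \<Rightarrow> real \<Rightarrow> real \<Rightarrow> bool" where
  "diag_in V S a b \<longleftrightarrow> (\<exists>g. framed V g \<and> D2 a b \<in> pull g S)"

text \<open>Both automorphisms permute the axes 0, 1, 3 up to sign, by a transposition and a
  3-cycle; so they generate all permutations of \<open>(a, b, - a - b)\<close>.\<close>

lemma frame7_std_swap:
  "aut7 (frame7 (axis 1 1) (axis 0 1) (axis 2 (1::real)))" "img (frame7 (axis 1 1) (axis 0 1) (axis 2 1)) V0 = V0"
  and frame7_std_rotate:
  "aut7 (frame7 (axis 1 1) (axis 3 1) (axis 2 (1::real)))" "img (frame7 (axis 1 1) (axis 3 1) (axis 2 1)) V0 = V0"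
proof -
  have a: "axis 0 1 \<in> V0" "axis 1 1 \<in> V0" "axis 3 1 \<in> V0" "axis 2 1 \<in> perp V0"
    unfolding perp_V0 by (simp_all add: V0_def axis_v7)
  show "aut7 (frame7 (axis 1 1) (axis 0 1) (axis 2 (1::real)))" "img (frame7 (axis 1 1) (axis 0 1) (axis 2 1)) V0 = V0"
    by (rule frame_V0[OF V0_MS a(2,1) _ _ _ a(4)]; simp add: dot7_def axis_v7)+
  show "aut7 (frame7 (axis 1 1) (axis 3 1) (axis 2 (1::real)))" "img (frame7 (axis 1 1) (axis 3 1) (axis 2 1)) V0 = V0"
    by (rule frame_V0[OF V0_MS a(2,3) _ _ _ a(4)]; simp add: dot7_def axis_v7)+
qed

lemma transpose_v7: "transpose (v7 r0 r1 r2 r3 r4 r5 r6) = v7 (v7 (r0$0) (r1$0) (r2$0) (r3$0) (r4$0) (r5$0) (r6$0))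
   (v7 (r0$1) (r1$1) (r2$1) (r3$1) (r4$1) (r5$1) (r6$1)) (v7 (r0$2) (r1$2) (r2$2) (r3$2) (r4$2) (r5$2) (r6$2))
   (v7 (r0$3) (r1$3) (r2$3) (r3$3) (r4$3) (r5$3) (r6$3)) (v7 (r0$4) (r1$4) (r2$4) (r3$4) (r4$4) (r5$4) (r6$4))
   (v7 (r0$5) (r1$5) (r2$5) (r3$5) (r4$5) (r5$5) (r6$5)) (v7 (r0$6) (r1$6) (r2$6) (r3$6) (r4$6) (r5$6) (r6$6))"
  by (simp add: vec_eq_7 transpose_def)

lemma pull_D2_swap: "conj7 (transpose (frame7 (axis 1 1) (axis 0 1) (axis 2 1))) (D2 a b) = D2 b a"
  and pull_D2_rotate: "conj7 (transpose (frame7 (axis 1 1) (axis 3 1) (axis 2 1))) (D2 a b) = D2 b (- a - b)"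
  unfolding conj7_def frame7_def transpose_transpose cross7_v7 axis_v7 v7_nth transpose_v7 M8_def
  by (simp_all add: matrix_mult_v7 vector_matrix_mult_v7)

lemma diag_in_swap: "diag_in V S a b \<Longrightarrow> diag_in V S b a"
  unfolding diag_in_def
  using framed_compose[OF _ frame7_std_swap] pull_D2_swap[of a b] pull_compose
  by (metis image_eqI)

lemma diag_in_rotate: "diag_in V S a b \<Longrightarrow> diag_in V S b (- a - b)"
  unfolding diag_in_def
  using framed_compose[OF _ frame7_std_rotate] pull_D2_rotate[of a b] pull_compose
  by (metis image_eqI)

lemma framed_std_lts:
  assumes "framed V g" "LTS V S"
  shows "std_lts (pull g S)"
proof
  have "LTS (img (transpose g) V) (pull g S)"
    using assms by (intro LTS_conj7) (simp_all add: framed_def aut7_transpose)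
  then show "LTS V0 (pull g S)" using assms img_transpose by (auto simp: framed_def)
qed

lemma diag_in_scale:
  assumes "LTS V S" "diag_in V S a b"
  shows "diag_in V S (r * a) (r * b)"
proof -
  obtain g where g: "framed V g" "D2 a b \<in> pull g S" using assms(2) unfolding diag_in_def by blast
  interpret std_lts "pull g S" by (rule framed_std_lts[OF g(1) assms(1)])
  have "D2 (r * a) (r * b) \<in> pull g S" using scale[OF g(2), of r] by (simp add: M8_scaleR)
  then show ?thesis using g unfolding diag_in_def by blast
qed

lemma diagonalize_pull:
  assumes V: "V \<in> MS" and S: "LTS V S" and g: "framed V g" and X: "X \<in> pull g S" "X \<noteq> 0"
  obtains a b k where "diag_in V S a b" "aut7 k" "img k V0 = V0" "X = conj7 k (D2 a b)"
proof -
  obtain H where H: "H \<in> S" "X = conj7 (transpose g) H" using X by blast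
  have ag: "aut7 g" using g by (simp add: framed_def)
  have "H \<noteq> 0" using H X by (auto simp: conj7_def)
  then obtain g' a b where g': "framed V g'" "H = conj7 g' (D2 a b)"
    using m4_diagonalize[OF V] H S by (metis LTS_def subset_iff)
  have ag': "aut7 g'" using g' by (simp add: framed_def)
  show ?thesis
  proof (rule that[of a b "transpose g ** g'"])
    have "D2 a b = conj7 (transpose g') H" using g' conj7_transpose[OF ag'] by simp
    then show "diag_in V S a b" unfolding diag_in_def using g' H by blast
    show "aut7 (transpose g ** g')" by (rule aut7_mult[OF aut7_transpose[OF ag] ag'])
    have "img (transpose g ** g') V0 = img (transpose g) (img g' V0)" by (simp add: image_image matrix_vector_mul_assoc)
    then show "img (transpose g ** g') V0 = V0"
      using g g' img_transpose(1)[OF ag, of V0] by (simp add: framed_def)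
    show "X = conj7 (transpose g ** g') (D2 a b)" using H g' by (simp add: conj7_mult)
  qed
qed

text \<open>Detects a vanishing short root without knowing the diagonalising automorphism
  \<open>k\<close>.\<close>

lemma D2_zero_kernel:
  assumes k: "aut7 k" "img k V0 = V0" and z: "a = 0 \<or> b = 0 \<or> a + b = 0"
  obtains x where "x \<in> V0" "x \<noteq> 0" "conj7 k (D2 a b) *v x = 0"
proof -
  have "\<exists>y. y \<in> V0 \<and> y \<noteq> 0 \<and> D2 a b *v y = 0"
  proof -
    have "axis 0 1 \<in> V0" "axis 1 1 \<in> V0" "axis 3 1 \<in> V0" by (simp_all add: V0_def axis_v7)
    moreover have "axis 0 (1::real) \<noteq> (0::real^7)" "axis 1 (1::real) \<noteq> (0::real^7)" "axis 3 (1::real) \<noteq> (0::real^7)"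
      by (simp_all add: axis_v7)
    moreover have "D2 a b *v axis 0 1 = 0 \<or> D2 a b *v axis 1 1 = 0 \<or> D2 a b *v axis 3 1 = 0"
      using z unfolding M8_mult axis_v7 by auto
    ultimately show ?thesis by blast
  qed
  then obtain y where y: "y \<in> V0" "y \<noteq> 0" "D2 a b *v y = 0" by blast
  show ?thesis
  proof (rule that[of "k *v y"])
    show "k *v y \<in> V0" using k y by blast
    show "k *v y \<noteq> 0" using y aut7_inverse_vec(1)[OF k(1), of y] by force
    show "conj7 k (D2 a b) *v (k *v y) = 0" using y by (simp add: conj7_mult_vec(1)[OF k(1)])
  qed
qed

text \<open>Detects a vanishing long root. If two coordinates equal \<open>d\<close>, the third is
  \<open>-2 * d\<close>; with \<open>m = d^2\<close> the square of the matrix has eigenvalues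
  \<open>- m\<close> and \<open>- 4 * m\<close> on \<open>V0\<close>, and the relation is
  \<open>(X^2 + m) (X^2 + 4 m) = 0\<close>.\<close>

lemma D2_double_quartic:
  assumes k: "aut7 k" "img k V0 = V0" and z: "a = b \<or> b = - a - b \<or> a = - a - b"
  obtains m where "\<And>x. x \<in> V0 \<Longrightarrow> conj7 k (D2 a b) *v (conj7 k (D2 a b) *v (conj7 k (D2 a b) *v (conj7 k (D2 a b) *v x)))
     + (5 * m) *s (conj7 k (D2 a b) *v (conj7 k (D2 a b) *v x)) + (4 * m^2) *s x = 0"
proof -
  obtain m where q: "a^2 * a^2 - 5 * m * a^2 + 4 * m^2 = 0" "b^2 * b^2 - 5 * m * b^2 + 4 * m^2 = 0"
    "(a+b)^2 * (a+b)^2 - 5 * m * (a+b)^2 + 4 * m^2 = 0"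
  proof -
    consider "a = b" | "a = - 2 * b" | "b = - 2 * a" using z by linarith
    then show ?thesis
    proof cases
      case 1 show ?thesis by (rule that[of "a^2"]) (simp_all add: 1 power2_eq_square algebra_simps)
    next
      case 2 show ?thesis by (rule that[of "b^2"]) (simp_all add: 2 power2_eq_square algebra_simps)
    next
      case 3 show ?thesis by (rule that[of "a^2"]) (simp_all add: 3 power2_eq_square algebra_simps)
    qed
  qed
  have D: "D2 a b *v (D2 a b *v (D2 a b *v (D2 a b *v y))) + (5 * m) *s (D2 a b *v (D2 a b *v y)) + (4 * m^2) *s y = 0" if "y \<in> V0" for y
  proof -
    have v: "y$2 = 0" "y$4 = 0" "y$5 = 0" "y$6 = 0" using that by (simp_all add: V0_def)
    have D2D2: "D2 a b *v (D2 a b *v x) = v7 (- (a\<^sup>2 * x$0)) (- (b\<^sup>2 * x$1)) 0 (- ((a + b)\<^sup>2 * x$3)) 0 0 0"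
      if "x$2 = 0" "x$4 = 0" "x$5 = 0" "x$6 = 0" for x
      using that by (simp add: M8_mult power2_eq_square algebra_simps)
    have "D2 a b *v (D2 a b *v (D2 a b *v (D2 a b *v y))) + (5 * m) *s (D2 a b *v (D2 a b *v y)) + (4 * m^2) *s y =
       v7 ((a^2 * a^2 - 5 * m * a^2 + 4 * m^2) * y$0) ((b^2 * b^2 - 5 * m * b^2 + 4 * m^2) * y$1) 0
         (((a+b)^2 * (a+b)^2 - 5 * m * (a+b)^2 + 4 * m^2) * y$3) 0 0 0"
      unfolding vec_eq_7 by (simp add: v D2D2) (simp add: left_diff_distrib distrib_right mult.assoc)
    then show ?thesis unfolding q by (simp add: zero_v7)
  qed
  show ?thesis
  proof (rule that)
    fix x assume x: "x \<in> V0"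
    define y where "y = transpose k *v x"
    have y: "y \<in> V0" using x k img_transpose(1)[OF k(1), of V0] by (auto simp: y_def)
    have xy: "x = k *v y" by (simp add: y_def aut7_inverse_vec[OF k(1)])
    show "conj7 k (D2 a b) *v (conj7 k (D2 a b) *v (conj7 k (D2 a b) *v (conj7 k (D2 a b) *v x)))
     + (5 * m) *s (conj7 k (D2 a b) *v (conj7 k (D2 a b) *v x)) + (4 * m^2) *s x = 0"
      unfolding xy conj7_mult_vec(1)[OF k(1)]
      using arg_cong[OF D[OF y], of "(*v) k"]
      by (simp add: matrix_vector_right_distrib vector_scalar_commute)
  qed
qed

text \<open>The last alternative is family 2 with kernel vector in the plane of axes 2 and 6;
  allowing it avoids another change of frame.\<close>

definition lts_conclusion :: "(real^7^7) set \<Rightarrow> bool" where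
  "lts_conclusion S \<longleftrightarrow> S \<subseteq> std_family2 \<or> S \<subseteq> std_family3 \<or> S \<subseteq> std_family4a \<or> S \<subseteq> std_family4b \<or> S \<subseteq> std_family4c \<or> (\<exists>c. c\<^sup>2 = 3/5 \<and> S \<subseteq> std_family1 c)
     \<or> (\<exists>y z. (y \<noteq> 0 \<or> z \<noteq> 0) \<and> (\<forall>x\<in>S. x *v v7 0 0 y 0 0 0 z = 0))"

lemma lts_reduction:
  assumes V: "V \<in> MS" and S: "LTS V S" and ne: "S \<noteq> m4 V"
  obtains g where "framed V g" "lts_conclusion (pull g S)"
proof -
  note res = that
  have pne: "pull g S \<noteq> m4 V0" if g: "framed V g" for g
  proof
    assume p: "pull g S = m4 V0"
    have ag: "aut7 g" using g by (simp add: framed_def)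
    have "conj7 g ` pull g S = S" by (simp add: image_image conj7_transpose[OF ag])
    moreover have "conj7 g ` m4 V0 = m4 V" using conj7_image_eq[OF ag conj7_m4[OF ag]] g by (simp add: framed_def)
    ultimately show False using ne p by simp
  qed
  show ?thesis
  proof (cases "\<exists>g. framed V g \<and> D2 1 0 \<in> pull g S \<and> D2 0 1 \<in> pull g S")
    case True
    then obtain g where g: "framed V g" "D2 1 0 \<in> pull g S" "D2 0 1 \<in> pull g S" by blast
    interpret std_lts "pull g S" by (rule framed_std_lts[OF g(1) S])
    show ?thesis using res[OF g(1)] cartan_case[OF g(2,3) pne[OF g(1)]] unfolding lts_conclusion_def by blast
  next
    case nf: False
    have regular_nc: ?thesis if d: "diag_in V S a b" and nz: "a \<noteq> 0" "b \<noteq> 0" "a + b \<noteq> 0" "a \<noteq> b" "2*a + b \<noteq> 0" "a + 2*b \<noteq> 0" for a b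
    proof (cases "b \<noteq> 2*a \<and> a \<noteq> 2*b \<and> 3*b \<noteq> -2*a \<and> a \<noteq> -3*b \<and> 3*a \<noteq> -2*b \<and> b \<noteq> -3*a")
      case True
      obtain g where g: "framed V g" "D2 a b \<in> pull g S" using d unfolding diag_in_def by blast
      interpret std_lts "pull g S" by (rule framed_std_lts[OF g(1) S])
      have "pull g S \<subseteq> std_family2" by (rule regular_case[OF g(2) _ nz]) (use nf g True in blast)+
      then show ?thesis using res[OF g(1)] unfolding lts_conclusion_def by blast
    next
      case False
      have d1: "diag_in V S b a" by (rule diag_in_swap[OF d])
      have d2: "diag_in V S b (- a - b)" by (rule diag_in_rotate[OF d])
      have d3: "diag_in V S (- a - b) b" by (rule diag_in_swap[OF d2])
      have d4: "diag_in V S (- a - b) a" using diag_in_rotate[OF d2] by simp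
      have d5: "diag_in V S a (- a - b)" by (rule diag_in_swap[OF d4])
      \<comment> \<open>Up to scale the triple is a permutation of (1, 2, -3), and \<open>d1\<close>
        to \<open>d5\<close> list the other arrangements.\<close>
      have "\<exists>x. x \<noteq> 0 \<and> diag_in V S x (2 * x)"
      proof -
        consider "b = 2*a" | "a = 2*b" | "3*b = -2*a" | "a = -3*b" | "3*a = -2*b" | "b = -3*a" using False by blast
        then show ?thesis
        proof cases
          case 1 then show ?thesis using d nz by blast
        next
          case 2 then show ?thesis using d1 nz by blast
        next
          case 3 
          then have "b = 2 * (- a - b)" by simp
          then show ?thesis using d3 nz by (metis mult_zero_right)
        next
          case 4
          then have "- a - b = 2 * b" by simp
          then show ?thesis using d2 nz by metis
        next
          case 5
          then have "a = 2 * (- a - b)" by simp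
          then show ?thesis using d4 nz by (metis mult_zero_right)
        next
          case 6
          then have "- a - b = 2 * a" by simp
          then show ?thesis using d5 nz by metis
        qed
      qed
      then obtain x where x: "x \<noteq> 0" "diag_in V S x (2 * x)" by blast
      then have "diag_in V S (1/x * x) (1/x * (2*x))" using diag_in_scale[OF S] by blast
      then have "diag_in V S 1 2" using x by simp
      then obtain g where g: "framed V g" "D2 1 2 \<in> pull g S" unfolding diag_in_def by blast
      interpret std_lts "pull g S" by (rule framed_std_lts[OF g(1) S])
      have "\<not> (D2 1 0 \<in> pull g S \<and> D2 0 1 \<in> pull g S)" using nf g by blast
      from principal_case[OF g(2) this] show ?thesis
        using res[OF g(1)] unfolding lts_conclusion_def by blast
    qed
    show ?thesis
    proof (cases "\<exists>a b. diag_in V S a b \<and> a \<noteq> 0 \<and> b \<noteq> 0 \<and> a + b \<noteq> 0 \<and> a \<noteq> b \<and> 2*a + b \<noteq> 0 \<and> a + 2*b \<noteq> 0")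
      case True
      then show ?thesis using regular_nc by blast
    next
      case sing: False
      show ?thesis
      proof (cases "diag_in V S 1 1")
        case True
        then obtain g where g: "framed V g" "D2 1 1 \<in> pull g S" unfolding diag_in_def by blast
        interpret std_lts "pull g S" by (rule framed_std_lts[OF g(1) S])
        have "s = t \<and> q = 0" if st: "M8 s t 0 0 0 0 0 q \<in> pull g S" for s t q
        proof (rule ccontr)
          assume n: "\<not> (s = t \<and> q = 0)"
          have q: "q \<noteq> 0"
          proof
            assume q0: "q = 0"
            have "1 * t \<noteq> 1 * s" using n q0 by simp
            from cartan_full[OF g(2) st[unfolded q0] this] show False using nf g(1) by blast
          qed
          define al R where "al = (s - t) / 2" and "R = al^2 + q^2"
          have R: "R > 0" using q unfolding R_def by (simp add: add_nonneg_pos)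
          \<comment> \<open>After this shift \<open>X\<close> corresponds to \<open>sqrt R\<close>
            times (3, 1, -4), a regular point. The two detection lemmas turn this into a
            contradiction with \<open>sing\<close>: \<open>X\<close> is injective on
            \<open>V0\<close>, and axis 0 forces \<open>m = 2 * R\<close>, which fails on axis
            3.\<close>
          define ta where "ta = 2 * sqrt R"
          have ta: "ta^2 = 4 * R" "ta \<noteq> 0" using R by (simp_all add: ta_def power_mult_distrib)
          define X where "X = M8 (al + ta) (ta - al) 0 0 0 0 0 q"
          have "M8 s t 0 0 0 0 0 q + (ta - (s + t) / 2) *\<^sub>R D2 1 1 \<in> pull g S" using st g scale plus by blast
          moreover have "M8 s t 0 0 0 0 0 q + (ta - (s + t) / 2) *\<^sub>R D2 1 1 = X"
            unfolding X_def M8_scaleR M8_add M8_eq_iff al_def by (simp add: field_simps)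
          ultimately have X: "X \<in> pull g S" by simp
          have X0: "X \<noteq> 0" unfolding X_def M8_eq_0_iff using q by simp
          obtain a b k where d: "diag_in V S a b" and k: "aut7 k" "img k V0 = V0" and Xk: "X = conj7 k (D2 a b)"
            using diagonalize_pull[OF V S g(1) X X0] by blast
          have inj: "x = 0" if "x \<in> V0" "X *v x = 0" for x
          proof -
            have e: "q * x$0 + (ta - al) * x$1 = 0" "(2 * ta) * x$3 = 0" "(al + ta) * x$0 + q * x$1 = 0" and v: "x$2 = 0" "x$4 = 0" "x$5 = 0" "x$6 = 0"
              using that unfolding X_def M8_mult V0_def by simp_all
            have "(ta^2 - R) * x$0 = 0" "(ta^2 - R) * x$1 = 0" using e(1,3) unfolding R_def by algebra+
            moreover have "ta^2 - R \<noteq> 0" using ta R by simp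
            ultimately have "x$0 = 0" "x$1 = 0" "x$3 = 0" using e(2) ta by auto
            then show ?thesis using v by (simp add: vec_eq_7)
          qed
          have nk: "\<not> (a = 0 \<or> b = 0 \<or> a + b = 0)"
            using D2_zero_kernel[OF k] inj unfolding Xk by metis
          then have "a = b \<or> b = - a - b \<or> a = - a - b" using sing d by force
          then obtain m where m: "\<And>x. x \<in> V0 \<Longrightarrow> X *v (X *v (X *v (X *v x))) + (5 * m) *s (X *v (X *v x)) + (4 * m^2) *s x = 0"
            using D2_double_quartic[OF k] unfolding Xk by blast
          have ax: "axis 0 1 \<in> V0" "axis 3 1 \<in> V0" by (simp_all add: V0_def axis_v7)
          have X01: "X *v (X *v v7 x y 0 0 0 0 0) = v7 (- (q^2 + (al + ta)^2) * x - 2 * q * ta * y) (- 2 * q * ta * x - (q^2 + (ta - al)^2) * y) 0 0 0 0 0"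
            and X3: "X *v (X *v v7 0 0 0 x 0 0 0) = v7 0 0 0 (- 4 * ta^2 * x) 0 0 0" for x y
            by (simp_all add: X_def M8_mult power2_eq_square algebra_simps)
          have "(X *v (X *v (X *v (X *v axis 0 1))) + (5 * m) *s (X *v (X *v axis 0 1)) + (4 * m^2) *s axis 0 1) $ 1 = 0" using m[OF ax(1)] by simp
          then have "2 * q * ta * (2 * q^2 + 2 * al^2 + 2 * ta^2 - 5 * m) = 0"
            unfolding axis_v7 X01 by (simp add: power2_eq_square algebra_simps)
          then have "2 * q^2 + 2 * al^2 + 2 * ta^2 = 5 * m" using q ta by simp
          then have mR: "m = 2 * R" unfolding ta R_def by simp
          have "(X *v (X *v (X *v (X *v axis 3 1))) + (5 * m) *s (X *v (X *v axis 3 1)) + (4 * m^2) *s axis 3 1) $ 3 = 0" using m[OF ax(2)] by simp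
          then have "(4 * ta^2 - m) * (4 * ta^2 - 4 * m) = 0"
            unfolding axis_v7 X3 by (simp add: power2_eq_square algebra_simps)
          then show False using R unfolding ta mR by simp
        qed
        from short_coroot_case[OF g(2) this] show ?thesis using res[OF g(1)] unfolding lts_conclusion_def by blast
      next
        case no11: False
        show ?thesis
        proof (cases "S \<subseteq> {0}")
          case True
          obtain u where u: "u \<in> V" "dot7 u u = 1"
          proof -
            have "subspace V" "V \<noteq> {0}" using V by (auto simp: MS_def)
            from exists_maximizer[OF this] show ?thesis using that by blast
          qed
          obtain u2 l where ul: "u2 \<in> V" "dot7 u2 u2 = 1" "dot7 u u2 = 0" "l \<in> perp V" "dot7 l l = 1"
            using MS_frame_exists[OF V u] by blast
          have "framed V (frame7 u u2 l)" unfolding framed_def using frame_V0[OF V u(1) ul(1) u(2) ul(2-5)] by blast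
          moreover have "pull (frame7 u u2 l) S \<subseteq> std_family2"
          proof -
            have "conj7 g 0 = 0" for g :: "real^7^7" by (simp add: conj7_def)
            moreover have "0 \<in> std_family2" unfolding std_family2_def M8_0[symmetric] by blast
            ultimately show ?thesis using True by auto
          qed
          ultimately show ?thesis using res unfolding lts_conclusion_def by blast
        next
          case False
          then obtain H where H: "H \<in> S" "H \<noteq> 0" by blast
          \<comment> \<open>A singular pair without a zero coordinate has a repeated one, hence
            could be permuted and scaled to (1, 1), which \<open>no11\<close> excludes.\<close>
          have zero: "a = 0 \<or> b = 0 \<or> a + b = 0" if d: "diag_in V S a b" and nz: "a \<noteq> 0 \<or> b \<noteq> 0" for a b
          proof (rule ccontr)
            assume n: "\<not> (a = 0 \<or> b = 0 \<or> a + b = 0)"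
            have "\<exists>x. x \<noteq> 0 \<and> diag_in V S x x"
            proof -
              consider "a = b" | "b = - a - b" | "a = - a - b" using sing d n by force
              then show ?thesis
              proof cases
                case 1 then show ?thesis using d n by blast
              next
                case 2 then show ?thesis using diag_in_rotate[OF d] n by metis
              next
                case 3
                then have "- b - a = a" by simp
                then show ?thesis using diag_in_rotate[OF diag_in_swap[OF d]] n by metis
              qed
            qed
            then obtain x where x: "x \<noteq> 0" "diag_in V S x x" by blast
            then have "diag_in V S (1/x * x) (1/x * x)" using diag_in_scale[OF S] by blast
            then show False using no11 x by simp
          qed
          obtain g0 a0 b0 where g0: "framed V g0" "H = conj7 g0 (D2 a0 b0)" using m4_diagonalize[OF V] H S by (metis LTS_def subset_iff)
          have d0: "diag_in V S a0 b0" unfolding diag_in_def using g0 H conj7_transpose(2)[of g0 "D2 a0 b0"] by (metis framed_def image_eqI)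
          have nz0: "a0 \<noteq> 0 \<or> b0 \<noteq> 0" using H g0 by (auto simp: conj7_def M8_0)
          have "\<exists>x. x \<noteq> 0 \<and> diag_in V S 0 x"
          proof -
            consider "a0 = 0" "b0 \<noteq> 0" | "b0 = 0" "a0 \<noteq> 0" | "- a0 - b0 = 0" "b0 \<noteq> 0" using zero[OF d0 nz0] nz0 by force
            then show ?thesis
            proof cases
              case 1 then show ?thesis using d0 by blast
            next
              case 2 then show ?thesis using diag_in_swap[OF d0] by blast
            next
              case 3 then show ?thesis using diag_in_swap[OF diag_in_rotate[OF d0]] by auto
            qed
          qed
          then obtain x where x: "x \<noteq> 0" "diag_in V S 0 x" by blast
          then have "diag_in V S (1/x * 0) (1/x * x)" using diag_in_scale[OF S] by blast
          then have "diag_in V S 0 1" using x by simp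
          then obtain g where g: "framed V g" "D2 0 1 \<in> pull g S" unfolding diag_in_def by blast
          interpret std_lts "pull g S" by (rule framed_std_lts[OF g(1) S])
          have "s = 0 \<and> p = 0" if st: "M8 s t p 0 0 0 0 0 \<in> pull g S" for s t p
          proof (rule ccontr)
            assume n: "\<not> (s = 0 \<and> p = 0)"
            \<comment> \<open>Large enough to make the block of \<open>X\<close> on the axes 1 and 3
              of positive determinant \<open>ta * (s + ta) - p^2\<close>; then \<open>X\<close> is
              injective on \<open>V0\<close>, against \<open>zero\<close>.\<close>
            define ta where "ta = 1 + \<bar>s\<bar> + \<bar>p\<bar>"
            define X where "X = M8 s ta p 0 0 0 0 0"
            have "M8 s t p 0 0 0 0 0 + (ta - t) *\<^sub>R D2 0 1 \<in> pull g S" using st g scale plus by blast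
            then have X: "X \<in> pull g S" by (simp add: X_def M8_scaleR M8_add)
            have X0: "X \<noteq> 0" unfolding X_def M8_eq_0_iff using n by simp
            obtain a b k where d: "diag_in V S a b" and k: "aut7 k" "img k V0 = V0" and Xk: "X = conj7 k (D2 a b)"
              using diagonalize_pull[OF V S g(1) X X0] by blast
            have "a \<noteq> 0 \<or> b \<noteq> 0" using X0 Xk by (auto simp: conj7_def M8_0)
            from D2_zero_kernel[OF k zero[OF d this]] obtain x where x: "x \<in> V0" "x \<noteq> 0" "X *v x = 0" unfolding Xk by blast
            then have e: "p * x$0 = 0" "ta * x$1 + p * x$3 = 0" "p * x$1 + (s + ta) * x$3 = 0" "s * x$0 = 0" and v: "x$2 = 0" "x$4 = 0" "x$5 = 0" "x$6 = 0"
              unfolding X_def M8_mult V0_def by simp_all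
            have x0: "x$0 = 0" using e(1,4) n by auto
            define e' where "e' = ta * (s + ta) - p^2"
            have "(1 + \<bar>s\<bar> + \<bar>p\<bar>) * (1 + \<bar>p\<bar>) \<le> ta * (s + ta)" unfolding ta_def by (intro mult_left_mono) auto
            moreover have "p^2 < (1 + \<bar>s\<bar> + \<bar>p\<bar>) * (1 + \<bar>p\<bar>)"
            proof -
              have "p^2 = \<bar>p\<bar> * \<bar>p\<bar>" by (simp add: power2_eq_square)
              also have "\<dots> \<le> (1 + \<bar>s\<bar> + \<bar>p\<bar>) * \<bar>p\<bar>" by (intro mult_right_mono) auto
              also have "\<dots> < (1 + \<bar>s\<bar> + \<bar>p\<bar>) * (1 + \<bar>p\<bar>)" by (intro mult_strict_left_mono) auto
              finally show ?thesis .
            qed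
            ultimately have "e' > 0" unfolding e'_def by simp
            moreover have "e' * x$1 = 0" "e' * x$3 = 0" using e(2,3) unfolding e'_def by algebra+
            ultimately have "x$1 = 0" "x$3 = 0" by auto
            then show False using x(2) x0 v by (simp add: vec_eq_7)
          qed
          then have "pull g S \<subseteq> std_family3 \<or> (\<exists>y z. (y \<noteq> 0 \<or> z \<noteq> 0) \<and> (\<forall>x\<in>pull g S. x *v v7 0 0 y 0 0 0 z = 0))"
            by (intro long_coroot_case[OF g(2)])
          then have "lts_conclusion (pull g S)"
            unfolding lts_conclusion_def by (elim disjE) simp_all
          then show ?thesis by (rule res[OF g(1)])
        qed
      qed
    qed
  qed
qed

section \<open>The standard members of the families\<close>

lemma dim_std_family2: "dim std_family2 = 5"
proof -
  define f where "f = (\<lambda>(s, t, q1, q2, q3). M8 s t 0 q1 0 q2 0 q3)"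
  have "linear f" by (rule linearI) (auto simp: f_def M8_add M8_scaleR)
  moreover have "inj f" by (rule injI) (auto simp: f_def M8_eq_iff)
  ultimately have "dim (range f) = dim (UNIV :: (real \<times> real \<times> real \<times> real \<times> real) set)"
    by (intro dim_image_eq) (auto intro: inj_on_subset)
  moreover have "range f = std_family2" unfolding std_family2_def f_def by (auto simp: image_iff) blast+
  ultimately show ?thesis by simp
qed

lemma dim_std_family3: "dim std_family3 = 4"
proof -
  define f where "f = (\<lambda>(t, q, p, r). M8 0 t 0 q p (-p) r (-r))"
  have "linear f" by (rule linearI) (auto simp: f_def M8_add M8_scaleR)
  moreover have "inj f" by (rule injI) (auto simp: f_def M8_eq_iff)
  ultimately have "dim (range f) = dim (UNIV :: (real \<times> real \<times> real \<times> real) set)"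
    by (intro dim_image_eq) (auto intro: inj_on_subset)
  moreover have "range f = std_family3" unfolding std_family3_def f_def by (auto simp: image_iff) blast+
  ultimately show ?thesis by simp
qed

lemma dim_std_family4a: "dim std_family4a = 4"
proof -
  define f where "f = (\<lambda>(s, t, p, q). M8 s t p q 0 0 0 0)"
  have "linear f" by (rule linearI) (auto simp: f_def M8_add M8_scaleR)
  moreover have "inj f" by (rule injI) (auto simp: f_def M8_eq_iff)
  ultimately have "dim (range f) = dim (UNIV :: (real \<times> real \<times> real \<times> real) set)"
    by (intro dim_image_eq) (auto intro: inj_on_subset)
  moreover have "range f = std_family4a" unfolding std_family4a_def f_def by (auto simp: image_iff) blast+
  ultimately show ?thesis by simp
qed

lemma m4_in_g2: "d \<in> m4 V \<Longrightarrow> d \<in> g2"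
  by (simp add: m4_def)

lemma M8_in_g2: "M8 s1 s2 p1 q1 p2 q2 p3 q3 \<in> g2"
  using M8_in_m4 m4_in_g2 by blast

lemma std_family2_eq: "std_family2 = h2 (axis 2 1) \<inter> m4 V0"
proof
  show "std_family2 \<subseteq> h2 (axis 2 1) \<inter> m4 V0"
    unfolding std_family2_def h2_def by (auto simp: M8_in_m4 M8_in_g2 M8_mult axis_v7)
  show "h2 (axis 2 1) \<inter> m4 V0 \<subseteq> std_family2"
  proof
    fix d assume d: "d \<in> h2 (axis 2 1) \<inter> m4 V0"
    then obtain s1 s2 p1 q1 p2 q2 p3 q3 where de: "d = M8 s1 s2 p1 q1 p2 q2 p3 q3" using m4_V0 by blast
    have "d *v axis 2 1 = 0" using d by (simp add: h2_def)
    then have "p1 = 0 \<and> p2 = 0 \<and> p3 = 0" unfolding de M8_mult axis_v7 by simp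
    then show "d \<in> std_family2" unfolding de std_family2_def by blast
  qed
qed

lemma std_family3_eq: "std_family3 = h2 (axis 0 1) \<inter> m4 V0"
proof
  show "std_family3 \<subseteq> h2 (axis 0 1) \<inter> m4 V0"
    unfolding std_family3_def h2_def by (auto simp: M8_in_m4 M8_in_g2 M8_mult axis_v7)
  show "h2 (axis 0 1) \<inter> m4 V0 \<subseteq> std_family3"
  proof
    fix d assume d: "d \<in> h2 (axis 0 1) \<inter> m4 V0"
    then obtain s1 s2 p1 q1 p2 q2 p3 q3 where de: "d = M8 s1 s2 p1 q1 p2 q2 p3 q3" using m4_V0 by blast
    have "d *v axis 0 1 = 0" using d by (simp add: h2_def)
    then have "s1 = 0 \<and> p1 = 0 \<and> q2 = - p2 \<and> q3 = - p3" unfolding de M8_mult axis_v7 by auto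
    then show "d \<in> std_family3" unfolding de std_family3_def by blast
  qed
qed

definition coord7 :: "7 set \<Rightarrow> (real^7) set" where
  "coord7 I = {x. \<forall>i. i \<notin> I \<longrightarrow> x$i = 0}"

lemma subspace_coord7: "subspace (coord7 I)"
  by (simp add: coord7_def subspace_def)

lemma dim_coord7: "dim (coord7 I) = card I"
  unfolding coord7_def dim_vec_eq[symmetric] by (rule dim_substandard_cart)

lemma perp_coord7: "perp (coord7 I) = coord7 (- I)"
proof (intro equalityI subsetI)
  fix x assume x: "x \<in> perp (coord7 I)"
  have "x$i = 0" if "i \<in> I" for i
  proof -
    have "axis i 1 \<in> coord7 I" using that by (auto simp: coord7_def axis_def)
    then have "inner (axis i 1) x = 0" using x unfolding perp_def by blast
    then show ?thesis by (simp add: inner_axis')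
  qed
  then show "x \<in> coord7 (- I)" by (simp add: coord7_def)
next
  fix x assume x: "x \<in> coord7 (- I)"
  have "inner v x = 0" if "v \<in> coord7 I" for v
    unfolding inner_vec_def using that x by (intro sum.neutral) (auto simp: coord7_def)
  then show "x \<in> perp (coord7 I)" by (simp add: perp_def)
qed

text \<open>The three lines of the Fano plane through index 2; each meets \<open>{0, 1, 3}\<close>
  in one index, so each has vectors in both \<open>V0\<close> and its complement.\<close>

lemma coord7_MS: "coord7 {0,2,6} \<in> MS" "coord7 {1,2,4} \<in> MS" "coord7 {2,3,5} \<in> MS"
  unfolding MS_def using subspace_coord7 by (simp_all add: dim_coord7) (simp_all add: coord7_def forall_7 cross7_v7)

lemma std_family4a_eq: "std_family4a = h4 (coord7 {0,2,6}) \<inter> m4 V0"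
proof
  show "std_family4a \<subseteq> h4 (coord7 {0,2,6}) \<inter> m4 V0"
    unfolding std_family4a_def h4_def perp_coord7 by (auto simp: M8_in_m4 M8_in_g2 M8_mult coord7_def forall_7)
  show "h4 (coord7 {0,2,6}) \<inter> m4 V0 \<subseteq> std_family4a"
  proof
    fix d assume d: "d \<in> h4 (coord7 {0,2,6}) \<inter> m4 V0"
    then obtain s1 s2 p1 q1 p2 q2 p3 q3 where de: "d = M8 s1 s2 p1 q1 p2 q2 p3 q3" using m4_V0 by blast
    have "axis 1 1 \<in> perp (coord7 {0,2,6})" "axis 3 1 \<in> perp (coord7 {0,2,6})"
      unfolding perp_coord7 by (simp_all add: coord7_def forall_7 axis_v7)
    then have "d *v axis 1 1 \<in> perp (coord7 {0,2,6})" "d *v axis 3 1 \<in> perp (coord7 {0,2,6})" using d by (simp_all add: h4_def)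
    moreover have "axis 4 1 \<in> perp (coord7 {0,2,6})" "axis 5 1 \<in> perp (coord7 {0,2,6})"
      unfolding perp_coord7 by (simp_all add: coord7_def forall_7 axis_v7)
    then have "d *v axis 4 1 \<in> perp (coord7 {0,2,6})" "d *v axis 5 1 \<in> perp (coord7 {0,2,6})" using d by (simp_all add: h4_def)
    ultimately have "p2 = 0 \<and> p3 = 0 \<and> q2 = 0 \<and> q3 = 0"
      unfolding perp_coord7 de M8_mult axis_v7 by (simp add: coord7_def forall_7)
    then show "d \<in> std_family4a" unfolding de std_family4a_def by blast
  qed
qed

lemma std_family4b_sub: "std_family4b \<subseteq> h4 (coord7 {1,2,4}) \<inter> m4 V0"
  unfolding std_family4b_def h4_def perp_coord7 by (auto simp: M8_in_m4 M8_in_g2 M8_mult coord7_def forall_7)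

lemma std_family4c_sub: "std_family4c \<subseteq> h4 (coord7 {2,3,5}) \<inter> m4 V0"
  unfolding std_family4c_def h4_def perp_coord7 by (auto simp: M8_in_m4 M8_in_g2 M8_mult coord7_def forall_7)

lemma std_family3_not_sub_h2:
  assumes "l \<in> perp V0" "std_family3 \<subseteq> h2 l"
  shows "l = 0"
proof -
  have "M8 0 1 0 0 0 0 0 0 \<in> std_family3" "M8 0 0 0 0 1 (-1) 0 0 \<in> std_family3"
    unfolding std_family3_def mem_Collect_eq
    by (rule exI[of _ 1], rule exI[of _ 0], rule exI[of _ 0], rule exI[of _ 0], simp,
        rule exI[of _ 0], rule exI[of _ 0], rule exI[of _ 1], rule exI[of _ 0], simp)
  then have "M8 0 1 0 0 0 0 0 0 *v l = 0" "M8 0 0 0 0 1 (-1) 0 0 *v l = 0" using assms(2) by (auto simp: h2_def)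
  then show ?thesis using assms(1) unfolding perp_V0 M8_mult vec_eq_7[of l] by simp
qed

lemma std_family4a_not_sub_h2:
  assumes "l \<in> perp V0" "std_family4a \<subseteq> h2 l"
  shows "l = 0"
proof -
  have "M8 1 1 0 0 0 0 0 0 \<in> std_family4a" "M8 0 0 1 0 0 0 0 0 \<in> std_family4a"
    unfolding std_family4a_def by blast+
  then have "M8 1 1 0 0 0 0 0 0 *v l = 0" "M8 0 0 1 0 0 0 0 0 *v l = 0" using assms(2) by (auto simp: h2_def)
  then show ?thesis using assms(1) unfolding perp_V0 M8_mult vec_eq_7[of l] by simp
qed

section \<open>Members of families 2, 3 and 4 in an adapted frame\<close>

lemma h2_scale: "r \<noteq> 0 \<Longrightarrow> h2 (r *s u) = h2 u"
  by (auto simp: h2_def vector_scalar_commute)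

lemma framed_perp:
  assumes "framed V g"
  shows "g *v axis 2 1 \<in> perp V" "g *v axis 0 1 \<in> V" "g *v axis 1 1 \<in> V" "g *v axis 3 1 \<in> V" 
    "x \<in> perp V0 \<Longrightarrow> g *v x \<in> perp V" "x \<in> perp V \<Longrightarrow> transpose g *v x \<in> perp V0"
proof -
  have ag: "aut7 g" and V: "V = img g V0" using assms by (auto simp: framed_def)
  have p: "perp V = img g (perp V0)" unfolding V by (rule perp_img[OF ag])
  show "x \<in> perp V0 \<Longrightarrow> g *v x \<in> perp V" unfolding p by blast
  show "x \<in> perp V \<Longrightarrow> transpose g *v x \<in> perp V0" unfolding p by (auto simp: aut7_inverse_vec[OF ag])
  show "g *v axis 2 1 \<in> perp V" unfolding p perp_V0 by (auto simp: axis_v7)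
  show "g *v axis 0 1 \<in> V" "g *v axis 1 1 \<in> V" "g *v axis 3 1 \<in> V" unfolding V V0_def by (auto simp: axis_v7)
qed

lemma normalized:
  assumes "(x::real^7) \<noteq> 0"
  obtains r where "r \<noteq> 0" "dot7 (r *s x) (r *s x) = 1"
proof (rule that[of "1 / norm x"])
  show "dot7 ((1 / norm x) *s x) ((1 / norm x) *s x) = 1"
  proof -
    have "dot7 x x = norm x * norm x" by (simp add: inner_eq_dot7[symmetric] power2_norm_eq_inner[symmetric] flip: power2_eq_square)
    then show ?thesis using assms by (simp add: dot7_smult_left dot7_smult_right)
  qed
qed (use assms in simp)

lemma MS_unit_exists:
  assumes "V \<in> MS"
  obtains u where "u \<in> V" "dot7 u u = 1"
proof -
  have "subspace V" "V \<noteq> {0}" using assms by (auto simp: MS_def)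
  from exists_maximizer[OF this] show ?thesis using that by blast
qed

lemma perp_subspace: "subspace (perp V)"
  unfolding perp_def by (simp add: subspace_def inner_right_distrib)

lemma type2_framed:
  assumes V: "V \<in> MS" and l: "l \<noteq> 0" "l \<in> perp V"
  obtains g where "framed V g" "h2 l \<inter> m4 V = conj7 g ` std_family2"
proof -
  obtain r where r: "r \<noteq> 0" "dot7 (r *s l) (r *s l) = 1" using normalized[OF l(1)] by blast
  have rl: "r *s l \<in> perp V" using l perp_subspace by (simp add: subspace_scale scalar_mult_eq_scaleR)
  obtain u1 where u1: "u1 \<in> V" "dot7 u1 u1 = 1" using MS_unit_exists[OF V] by blast
  obtain u2 where u2: "u2 \<in> V" "dot7 u2 u2 = 1" "dot7 u1 u2 = 0" using MS_frame_exists[OF V u1] by blast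
  have f: "framed V (frame7 u1 u2 (r *s l))" unfolding framed_def using frame_V0[OF V u1(1) u2(1) u1(2) u2(2,3) rl r(2)] by blast
  then have ag: "aut7 (frame7 u1 u2 (r *s l))" by (simp add: framed_def)
  have "conj7 (frame7 u1 u2 (r *s l)) ` std_family2 = h2 l \<inter> m4 V"
  proof (rule conj7_image_eq[OF ag])
    fix d show "conj7 (frame7 u1 u2 (r *s l)) d \<in> h2 l \<inter> m4 V \<longleftrightarrow> d \<in> std_family2"
      using conj7_h2[OF ag, of d "axis 2 1", unfolded frame7_axis h2_scale[OF r(1)]] conj7_m4[OF ag, of d V0, unfolded f[unfolded framed_def, THEN conjunct2]]
      unfolding std_family2_eq by blast
  qed
  then show ?thesis using that f by metis
qed

lemma type3_framed:
  assumes V: "V \<in> MS" and l: "l \<noteq> 0" "l \<in> V"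
  obtains g where "framed V g" "h2 l \<inter> m4 V = conj7 g ` std_family3"
proof -
  obtain r where r: "r \<noteq> 0" "dot7 (r *s l) (r *s l) = 1" using normalized[OF l(1)] by blast
  have rl: "r *s l \<in> V" using l V by (simp add: subspace_scale scalar_mult_eq_scaleR MS_def)
  obtain u2 k where u2: "u2 \<in> V" "dot7 u2 u2 = 1" "dot7 (r *s l) u2 = 0" and k: "k \<in> perp V" "dot7 k k = 1" using MS_frame_exists[OF V rl r(2)] by blast
  have f: "framed V (frame7 (r *s l) u2 k)" unfolding framed_def using frame_V0[OF V rl u2(1) r(2) u2(2,3) k] by blast
  then have ag: "aut7 (frame7 (r *s l) u2 k)" by (simp add: framed_def)
  have "conj7 (frame7 (r *s l) u2 k) ` std_family3 = h2 l \<inter> m4 V"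
  proof (rule conj7_image_eq[OF ag])
    fix d show "conj7 (frame7 (r *s l) u2 k) d \<in> h2 l \<inter> m4 V \<longleftrightarrow> d \<in> std_family3"
      using conj7_h2[OF ag, of d "axis 0 1", unfolded frame7_axis h2_scale[OF r(1)]] conj7_m4[OF ag, of d V0, unfolded f[unfolded framed_def, THEN conjunct2]]
      unfolding std_family3_eq by blast
  qed
  then show ?thesis using that f by metis
qed

text \<open>Unit vectors \<open>u\<close> in \<open>W\<close> and \<open>V\<close>, and
  \<open>l\<close> in \<open>W\<close> orthogonal to \<open>V\<close>, span \<open>W\<close>
  together with their product. A frame starting with \<open>u\<close> and ending with
  \<open>l\<close> therefore always gives the model \<open>std_family4a\<close>.\<close>

lemma type4_framed:
  assumes V: "V \<in> MS" and W: "W \<in> MS" "W \<inter> V \<noteq> {0}" "W \<inter> perp V \<noteq> {0}"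
  obtains g where "framed V g" "h4 W \<inter> m4 V = conj7 g ` std_family4a"
proof -
  have sW: "subspace W" and sV: "subspace V" and cW: "\<And>x y. x \<in> W \<Longrightarrow> y \<in> W \<Longrightarrow> cross7 x y \<in> W" and dW: "dim W = 3"
    using W V by (auto simp: MS_def)
  obtain u where u: "u \<in> W" "u \<in> V" "dot7 u u = 1"
    using exists_maximizer[OF subspace_inter[OF sW sV] W(2)] by blast
  obtain l where l: "l \<in> W" "l \<in> perp V" "dot7 l l = 1"
    using exists_maximizer[OF subspace_inter[OF sW perp_subspace] W(3)] by blast
  obtain u2 where u2: "u2 \<in> V" "dot7 u2 u2 = 1" "dot7 u u2 = 0" using MS_frame_exists[OF V u(2,3)] by blast
  define g where "g = frame7 u u2 l"
  have f: "framed V g" unfolding framed_def g_def using frame_V0[OF V u(2) u2(1) u(3) u2(2,3) l(2,3)] by blast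
  then have ag: "aut7 g" by (simp add: framed_def)
  have "g *v x \<in> W" if "x \<in> coord7 {0,2,6}" for x
  proof -
    have "g *v x = x$0 *\<^sub>R u + x$2 *\<^sub>R l + x$6 *\<^sub>R cross7 u l"
      using that unfolding g_def frame7_def transpose_v7_mult coord7_def by (simp add: forall_7 scalar_mult_eq_scaleR)
    then show ?thesis using u l cW sW by (simp add: subspace_add subspace_scale)
  qed
  then have sub: "img g (coord7 {0,2,6}) \<subseteq> W" by blast
  have Wg: "img g (coord7 {0,2,6}) = W"
    by (rule subspace_dim_equal[OF linear_subspace_image[OF linear_mult_vec subspace_coord7] sW sub])
      (simp add: dim_img[OF ag] dim_coord7 dW)
  have "conj7 g ` std_family4a = h4 W \<inter> m4 V"
  proof (rule conj7_image_eq[OF ag])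
    fix d show "conj7 g d \<in> h4 W \<inter> m4 V \<longleftrightarrow> d \<in> std_family4a"
      using conj7_h4[OF ag, of d "coord7 {0,2,6}", unfolded Wg] conj7_m4[OF ag, of d V0, unfolded f[unfolded framed_def, THEN conjunct2]]
      unfolding std_family4a_eq by blast
  qed
  then show ?thesis using that f by metis
qed

section \<open>Nilpotent complex derivations\<close>

definition cmat :: "real^7^7 \<Rightarrow> real^7^7 \<Rightarrow> complex^7^7" where
  "cmat A B = (\<chi> i j. Complex (A$i$j) (B$i$j))"

definition cvec :: "real^7 \<Rightarrow> real^7 \<Rightarrow> complex^7" where
  "cvec x y = (\<chi> i. Complex (x$i) (y$i))"

lemma complexify_cmat: "complexify S = {cmat A B | A B. A \<in> S \<and> B \<in> S}"
  by (simp add: complexify_def cmat_def)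

lemma cmat_mult_cvec: "cmat A B *v cvec x y = cvec (A *v x - B *v y) (A *v y + B *v x)"
  by (simp add: vec_eq_iff cmat_def cvec_def matrix_vector_mult_def complex_eq_iff sum_subtractf sum.distrib
      Re_sum Im_sum)

lemma cvec_exists: obtains x y where "z = cvec x y"
  by (rule that[of "\<chi> i. Re (z$i)" "\<chi> i. Im (z$i)"]) (simp add: cvec_def vec_eq_iff)

lemma cvec_eq_iff: "cvec x y = cvec x' y' \<longleftrightarrow> x = x' \<and> y = y'"
  by (auto simp: cvec_def vec_eq_iff)

lemma cvec_0: "cvec 0 0 = 0"
  by (simp add: cvec_def vec_eq_iff complex_eq_iff)

lemma cvec_eq_0_iff: "cvec x y = 0 \<longleftrightarrow> x = 0 \<and> y = 0"
  unfolding cvec_0[symmetric] cvec_eq_iff ..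

lemma cross7_cvec: "cross7 (cvec x y) (cvec x' y') = cvec (cross7 x x' - cross7 y y') (cross7 x y' + cross7 y x')"
  unfolding cross7_v7 vec_eq_7 by (simp add: cvec_def complex_eq_iff)

lemma dot7_cvec: "dot7 (cvec x y) (cvec x' y') = Complex (dot7 x x' - dot7 y y') (dot7 x y' + dot7 y x')"
  unfolding dot7_def by (simp add: cvec_def complex_eq_iff)

lemma g2C_iff: "X \<in> g2C \<longleftrightarrow> (\<exists>d40 d42 d43 d50 d51 d52 d53 d54 d60 d61 d62 d63 d64 d65. X = G14 d40 d42 d43 d50 d51 d52 d53 d54 d60 d61 d62 d63 d64 d65)"
proof
  assume "X \<in> g2C"
  then obtain A B where AB: "X = cmat A B" "A \<in> g2" "B \<in> g2" unfolding complexify_cmat by blast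
  have "X = G14 (Complex (A$4$0) (B$4$0)) (Complex (A$4$2) (B$4$2)) (Complex (A$4$3) (B$4$3)) (Complex (A$5$0) (B$5$0)) (Complex (A$5$1) (B$5$1))
     (Complex (A$5$2) (B$5$2)) (Complex (A$5$3) (B$5$3)) (Complex (A$5$4) (B$5$4)) (Complex (A$6$0) (B$6$0)) (Complex (A$6$1) (B$6$1)) (Complex (A$6$2) (B$6$2))
     (Complex (A$6$3) (B$6$3)) (Complex (A$6$4) (B$6$4)) (Complex (A$6$5) (B$6$5))"
    unfolding AB(1) cmat_def
    by (subst der7_imp_G14[OF AB(2)[unfolded g2_iff_der7]], subst der7_imp_G14[OF AB(3)[unfolded g2_iff_der7]])
      (simp add: vec_eq_7 G14_def complex_eq_iff)
  then show "\<exists>d40 d42 d43 d50 d51 d52 d53 d54 d60 d61 d62 d63 d64 d65. X = G14 d40 d42 d43 d50 d51 d52 d53 d54 d60 d61 d62 d63 d64 d65" by blast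
next
  assume "\<exists>d40 d42 d43 d50 d51 d52 d53 d54 d60 d61 d62 d63 d64 d65. X = G14 d40 d42 d43 d50 d51 d52 d53 d54 d60 d61 d62 d63 d64 d65"
  then obtain d40 d42 d43 d50 d51 d52 d53 d54 d60 d61 d62 d63 d64 d65 where X: "X = G14 d40 d42 d43 d50 d51 d52 d53 d54 d60 d61 d62 d63 d64 d65" by blast
  have "X = cmat (G14 (Re d40) (Re d42) (Re d43) (Re d50) (Re d51) (Re d52) (Re d53) (Re d54) (Re d60) (Re d61) (Re d62) (Re d63) (Re d64) (Re d65))
     (G14 (Im d40) (Im d42) (Im d43) (Im d50) (Im d51) (Im d52) (Im d53) (Im d54) (Im d60) (Im d61) (Im d62) (Im d63) (Im d64) (Im d65))"
    unfolding X cmat_def by (simp add: vec_eq_7 G14_def complex_eq_iff)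
  then show "X \<in> g2C" unfolding complexify_cmat using der7_G14 g2_iff_der7 by blast
qed

section \<open>From ad-nilpotent to nilpotent on C^7\<close>

lemma g2C_der7: "X \<in> g2C \<Longrightarrow> der7 X"
  using g2C_iff der7_G14 by metis

lemma g2C_skew: assumes "X \<in> g2C" shows "transpose X = - X" "dot7 (X *v x) y = - dot7 x (X *v y)"
proof -
  obtain d40 d42 d43 d50 d51 d52 d53 d54 d60 d61 d62 d63 d64 d65 where X: "X = G14 d40 d42 d43 d50 d51 d52 d53 d54 d60 d61 d62 d63 d64 d65" 
    using assms unfolding g2C_iff by blast
  show "transpose X = - X" unfolding X G14_def transpose_v7 by simp
  show "dot7 (X *v x) y = - dot7 x (X *v y)"
    unfolding X G14_def matrix_vector_mult_v7 sum_7 dot7_def by (simp add: algebra_simps)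
qed

text \<open>A skew matrix of odd size has determinant zero.\<close>

lemma g2C_kernel:
  assumes "X \<in> g2C"
  obtains w where "w \<noteq> 0" "X *v w = 0"
proof -
  have m: "- X = mat (- 1) ** X" by (simp add: vec_eq_iff matrix_matrix_mult_def mat_def if_distrib[of "\<lambda>x. x * _"] cong: if_cong)
  have d: "det (mat (- 1) :: complex^7^7) = - 1"
    by (subst det_diagonal) (simp_all add: mat_def)
  have "det X = det (transpose X)" by simp
  also have "\<dots> = - det X" unfolding g2C_skew(1)[OF assms] m det_mul d by simp
  finally have "det X = 0" by simp
  then have "\<not> invertible X" by (simp add: invertible_det_nz)
  then have "\<not> (\<exists>B. B ** X = mat 1)" using invertible_left_inverse by blast
  then show ?thesis using that matrix_left_invertible_ker[of X] by blast
qed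

text \<open>The projection of the elementary skew matrix of \<open>x\<close> and \<open>w\<close> to the derivation algebra.\<close>
definition wedge_der :: "complex^7 \<Rightarrow> complex^7 \<Rightarrow> complex^7^7" where
  "wedge_der x w = (let c = (1/3) *s cross7 x w; m = (\<lambda>i j. x$i * w$j - w$i * x$j) in
     G14 (m 4 0 + c$5) (m 4 2 + c$1) (m 4 3 + c$6) (m 5 0 - c$4) (m 5 1 + c$6) (m 5 2 - c$3) (m 5 3 + c$2) (m 5 4 + c$0)
       (m 6 0 - c$2) (m 6 1 - c$5) (m 6 2 + c$0) (m 6 3 - c$4) (m 6 4 + c$3) (m 6 5 + c$1))"

lemma wedge_der_g2C: "wedge_der x w \<in> g2C"
  unfolding wedge_der_def Let_def g2C_iff by blast

lemma wedge_der_mult: "wedge_der x w *v z = dot7 w z *s x - dot7 x z *s w + (1/3) *s cross7 (cross7 x w) z"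
  unfolding wedge_der_def Let_def G14_def matrix_vector_mult_v7 sum_7 dot7_def cross7_v7
  by (simp add: vec_eq_7) (simp add: field_simps)

lemma matrix_eqI_vec: "(\<And>z. A *v z = B *v z) \<Longrightarrow> A = (B::'a::comm_ring_1^7^7)"
  using matrix_eq[of A B] by blast

lemma lie_mult_vec: "lie X Y *v z = X *v (Y *v z) - Y *v (X *v (z::'a::comm_ring_1^7))"
  by (simp add: lie_def matrix_vector_mult_diff_rdistrib matrix_vector_mul_assoc)

text \<open>The projection from skew matrices is equivariant. If \<open>X *v w = 0\<close>, iterated
  brackets with \<open>X\<close> therefore only move \<open>x\<close>.\<close>

lemma lie_wedge_der:
  assumes X: "X \<in> g2C"
  shows "lie X (wedge_der x w) = wedge_der (X *v x) w + wedge_der x (X *v w)"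
proof (rule matrix_eqI_vec)
  fix z
  have D: "X *v cross7 u v = cross7 (X *v u) v + cross7 u (X *v v)" for u v
    using g2C_der7[OF X] by (simp add: der7_def)
  have s: "dot7 y (X *v z) = - dot7 (X *v y) z" for y using g2C_skew(2)[OF X, of y z] by simp
  show "lie X (wedge_der x w) *v z = (wedge_der (X *v x) w + wedge_der x (X *v w)) *v z"
    unfolding lie_mult_vec matrix_vector_mult_add_rdistrib wedge_der_mult
    by (simp add: matrix_vector_right_distrib matrix_vector_mult_diff_distrib vector_scalar_commute D s cross7_add_left
       vec_eq_iff algebra_simps)
qed

lemma wedge_der_0_right: "wedge_der x 0 = 0"
  by (rule matrix_eqI_vec) (simp add: wedge_der_mult dot7_0_left cross7_0_left cross7_0_right)

lemma lie_funpow_wedge_der: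
  assumes X: "X \<in> g2C" and w: "X *v w = 0"
  shows "((lie X) ^^ n) (wedge_der x w) = wedge_der (((*v) X ^^ n) x) w"
  by (induction n) (simp_all add: lie_wedge_der[OF X] w wedge_der_0_right)

text \<open>If the projection of \<open>x \<and> w\<close> vanishes, the minors of \<open>x, w\<close> on the three lines through a point agree,
  and the Pluecker relations make the sum of the squares of \<open>x \<times> w\<close> along every line vanish.\<close>
lemma wedge_der_eq_0_parallel:
  assumes D: "wedge_der x w = 0" and w: "w \<noteq> 0"
  obtains k where "x = k *s w"
proof -
  define c where "c = cross7 x w"
  have "w$j * x$i - x$j * w$i + (1/3) * cross7 c (axis j 1) $ i = 0" for i j
    using arg_cong[OF wedge_der_mult[of x w "axis j 1"], of "\<lambda>v. v$i"] D by (simp add: dot7_axis c_def)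
  then have m: "x$i * w$j - w$i * x$j = - (1/3) * cross7 c (axis j 1) $ i" for i j
    by (simp add: algebra_simps eq_neg_iff_add_eq_0)
  have plu: "(x$a * w$b - w$a * x$b) * (x$c * w$d - w$c * x$d) - (x$a * w$c - w$a * x$c) * (x$b * w$d - w$b * x$d)
     + (x$a * w$d - w$a * x$d) * (x$b * w$c - w$b * x$c) = 0" for a b c d
    by (simp add: algebra_simps)
  note plu = plu[unfolded m cross7_v7 axis_v7]
  have e: "c$0 * c$0 + c$4 * c$4 + c$5 * c$5 = 0" "c$1 * c$1 + c$5 * c$5 + c$6 * c$6 = 0"
     "c$2 * c$2 + c$6 * c$6 + c$0 * c$0 = 0" "c$3 * c$3 + c$0 * c$0 + c$1 * c$1 = 0"
     "c$4 * c$4 + c$1 * c$1 + c$2 * c$2 = 0" "c$5 * c$5 + c$2 * c$2 + c$3 * c$3 = 0" "c$6 * c$6 + c$3 * c$3 + c$4 * c$4 = 0"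
    using plu[of 1 3 2 6, unfolded axis_v7] plu[of 2 4 3 0, unfolded axis_v7] plu[of 3 5 4 1, unfolded axis_v7]
      plu[of 4 6 5 2, unfolded axis_v7] plu[of 5 0 6 3, unfolded axis_v7] plu[of 6 1 0 4, unfolded axis_v7] plu[of 0 2 1 5, unfolded axis_v7]
    by (simp_all add: add.assoc add_divide_distrib[symmetric])
  have T: "c$0 * c$0 + c$1 * c$1 + c$2 * c$2 + c$3 * c$3 + c$4 * c$4 + c$5 * c$5 + c$6 * c$6 = 0"
    using e by algebra
  have "c$0 = 0 \<and> c$1 = 0 \<and> c$2 = 0 \<and> c$3 = 0 \<and> c$4 = 0 \<and> c$5 = 0 \<and> c$6 = 0"
  proof -
    have "2 * (c$0 * c$0) = 0" "2 * (c$1 * c$1) = 0" "2 * (c$2 * c$2) = 0" "2 * (c$3 * c$3) = 0" "2 * (c$4 * c$4) = 0" "2 * (c$5 * c$5) = 0" "2 * (c$6 * c$6) = 0"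
      using T e by algebra+
    then show ?thesis by simp
  qed
  then have "c = 0" by (simp add: vec_eq_7)
  then have m0: "x$i * w$j = w$i * x$j" for i j using m[of i j] by (simp add: cross7_0_left)
  obtain j where j: "w$j \<noteq> 0" using w by (auto simp: vec_eq_iff)
  show ?thesis
    by (rule that[of "x$j / w$j"]) (use j m0 in \<open>simp add: vec_eq_iff field_simps\<close>)
qed

text \<open>With \<open>w\<close> in the kernel of \<open>X\<close>, vanishing of the iterated
  brackets on \<open>wedge_der z w\<close> makes the iterate of \<open>z\<close> parallel to
  \<open>w\<close>, so one more application of \<open>X\<close> gives zero.\<close>

lemma nilpotent_elt_vec:
  assumes "nilpotent_elt X"
  obtains n where "\<And>z. ((*v) X ^^ n) z = 0"
proof -
  obtain k where X: "X \<in> g2C" and k: "\<And>Y. Y \<in> g2C \<Longrightarrow> ((lie X) ^^ k) Y = 0"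
    using assms by (auto simp: nilpotent_elt_def)
  obtain w where w: "w \<noteq> 0" "X *v w = 0" using g2C_kernel[OF X] by blast
  have "((*v) X ^^ Suc k) z = 0" for z
  proof -
    have "wedge_der (((*v) X ^^ k) z) w = 0" using k[OF wedge_der_g2C[of z w]] lie_funpow_wedge_der[OF X w(2)] by simp
    then obtain r where "((*v) X ^^ k) z = r *s w" using wedge_der_eq_0_parallel w(1) by blast
    then show ?thesis by (simp add: vector_scalar_commute w)
  qed
  then show ?thesis using that by blast
qed

text \<open>The image of an invariant \<open>U\<close> is strictly smaller unless \<open>U\<close>
  consists of arbitrarily deep images, that is, of zero; each application of \<open>N\<close> thus
  lowers the dimension bound by one.\<close>

lemma nilpotent_on_subspace:
  fixes N :: "complex^7^7"
  assumes nil: "\<And>z. ((*v) N ^^ n) z = 0"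
  shows "vec.subspace U \<Longrightarrow> (\<And>z. z \<in> U \<Longrightarrow> N *v z \<in> U) \<Longrightarrow> vec.dim U \<le> k \<Longrightarrow> z \<in> U \<Longrightarrow> ((*v) N ^^ k) z = 0"
proof (induction k arbitrary: U z)
  case 0
  then show ?case by (auto simp: vec.dim_eq_0)
next
  case (Suc k)
  define U' where "U' = (*v) N ` U"
  have sU': "vec.subspace U'" unfolding U'_def
    by (rule vec.subspace_image[OF Suc.prems(1)])
  have sub: "U' \<subseteq> U" using Suc.prems(2) by (auto simp: U'_def)
  show ?case
  proof (cases "U' = U")
    case True
    have "\<exists>y\<in>U. z = ((*v) N ^^ m) y" if "z \<in> U" for m z
      using that
    proof (induction m arbitrary: z)
      case (Suc m)
      obtain y where y: "y \<in> U" "z = ((*v) N ^^ m) y" using Suc by blast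
      obtain x where "x \<in> U" "y = N *v x" using y(1) True U'_def by blast
      then show ?case using y by (intro bexI[of _ x]) (simp_all add: funpow_swap1)
    qed simp
    then have "z = 0" using nil Suc.prems(4) by metis
    moreover have "((*v) N ^^ m) 0 = 0" for m by (induction m) simp_all
    ultimately show ?thesis by blast
  next
    case False
    then have "vec.dim U' < vec.dim U"
      using vec.subspace_dim_equal[OF sU' Suc.prems(1) sub] vec.dim_subset[OF sub] by linarith
    then have "vec.dim U' \<le> k" using Suc.prems(3) by simp
    moreover have "N *v z \<in> U'" using Suc.prems(4) by (simp add: U'_def)
    ultimately have "((*v) N ^^ k) (N *v z) = 0"
      by (intro Suc.IH[OF sU']) (use sub in \<open>auto simp: U'_def\<close>)
    then show ?thesis by (simp add: funpow_swap1)
  qed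
qed

text \<open>Each proper invariant subspace has dimension at most 6, so \<open>N^6\<close> vanishes
  on both summands.\<close>

lemma nilpotent_reducible_pow6:
  fixes N :: "complex^7^7"
  assumes nil: "\<And>z. ((*v) N ^^ n) z = 0"
    and U: "vec.subspace U" "\<And>z. z \<in> U \<Longrightarrow> N *v z \<in> U" "U \<noteq> UNIV"
    and W: "vec.subspace W" "\<And>z. z \<in> W \<Longrightarrow> N *v z \<in> W" "W \<noteq> UNIV"
    and sum: "\<And>z. \<exists>a\<in>U. \<exists>b\<in>W. z = a + b"
  shows "((*v) N ^^ 6) z = 0"
proof -
  have d: "vec.dim A \<le> 6" if "vec.subspace A" "A \<noteq> UNIV" for A :: "(complex^7) set"
  proof (rule ccontr)
    assume "\<not> vec.dim A \<le> 6"
    moreover have "vec.dim (UNIV :: (complex^7) set) = 7" by (subst vec_dim_card) simp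
    ultimately have "vec.dim (UNIV :: (complex^7) set) \<le> vec.dim A" by linarith
    then show False using vec.subspace_dim_equal[OF that(1) vec.subspace_UNIV subset_UNIV] that(2) by blast
  qed
  obtain a b where ab: "a \<in> U" "b \<in> W" "z = a + b" using sum by blast
  have add: "((*v) N ^^ m) (x + y) = ((*v) N ^^ m) x + ((*v) N ^^ m) y" for m x y
    by (induction m) (simp_all add: matrix_vector_right_distrib)
  show ?thesis unfolding ab(3) add
    using nilpotent_on_subspace[OF nil U(1,2) d[OF U(1,3)] ab(1)] nilpotent_on_subspace[OF nil W(1,2) d[OF W(1,3)] ab(2)] by simp
qed

text \<open>A maximal nilpotent subalgebra: the coordinates belong to the positive roots, of heights 1, 1, 2, 3, 4, 5.\<close>
definition XX :: "complex \<Rightarrow> complex \<Rightarrow> complex \<Rightarrow> complex \<Rightarrow> complex \<Rightarrow> complex \<Rightarrow> complex^7^7" where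
  "XX c1 c2 c3 c4 c5 c6 = G14 (c2 + c4) (- 2 * \<i> * c3) (c1 - c6) (c3 + c5) (c1 + c6) (- 2 * \<i> * c4) 0 (\<i> * (c6 - c1))
     0 (c2 - c4) (2 * \<i> * c1) (c3 - c5) (\<i> * (c2 - c4)) (\<i> * (c3 - c5))"

lemma ii_mult: "\<i> * (\<i> * x) = - x"
  by (simp add: mult.assoc[symmetric])

lemma lie_XX: "lie (XX d1 d2 d3 d4 d5 d6) (XX c1 c2 c3 c4 c5 c6) =
  XX 0 0 (- 2 * \<i> * (d1 * c2 - d2 * c1)) (- 4 * \<i> * (d1 * c3 - d3 * c1)) (- 6 * \<i> * (d1 * c4 - d4 * c1))
    (- 2 * \<i> * (d2 * c5 - d5 * c2) + 6 * \<i> * (d3 * c4 - d4 * c3))"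
  unfolding lie_def XX_def G14_def matrix_mult_v7 vector_matrix_mult_v7
  by (simp add: algebra_simps ii_mult)

lemma XX_g2C: "XX c1 c2 c3 c4 c5 c6 \<in> g2C"
  unfolding XX_def g2C_iff by blast

lemma XX_add: "XX c1 c2 c3 c4 c5 c6 + XX d1 d2 d3 d4 d5 d6 = XX (c1 + d1) (c2 + d2) (c3 + d3) (c4 + d4) (c5 + d5) (c6 + d6)"
  and XX_0: "XX 0 0 0 0 0 0 = 0"
  unfolding XX_def G14_def by (simp_all add: algebra_simps zero_v7)

lemma XX_mult: "XX c1 c2 c3 c4 c5 c6 *v z = v7
  (\<i> * (c2 + c4) * z$1 + 2 * c1 * z$2 + \<i> * (c3 + c5) * z$3 - (c2 + c4) * z$4 - (c3 + c5) * z$5)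
  (- \<i> * (c2 + c4) * z$0 - 2 * c3 * z$2 + \<i> * (c1 + c6) * z$3 - (c1 + c6) * z$5 - (c2 - c4) * z$6)
  (- 2 * c1 * z$0 + 2 * c3 * z$1 + 2 * c4 * z$3 + 2 * \<i> * c3 * z$4 + 2 * \<i> * c4 * z$5 - 2 * \<i> * c1 * z$6)
  (- \<i> * (c3 + c5) * z$0 - \<i> * (c1 + c6) * z$1 - 2 * c4 * z$2 - (c1 - c6) * z$4 - (c3 - c5) * z$6)
  ((c2 + c4) * z$0 - 2 * \<i> * c3 * z$2 + (c1 - c6) * z$3 + \<i> * (c1 - c6) * z$5 - \<i> * (c2 - c4) * z$6)
  ((c3 + c5) * z$0 + (c1 + c6) * z$1 - 2 * \<i> * c4 * z$2 - \<i> * (c1 - c6) * z$4 - \<i> * (c3 - c5) * z$6)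
  ((c2 - c4) * z$1 + 2 * \<i> * c1 * z$2 + (c3 - c5) * z$3 + \<i> * (c2 - c4) * z$4 + \<i> * (c3 - c5) * z$5)"
  unfolding XX_def G14_def matrix_vector_mult_v7 sum_7 by (simp add: algebra_simps)

lemma XX_smult: "XX (r * c1) (r * c2) (r * c3) (r * c4) (r * c5) (r * c6) *v z = r *s (XX c1 c2 c3 c4 c5 c6 *v z)"
  unfolding XX_mult by (simp add: algebra_simps)

lemma lie_0_right: "lie x 0 = 0"
  by (simp add: lie_def)

text \<open>The two vectors are e3 + i e5 and e1 + i e4, null and with product zero. Requiring
  \<open>X\<close> to kill the first and to send the second into its line leaves six
  parameters.\<close>

lemma XX_of_flag:
  assumes X: "X \<in> g2C" and v: "X *v v7 0 0 0 1 0 \<i> 0 = 0" and w: "X *v v7 0 1 0 0 \<i> 0 0 = k *s v7 0 0 0 1 0 \<i> 0"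
  obtains c1 c2 c3 c4 c5 c6 where "X = XX c1 c2 c3 c4 c5 c6"
proof -
  obtain d40 d42 d43 d50 d51 d52 d53 d54 d60 d61 d62 d63 d64 d65 where XG: "X = G14 d40 d42 d43 d50 d51 d52 d53 d54 d60 d61 d62 d63 d64 d65" 
    using X unfolding g2C_iff by blast
  have e: "- d42 = d65 + \<i> * d50" "d54 + d62 = \<i> * d51" "d40 = d61 + \<i> * d52" "d53 = 0" "d43 = \<i> * d54" "d63 + \<i> * d65 = 0"
    using v unfolding XG G14_def matrix_vector_mult_v7 sum_7 by (simp_all add: algebra_simps)
  have f: "d53 = d60" "d61 + \<i> * d64 = 0"
    using arg_cong[OF w, of "\<lambda>z. z $ 4"] arg_cong[OF w, of "\<lambda>z. z $ 6"]
    unfolding XG G14_def matrix_vector_mult_v7 sum_7 by (simp_all add: algebra_simps)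
  have s: "d43 = \<i> * d54" "d63 = - (\<i> * d65)" "d61 = - (\<i> * d64)" "d60 = 0"
    using e f by (simp_all add: eq_neg_iff_add_eq_0)
  have d42: "d42 = - (d65 + \<i> * d50)" using e(1) by (metis minus_minus)
  have s': "d50 = \<i> * (d42 + d65)" unfolding d42 by (simp add: ii_mult)
  have "d51 = - \<i> * (d54 + d62)" unfolding e(2) by (simp add: ii_mult)
  also have "\<dots> = - (\<i> * d62) - \<i> * d54" by (simp add: algebra_simps)
  finally have s'': "d51 = - (\<i> * d62) - \<i> * d54" .
  show ?thesis
    by (rule that[of "- \<i> * d62 / 2" "\<i> * d52 / 2 - \<i> * d64" "\<i> * d42 / 2" "\<i> * d52 / 2" "\<i> * d42 / 2 + \<i> * d65" "- \<i> * d62 / 2 - \<i> * d54"])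
      (simp add: XG XX_def s s' s'' e(3,4) algebra_simps ii_mult)
qed

section \<open>Conjugacy under the complex automorphism group\<close>

lemma aut7_G2C: "aut7 g \<Longrightarrow> g \<in> G2C"
  unfolding G2C_def aut7_def using invertible_left_inverse by blast

lemma G2C_mult: "g \<in> G2C \<Longrightarrow> h \<in> G2C \<Longrightarrow> g ** h \<in> G2C"
  unfolding G2C_def by (simp add: invertible_mult matrix_vector_mul_assoc[symmetric])

lemma G2C_inverse:
  assumes "g \<in> G2C"
  shows "matrix_inv g \<in> G2C" "matrix_inv g ** g = mat 1" "g ** matrix_inv g = mat 1"
proof -
  have inv: "invertible g" using assms by (simp add: G2C_def)
  show l: "matrix_inv g ** g = mat 1" and r: "g ** matrix_inv g = mat 1"
    using someI_ex[OF inv[unfolded invertible_def]] unfolding matrix_inv_def by blast+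
  have c: "matrix_inv g *v (g *v x) = x" "g *v (matrix_inv g *v x) = x" for x by (simp_all add: matrix_vector_mul_assoc l r)
  have "matrix_inv g *v cross7 x y = cross7 (matrix_inv g *v x) (matrix_inv g *v y)" for x y
  proof -
    have "g *v cross7 (matrix_inv g *v x) (matrix_inv g *v y) = cross7 x y" using assms by (simp add: G2C_def c)
    then show ?thesis using c(1) by metis
  qed
  moreover have "invertible (matrix_inv g)" using l r unfolding invertible_def by blast
  ultimately show "matrix_inv g \<in> G2C" by (simp add: G2C_def)
qed

text \<open>An intertwining relation, so that no inverse has to be handled.\<close>

definition sim7 :: "complex^7^7 \<Rightarrow> complex^7^7 \<Rightarrow> bool" where
  "sim7 X Y \<longleftrightarrow> (\<exists>g\<in>G2C. g ** X = Y ** g)"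

lemma adj_orbit_iff: "Y \<in> adj_orbit X \<longleftrightarrow> sim7 X Y"
proof
  assume "Y \<in> adj_orbit X"
  then obtain g where g: "g \<in> G2C" "Y = g ** X ** matrix_inv g" by (auto simp: adj_orbit_def)
  have "Y ** g = g ** X ** (matrix_inv g ** g)" by (simp add: g(2) matrix_mul_assoc)
  then have "g ** X = Y ** g" using G2C_inverse(2)[OF g(1)] by simp
  then show "sim7 X Y" using g(1) unfolding sim7_def by blast
next
  assume "sim7 X Y"
  then obtain g where g: "g \<in> G2C" "g ** X = Y ** g" by (auto simp: sim7_def)
  have "g ** X ** matrix_inv g = Y ** (g ** matrix_inv g)" by (simp add: g(2) matrix_mul_assoc)
  then have "Y = g ** X ** matrix_inv g" using G2C_inverse(3)[OF g(1)] by simp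
  then show "Y \<in> adj_orbit X" using g(1) unfolding adj_orbit_def by blast
qed

lemma sim7_trans: "sim7 X Y \<Longrightarrow> sim7 Y Z \<Longrightarrow> sim7 X Z"
  unfolding sim7_def by (metis G2C_mult matrix_mul_assoc)

lemma sim7_sym:
  assumes "sim7 X Y" shows "sim7 Y X"
proof -
  obtain g where g: "g \<in> G2C" "g ** X = Y ** g" using assms by (auto simp: sim7_def)
  note i = G2C_inverse[OF g(1)]
  have "matrix_inv g ** Y = matrix_inv g ** (Y ** g) ** matrix_inv g"
    by (simp add: i(3) flip: matrix_mul_assoc)
  also have "\<dots> = (matrix_inv g ** g) ** X ** matrix_inv g" unfolding g(2)[symmetric] by (simp add: matrix_mul_assoc)
  finally have "matrix_inv g ** Y = X ** matrix_inv g" using i(2) by simp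
  then show ?thesis using i(1) by (auto simp: sim7_def)
qed

text \<open>Conjugation by \<open>exp D = 1 + D + D\<^sup>2/2\<close>.\<close>
lemma sim7_exp:
  fixes D X X1 X2 X3 X' :: "complex^7^7"
  assumes D: "der7 D" and D3: "\<And>z. D *v (D *v (D *v z)) = 0"
    and b: "lie D X = X1" "lie D X1 = X2" "lie D X2 = X3" "lie D X3 = 0"
    and X': "\<And>z. X' *v z = X *v z + X1 *v z + (1/2) *s (X2 *v z) + (1/6) *s (X3 *v z)"
  shows "sim7 X X'"
proof -
  define H where "H = (\<chi> i j. (1/2) * (D ** D)$i$j)"
  define g where "g = mat 1 + D + H"
  have g: "g *v z = z + D *v z + (1/2) *s (D *v (D *v z))" for z
  proof -
    have "H *v z = (1/2) *s ((D ** D) *v z)"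
      by (simp add: H_def vec_eq_iff matrix_vector_mult_def sum_distrib_left mult.assoc)
    then show ?thesis by (simp add: g_def matrix_vector_mult_add_rdistrib matrix_vector_mul_assoc)
  qed
  have lin: "D *v (x + y) = D *v x + D *v y" "D *v (x - y) = D *v x - D *v y" "D *v (c *s x) = c *s (D *v x)" for x y c
    by (simp_all add: matrix_vector_right_distrib matrix_vector_mult_diff_distrib vector_scalar_commute)
  define h where "h = mat 1 - D + H"
  have h: "h *v z = z - D *v z + (1/2) *s (D *v (D *v z))" for z
  proof -
    have "H *v z = (1/2) *s ((D ** D) *v z)"
      by (simp add: H_def vec_eq_iff matrix_vector_mult_def sum_distrib_left mult.assoc)
    then show ?thesis by (simp add: h_def matrix_vector_mult_add_rdistrib matrix_vector_mult_diff_rdistrib matrix_vector_mul_assoc)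
  qed
  have "h ** g = mat 1"
  proof (rule matrix_eqI_vec)
    fix z show "(h ** g) *v z = mat 1 *v z"
      unfolding matrix_vector_mul_assoc[symmetric] h g lin D3 by (simp add: vec_eq_iff field_simps D3)
  qed
  then have inv: "invertible g" using invertible_left_inverse by blast
  have Dc: "D *v cross7 x y = cross7 (D *v x) y + cross7 x (D *v y)" for x y using D by (simp add: der7_def)
  \<comment> \<open>\<open>D\<close> cubed annihilates every product, and by Leibniz only the mixed
    terms remain; one more \<open>D\<close> gives \<open>c4\<close>. These two facts make the
    truncated exponential multiplicative.\<close>
  have c3: "cross7 (D *v (D *v x)) (D *v y) + cross7 (D *v x) (D *v (D *v y)) = 0" for x y
  proof -
    have "D *v (D *v (D *v cross7 x y)) = 3 *s (cross7 (D *v (D *v x)) (D *v y) + cross7 (D *v x) (D *v (D *v y)))"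
      by (simp only: Dc lin D3 cross7_0_left cross7_0_right) (simp add: vec_eq_iff)
    then have "3 *s (cross7 (D *v (D *v x)) (D *v y) + cross7 (D *v x) (D *v (D *v y))) = 0" unfolding D3 by (rule sym)
    then show ?thesis by (simp only: vector_mul_eq_0) simp
  qed
  have aut: "g *v cross7 x y = cross7 (g *v x) (g *v y)" for x y
  proof -
    have "D *v (cross7 (D *v (D *v x)) (D *v y) + cross7 (D *v x) (D *v (D *v y))) = 2 *s cross7 (D *v (D *v x)) (D *v (D *v y))"
      by (simp only: Dc lin D3 cross7_0_left cross7_0_right) (simp add: vec_eq_iff)
    then have c4: "cross7 (D *v (D *v x)) (D *v (D *v y)) = 0" unfolding c3 by simp
    show ?thesis
      unfolding g Dc lin cross7_add_left cross7_add_right cross7_smult_left cross7_smult_right c4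
      using c3[of x y] by (simp add: vec_eq_iff field_simps)
  qed
  have gG: "g \<in> G2C" using inv aut by (simp add: G2C_def)
  have DX: "D *v (X *v z) = X *v (D *v z) + X1 *v z" "D *v (X1 *v z) = X1 *v (D *v z) + X2 *v z"
    "D *v (X2 *v z) = X2 *v (D *v z) + X3 *v z" "D *v (X3 *v z) = X3 *v (D *v z)" for z
    using arg_cong[OF b(1), of "\<lambda>A. A *v z"] arg_cong[OF b(2), of "\<lambda>A. A *v z"] arg_cong[OF b(3), of "\<lambda>A. A *v z"] arg_cong[OF b(4), of "\<lambda>A. A *v z"]
    by (simp_all add: lie_mult_vec algebra_simps)
  \<comment> \<open>\<open>D\<close> cubed also annihilates \<open>X *v z\<close>, and Leibniz ties
    \<open>X3\<close> to \<open>X1\<close> and \<open>X2\<close>. With \<open>E2\<close> to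
    \<open>E4\<close> this disposes of the terms beyond the truncation.\<close>
  have E1: "X3 *v z = - (3 *s (X1 *v (D *v (D *v z))) + 3 *s (X2 *v (D *v z)))" for z
  proof -
    have "D *v (D *v (D *v (X *v z))) = 3 *s (X1 *v (D *v (D *v z))) + 3 *s (X2 *v (D *v z)) + X3 *v z"
      by (simp only: DX lin D3 matrix_vector_mult_0_right) (simp add: vec_eq_iff)
    then show ?thesis unfolding D3 eq_neg_iff_add_eq_0 by (simp only: add_ac)
  qed
  have E2: "X3 *v (D *v z) = - (3 *s (X2 *v (D *v (D *v z))))" for z
    using E1[of "D *v z"] by (simp add: D3)
  have E3: "X2 *v (D *v (D *v z)) = 0" for z
  proof -
    have "D *v (D *v (D *v (X1 *v z))) = 3 *s (X2 *v (D *v (D *v z))) + 3 *s (X3 *v (D *v z))"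
      by (simp only: DX lin D3 matrix_vector_mult_0_right) (simp add: vec_eq_iff)
    then have "6 *s (X2 *v (D *v (D *v z))) = 0" unfolding D3 E2 by (simp add: vec_eq_iff)
    then show ?thesis by simp
  qed
  have E4: "X3 *v (D *v z) = 0" for z using E2 E3 by simp
  have "g ** X = X' ** g"
  proof (rule matrix_eqI_vec)
    fix z
    have E5: "X1 *v (D *v (D *v z)) = (- 1/3) *s (X3 *v z) - X2 *v (D *v z)"
      unfolding E1[of z] by (simp add: vec_eq_iff field_simps)
    have L: "(g ** X) *v z = X *v z + (X *v (D *v z) + X1 *v z) + (1/2) *s (X *v (D *v (D *v z)) + X1 *v (D *v z) + (X1 *v (D *v z) + X2 *v z))"
      by (simp only: matrix_vector_mul_assoc[symmetric] g DX lin)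
    have R: "(X' ** g) *v z = X *v z + X *v (D *v z) + (1/2) *s (X *v (D *v (D *v z)))
        + (X1 *v z + X1 *v (D *v z) + (1/2) *s (X1 *v (D *v (D *v z)))) + (1/2) *s (X2 *v z + X2 *v (D *v z)) + (1/6) *s (X3 *v z)"
      by (simp only: matrix_vector_mul_assoc[symmetric] g X' matrix_vector_right_distrib vector_scalar_commute E3 E4 vector_smult_rzero add_0_right)
         (simp add: vec_eq_iff algebra_simps)
    show "(g ** X) *v z = (X' ** g) *v z"
      unfolding L R E5 by (simp add: vec_eq_iff field_simps)
  qed
  then show ?thesis using gG by (auto simp: sim7_def)
qed

lemma XX_square:
  "XX t 0 0 0 0 0 *v (XX t 0 0 0 0 0 *v z) = v7 (- 4*t*t * (z$0 + \<i> * z$6)) 0 0 0 0 0 (- 4*t*t * \<i> * (z$0 + \<i> * z$6))"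
  "XX 0 0 t 0 0 0 *v (XX 0 0 t 0 0 0 *v z) = v7 0 (- 4*t*t * (z$1 + \<i> * z$4)) 0 0 (- 4*t*t * \<i> * (z$1 + \<i> * z$4)) 0 0"
  "XX 0 0 0 t 0 0 *v (XX 0 0 0 t 0 0 *v z) = v7 0 0 0 (- 4*t*t * (z$3 + \<i> * z$5)) 0 (- 4*t*t * \<i> * (z$3 + \<i> * z$5)) 0"
  "XX 0 0 0 0 t 0 *v (XX 0 0 0 0 t 0 *v z) = 0"
  unfolding XX_mult v7_nth by (simp_all add: algebra_simps ii_mult)

lemma XX_cube:
  "XX t 0 0 0 0 0 *v (XX t 0 0 0 0 0 *v (XX t 0 0 0 0 0 *v z)) = 0"
  "XX 0 0 t 0 0 0 *v (XX 0 0 t 0 0 0 *v (XX 0 0 t 0 0 0 *v z)) = 0"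
  "XX 0 0 0 t 0 0 *v (XX 0 0 0 t 0 0 *v (XX 0 0 0 t 0 0 *v z)) = 0"
  "XX 0 0 0 0 t 0 *v (XX 0 0 0 0 t 0 *v (XX 0 0 0 0 t 0 *v z)) = 0"
  unfolding XX_square[of t z] unfolding XX_mult v7_nth by (simp_all add: algebra_simps ii_mult)

lemma sim7_XX_exp:
  assumes D: "\<And>z. XX d1 d2 d3 d4 d5 d6 *v (XX d1 d2 d3 d4 d5 d6 *v (XX d1 d2 d3 d4 d5 d6 *v z)) = 0"
    and 1: "lie (XX d1 d2 d3 d4 d5 d6) (XX c1 c2 c3 c4 c5 c6) = XX 0 0 x3 x4 x5 x6"
    and 2: "lie (XX d1 d2 d3 d4 d5 d6) (XX 0 0 x3 x4 x5 x6) = XX 0 0 0 y4 y5 y6"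
    and 3: "lie (XX d1 d2 d3 d4 d5 d6) (XX 0 0 0 y4 y5 y6) = XX 0 0 0 0 z5 z6"
    and 4: "lie (XX d1 d2 d3 d4 d5 d6) (XX 0 0 0 0 z5 z6) = 0"
  shows "sim7 (XX c1 c2 c3 c4 c5 c6) (XX c1 c2 (c3 + x3) (c4 + x4 + y4/2) (c5 + x5 + y5/2 + z5/6) (c6 + x6 + y6/2 + z6/6))"
proof (rule sim7_exp[OF g2C_der7[OF XX_g2C] D 1 2 3 4])
  fix z
  show "XX c1 c2 (c3 + x3) (c4 + x4 + y4/2) (c5 + x5 + y5/2 + z5/6) (c6 + x6 + y6/2 + z6/6) *v z =
    XX c1 c2 c3 c4 c5 c6 *v z + XX 0 0 x3 x4 x5 x6 *v z + (1/2) *s (XX 0 0 0 y4 y5 y6 *v z) + (1/6) *s (XX 0 0 0 0 z5 z6 *v z)"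
    unfolding XX_smult[symmetric] matrix_vector_mult_add_rdistrib[symmetric] XX_add by simp
qed

text \<open>Heights are cleared in increasing order, each by the exponential of one root vector:
  roots 1, 3, 4, 5 remove the coordinates 3, 4, 5, 6 by acting on \<open>c2\<close>,
  \<open>c1\<close>, \<open>c1\<close>, \<open>c2\<close>. Only later coordinates change at each
  stage, and \<open>t\<close> solves the linear equation for the one to be removed.\<close>

lemma sim7_XX_reduce:
  assumes c: "c1 \<noteq> 0" "c2 \<noteq> 0"
  shows "sim7 (XX c1 c2 c3 c4 c5 c6) (XX c1 c2 0 0 0 0)"
proof -
  have 1: "\<exists>d4 d5 d6. sim7 (XX c1 c2 c3 c4 c5 c6) (XX c1 c2 0 d4 d5 d6)"
  proof -
    define t where "t = c3 / (2 * \<i> * c2)"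
    define x3 x4 x5 y4 y5 z5 where d: "x3 = - 2 * \<i> * (t * c2)" "x4 = - 4 * \<i> * (t * c3)" "x5 = - 6 * \<i> * (t * c4)"
      "y4 = - 4 * \<i> * (t * x3)" "y5 = - 6 * \<i> * (t * x4)" "z5 = - 6 * \<i> * (t * y4)"
    have z: "c3 + x3 = 0" using c by (simp add: t_def d)
    have "sim7 (XX c1 c2 c3 c4 c5 c6) (XX c1 c2 (c3 + x3) (c4 + x4 + y4/2) (c5 + x5 + y5/2 + z5/6) (c6 + 0 + 0/2 + 0/6))"
      by (rule sim7_XX_exp[OF XX_cube(1)[of t]]) (simp_all add: lie_XX XX_0 d lie_0_right)
    then show ?thesis unfolding z by blast
  qed
  have 2: "\<exists>d5 d6. sim7 (XX c1 c2 0 c4 c5 c6) (XX c1 c2 0 0 d5 d6)" for c4 c5 c6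
  proof -
    define t where "t = - c4 / (4 * \<i> * c1)"
    define x4 x6 y6 where d: "x4 = 4 * \<i> * (t * c1)" "x6 = 6 * \<i> * (t * c4)" "y6 = 6 * \<i> * (t * x4)"
    have z: "c4 + x4 = 0" using c by (simp add: t_def d)
    have "sim7 (XX c1 c2 0 c4 c5 c6) (XX c1 c2 (0 + 0) (c4 + x4 + 0/2) (c5 + 0 + 0/2 + 0/6) (c6 + x6 + y6/2 + 0/6))"
      by (rule sim7_XX_exp[OF XX_cube(2)[of t]]) (simp_all add: lie_XX XX_0 d lie_0_right)
    then have "sim7 (XX c1 c2 0 c4 c5 c6) (XX c1 c2 0 0 c5 (c6 + x6 + y6/2))" by (simp add: z)
    then show ?thesis by blast
  qed
  have 3: "\<exists>d6. sim7 (XX c1 c2 0 0 c5 c6) (XX c1 c2 0 0 0 d6)" for c5 c6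
  proof -
    define t where "t = - c5 / (6 * \<i> * c1)"
    define x5 where d: "x5 = 6 * \<i> * (t * c1)"
    have z: "c5 + x5 = 0" using c by (simp add: t_def d)
    have "sim7 (XX c1 c2 0 0 c5 c6) (XX c1 c2 (0 + 0) (0 + 0 + 0/2) (c5 + x5 + 0/2 + 0/6) (c6 + 0 + 0/2 + 0/6))"
      by (rule sim7_XX_exp[OF XX_cube(3)[of t]]) (simp_all add: lie_XX XX_0 d lie_0_right)
    then have "sim7 (XX c1 c2 0 0 c5 c6) (XX c1 c2 0 0 0 c6)" by (simp add: z)
    then show ?thesis by blast
  qed
  have 4: "sim7 (XX c1 c2 0 0 0 c6) (XX c1 c2 0 0 0 0)" for c6
  proof -
    define t where "t = - c6 / (2 * \<i> * c2)"
    define x6 where d: "x6 = 2 * \<i> * (t * c2)"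
    have z: "c6 + x6 = 0" using c by (simp add: t_def d)
    have "sim7 (XX c1 c2 0 0 0 c6) (XX c1 c2 (0 + 0) (0 + 0 + 0/2) (0 + 0 + 0/2 + 0/6) (c6 + x6 + 0/2 + 0/6))"
      by (rule sim7_XX_exp[OF XX_cube(4)[of t]]) (simp_all add: lie_XX XX_0 d lie_0_right)
    then show ?thesis by (simp add: z)
  qed
  show ?thesis using 1 2 3 4 sim7_trans by meson
qed

text \<open>Complex rotations in the planes of axes 0, 6 and 1, 4 form a maximal torus; it scales
  the two simple root coordinates.\<close>

lemma sim7_torus:
  assumes h: "A1 * A1 + B1 * B1 = 1" "A2 * A2 + B2 * B2 = (1::complex)"
  shows "sim7 (XX c1 c2 0 0 0 0) (XX (c1 * (A1 - \<i> * B1)) (c2 * ((A1 + \<i> * B1) * (A2 - \<i> * B2))) 0 0 0 0)"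
proof -
  define a b where "a = v7 A1 0 0 0 0 0 B1" and "b = v7 0 A2 0 0 B2 0 0"
  have "basic7 a b (axis 2 1)"
    unfolding basic7_def a_def b_def using h by (simp add: dot7_def axis_v7 cross7_v7)
  then have au: "aut7 (frame7 a b (axis 2 1))" by (rule aut7_frame7)
  define A3 B3 where A3: "A3 = A1 * A2 - B1 * B2" and B3: "B3 = A1 * B2 + B1 * A2"
  have g: "frame7 a b (axis 2 1) *v z = v7 (A1 * z$0 - B1 * z$6) (A2 * z$1 - B2 * z$4) (z$2) (A3 * z$3 - B3 * z$5)
      (B2 * z$1 + A2 * z$4) (B3 * z$3 + A3 * z$5) (B1 * z$0 + A1 * z$6)" for z
    unfolding frame7_def transpose_v7_mult a_def b_def A3 B3 cross7_v7 axis_v7 by (simp add: algebra_simps)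
  have ii: "\<i> * \<i> = -1" by simp
  have "frame7 a b (axis 2 1) ** XX c1 c2 0 0 0 0 = XX (c1 * (A1 - \<i> * B1)) (c2 * ((A1 + \<i> * B1) * (A2 - \<i> * B2))) 0 0 0 0 ** frame7 a b (axis 2 1)"
  proof (rule matrix_eqI_vec)
    fix z
    show "(frame7 a b (axis 2 1) ** XX c1 c2 0 0 0 0) *v z = (XX (c1 * (A1 - \<i> * B1)) (c2 * ((A1 + \<i> * B1) * (A2 - \<i> * B2))) 0 0 0 0 ** frame7 a b (axis 2 1)) *v z"
      unfolding matrix_vector_mul_assoc[symmetric] g XX_mult v7_nth v7_eq_iff A3 B3
      using h ii by (intro conjI; algebra)
  qed
  then show ?thesis using aut7_G2C[OF au] by (auto simp: sim7_def)
qed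

lemma sim7_XX_simple:
  assumes "c1 \<noteq> 0" "c2 \<noteq> 0" "k1 \<noteq> 0" "k2 \<noteq> 0"
  shows "sim7 (XX c1 c2 0 0 0 0) (XX k1 k2 0 0 0 0)"
proof -
  \<comment> \<open>Complex cosine and sine: \<open>A - i B = z\<close> and
    \<open>A + i B = 1/z\<close>, so any scaling factor is available.\<close>
  have "\<exists>A B. A * A + B * B = 1 \<and> A - \<i> * B = z \<and> A + \<i> * B = 1 / z" if "z \<noteq> 0" for z :: complex
    by (rule exI[of _ "(z + 1/z) / 2"], rule exI[of _ "\<i> * (z - 1/z) / 2"])
      (use that in \<open>simp add: field_simps ii_mult\<close>)
  then obtain A1 B1 A2 B2 where h: "A1 * A1 + B1 * B1 = 1" "A1 - \<i> * B1 = k1 / c1" "A1 + \<i> * B1 = 1 / (k1 / c1)"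
     "A2 * A2 + B2 * B2 = 1" "A2 - \<i> * B2 = (k1 / c1) * (k2 / c2)"
    using assms by (metis divide_eq_0_iff mult_eq_0_iff)
  have "c1 * (A1 - \<i> * B1) = k1" "c2 * ((A1 + \<i> * B1) * (A2 - \<i> * B2)) = k2"
    unfolding h(2,3,5) using assms by simp_all
  then show ?thesis using sim7_torus[OF h(1,4), of c1 c2] by simp
qed

lemma continuous_conj: "continuous_on UNIV (\<lambda>Y::complex^7^7. A ** Y ** B)"
  unfolding matrix_matrix_mult_def by (intro continuous_intros)

text \<open>A vanishing simple coordinate is perturbed by \<open>1/(n+1)\<close>, a nonzero one is
  left alone; the perturbed elements all lie in the orbit.\<close>

lemma XX_in_closure:
  assumes k: "k1 \<noteq> 0" "k2 \<noteq> 0"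
  shows "XX c1 c2 c3 c4 c5 c6 \<in> closure (adj_orbit (XX k1 k2 0 0 0 0))"
proof -
  define e1 e2 where "e1 = (if c1 = 0 then 1 else 0 :: complex)" and "e2 = (if c2 = 0 then 1 else 0 :: complex)"
  define f where "f = (\<lambda>n::nat. XX (c1 + e1 * of_real (inverse (real (Suc n)))) (c2 + e2 * of_real (inverse (real (Suc n)))) c3 c4 c5 c6)"
  have "f n \<in> adj_orbit (XX k1 k2 0 0 0 0)" for n
  proof -
    have r: "of_real (inverse (real (Suc n))) \<noteq> (0::complex)" by (simp only: of_real_eq_0_iff) simp
    have nz: "c1 + e1 * of_real (inverse (real (Suc n))) \<noteq> 0" "c2 + e2 * of_real (inverse (real (Suc n))) \<noteq> 0"
      using r by (simp_all add: e1_def e2_def)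
    show ?thesis unfolding adj_orbit_iff f_def
      using sim7_trans[OF sim7_XX_simple[OF k nz] sim7_sym[OF sim7_XX_reduce[OF nz]]] by blast
  qed
  moreover have "f \<longlonglongrightarrow> XX c1 c2 c3 c4 c5 c6"
  proof -
    have a: "(\<lambda>n. c + e * of_real (inverse (real (Suc n)))) \<longlonglongrightarrow> c" for c e :: complex
    proof -
      have "(\<lambda>n. c + e * of_real (inverse (real (Suc n)))) \<longlonglongrightarrow> c + e * of_real 0"
        by (intro tendsto_intros LIMSEQ_inverse_real_of_nat)
      then show ?thesis by simp
    qed
    show ?thesis unfolding f_def
    proof (intro vec_tendstoI)
      have *: "\<forall>i j. (\<lambda>n. XX (c1 + e1 * of_real (inverse (real (Suc n)))) (c2 + e2 * of_real (inverse (real (Suc n)))) c3 c4 c5 c6 $ i $ j) \<longlonglongrightarrow> XX c1 c2 c3 c4 c5 c6 $ i $ j"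
        unfolding forall_7 XX_def G14_def v7_nth by (intro conjI tendsto_intros a)
      fix i j show "(\<lambda>n. XX (c1 + e1 * of_real (inverse (real (Suc n)))) (c2 + e2 * of_real (inverse (real (Suc n)))) c3 c4 c5 c6 $ i $ j) \<longlonglongrightarrow> XX c1 c2 c3 c4 c5 c6 $ i $ j"
        using * by blast
    qed
  qed
  ultimately show ?thesis unfolding closure_sequential by blast
qed

section \<open>Moving a nilpotent derivation into the standard nilpotent algebra\<close>

lemma cmat_mult: "cmat A B ** cmat C D = cmat (A ** C - B ** D) (A ** D + B ** C)"
  by (simp add: vec_eq_iff cmat_def matrix_matrix_mult_def complex_eq_iff sum_subtractf sum.distrib)

lemma transpose_cmat: "transpose (cmat A B) = cmat (transpose A) (transpose B)"
  by (simp add: vec_eq_iff cmat_def transpose_def)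

lemma cmat_mat: "cmat (mat 1) 0 = mat 1"
  by (simp add: vec_eq_iff cmat_def mat_def complex_eq_iff)

lemma conj7_cmat: "conj7 (cmat g 0) (cmat A B) = cmat (conj7 g A) (conj7 g B)"
  unfolding conj7_def transpose_cmat cmat_mult
  by (simp add: transpose_def vec_eq_iff cmat_def matrix_matrix_mult_def complex_eq_iff)

lemma aut7_cmat:
  assumes g: "aut7 g"
  shows "aut7 (cmat g 0)"
proof -
  have "transpose (0::real^7^7) = 0" by (simp add: transpose_def vec_eq_iff)
  then have "transpose (cmat g 0) ** cmat g 0 = mat 1"
    unfolding transpose_cmat cmat_mult by (simp add: aut7D[OF g] cmat_mat)
  moreover have "cmat g 0 *v cross7 z w = cross7 (cmat g 0 *v z) (cmat g 0 *v w)" for z w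
  proof -
    obtain x y x' y' where z: "z = cvec x y" "w = cvec x' y'" using cvec_exists by metis
    show ?thesis unfolding z cross7_cvec cmat_mult_cvec
      by (simp add: aut7D(3)[OF g] matrix_vector_right_distrib matrix_vector_mult_diff_distrib)
  qed
  ultimately show ?thesis by (simp add: aut7_def)
qed

lemma cmat_g2C_conj7:
  assumes g: "aut7 g" and X: "X \<in> g2C"
  shows "conj7 (cmat g 0) X \<in> g2C"
proof -
  obtain A B where "X = cmat A B" "A \<in> g2" "B \<in> g2" using X unfolding complexify_cmat by blast
  moreover from this have "conj7 g A \<in> g2" "conj7 g B \<in> g2" by (simp_all add: g2_iff_der7 der7_conj7[OF g])
  ultimately show ?thesis unfolding complexify_cmat using conj7_cmat by blast
qed

lemma sim7_conj7: "aut7 g \<Longrightarrow> sim7 X (conj7 g X)"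
proof -
  assume g: "aut7 g"
  have "conj7 g X ** g = g ** X ** (transpose g ** g)" by (simp add: conj7_def matrix_mul_assoc)
  then have "g ** X = conj7 g X ** g" by (simp add: aut7D[OF g])
  then show ?thesis using aut7_G2C[OF g] by (auto simp: sim7_def)
qed

text \<open>The last nonzero iterate of a vector with \<open>X *v z\<close> nonzero lies both in the
  image and in the kernel of \<open>X\<close>. For skew \<open>X\<close> these are orthogonal, so
  the iterate is null.\<close>

lemma null_kernel_vector:
  assumes X: "X \<in> g2C" "X \<noteq> 0" and nil: "\<And>z. ((*v) X ^^ n) z = 0"
  obtains y where "y \<noteq> 0" "X *v y = 0" "dot7 y y = 0"
proof -
  obtain z where z: "X *v z \<noteq> 0" using X(2) matrix_eqI_vec[of X 0] by auto
  define m where "m = (LEAST m. ((*v) X ^^ m) z = 0)"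
  have m: "((*v) X ^^ m) z = 0" unfolding m_def by (rule LeastI[of _ n]) (rule nil)
  have lt: "((*v) X ^^ k) z \<noteq> 0" if "k < m" for k using not_less_Least[of k] that unfolding m_def by blast
  have "m \<noteq> 0"
  proof
    assume "m = 0"
    then have "z = 0" using m by simp
    then show False using z by simp
  qed
  moreover have "m \<noteq> 1" using m z by auto
  ultimately have "m \<noteq> 0" "m \<noteq> 1" by blast+
  then obtain k where k: "m = Suc (Suc k)" by (metis One_nat_def not0_implies_Suc)
  define y where "y = ((*v) X ^^ Suc k) z"
  have y0: "y \<noteq> 0" unfolding y_def by (rule lt) (simp add: k)
  have Xy: "X *v y = 0" using m by (simp add: y_def k)
  have "dot7 y y = dot7 (X *v (((*v) X ^^ k) z)) y" by (simp add: y_def)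
  also have "\<dots> = 0" unfolding g2C_skew(2)[OF X(1)] Xy by (simp add: dot7_0_right)
  finally show ?thesis using that y0 Xy by blast
qed

lemma exists_orthogonal_triple:
  obtains c :: "real^7" where "c \<noteq> 0" "dot7 c x = 0" "dot7 c y = 0" "dot7 c z = 0"
proof -
  have "span {x, y, z} \<noteq> UNIV"
  proof
    assume "span {x, y, z} = UNIV"
    then have "dim (UNIV :: (real^7) set) \<le> card {x, y, z}" by (metis dim_span dim_le_card' finite.emptyI finite.insertI)
    moreover have "card {x, y, z} \<le> 3" by (simp add: card_insert_if)
    ultimately show False by simp
  qed
  from span_not_UNIV_orthogonal[OF this] obtain c where "c \<noteq> 0" "\<And>u. u \<in> span {x, y, z} \<Longrightarrow> inner c u = 0" by blast
  then show ?thesis using that[of c] by (simp add: inner_eq_dot7 span_base)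
qed

text \<open>\<open>k\<close> says that the product of a + ib and p + iq vanishes. The real group is
  transitive on such complex flags, which is why real automorphisms suffice to normalise complex
  nilpotents.\<close>

lemma flag_frame:
  fixes a b p q :: "real^7"
  assumes a: "dot7 a a = 1" "dot7 b b = 1" "dot7 a b = 0"
    and pa: "dot7 a p = 0" "dot7 a q = 0" and k: "cross7 a p = cross7 b q" "cross7 a q = - cross7 b p"
    and nz: "p \<noteq> 0 \<or> q \<noteq> 0"
  obtains g r where "aut7 g" "r \<noteq> 0" "g *v axis 3 1 = a" "g *v axis 5 1 = b" "g *v axis 1 1 = r *s p" "g *v axis 4 1 = r *s q"
proof -
  have ba: "dot7 b a = 0" using a by (simp add: dot7_commute)
  have bpq: "dot7 b p = 0" "dot7 b q = 0"
  proof -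
    have "cross7 a (cross7 a p) + cross7 b (cross7 a q) = cross7 a (cross7 b q) + cross7 b (cross7 a q)" by (simp add: k)
    also have "\<dots> = dot7 b q *s a" unfolding cross7_cross7_polar using a pa by simp
    also have "cross7 a (cross7 a p) + cross7 b (cross7 a q) = - (dot7 b p *s b)"
      unfolding k(2) cross7_minus_right cross7_cross7_same using a pa by simp
    finally have e: "- (dot7 b p *s b) = dot7 b q *s a" .
    from arg_cong[OF e, of "dot7 b"] show "dot7 b p = 0" using a ba by (simp add: dot7_minus_right dot7_smult_right)
    from arg_cong[OF e, of "dot7 a"] show "dot7 b q = 0" using a ba by (simp add: dot7_minus_right dot7_smult_right)
  qed
  have p0: "p \<noteq> 0"
  proof
    assume "p = 0"
    then have "cross7 b q = 0" using k(1) by (simp add: cross7_0_right)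
    then have "q = 0" using cross7_cross7_orth[OF bpq(2)] a by (simp add: cross7_0_right)
    then show False using nz \<open>p = 0\<close> by simp
  qed
  obtain r where r: "r \<noteq> 0" "dot7 (r *s p) (r *s p) = 1" using normalized[OF p0] by blast
  define P Q where "P = r *s p" and "Q = r *s q"
  have P: "dot7 P P = 1" "dot7 a P = 0" "dot7 b P = 0" "dot7 P a = 0" "dot7 P b = 0" "cross7 a P = cross7 b Q" "cross7 a Q = - cross7 b P" "dot7 a Q = 0"
    using r pa bpq k dot7_commute[of p a] dot7_commute[of p b]
    by (simp_all add: P_def Q_def dot7_smult_right dot7_smult_left cross7_smult_right)
  \<comment> \<open>The future image of axis 0: as e3 x e0 = e1 and e5 x e0 = e4, it must be
    multiplied by \<open>a\<close> and \<open>b\<close> to \<open>P\<close> and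
    \<open>Q\<close>.\<close>
  define c where "c = - cross7 a P"
  have ac: "cross7 a c = P" unfolding c_def cross7_minus_right cross7_cross7_orth[OF P(2)] using a by simp
  have bc: "cross7 b c = Q"
  proof -
    have "cross7 b c = cross7 a (cross7 b P)"
      unfolding c_def cross7_minus_right using cross7_swap[of b a P] ba P by simp
    also have "\<dots> = - cross7 a (cross7 a Q)" unfolding P(7) by (simp add: cross7_minus_right)
    also have "\<dots> = Q" unfolding cross7_cross7_orth[OF P(8)] using a by simp
    finally show ?thesis .
  qed
  have acd: "dot7 a c = 0" by (simp add: c_def dot7_minus_right dot7_cross7_self)
  have cc: "dot7 c c = 1"
  proof -
    have "dot7 c c = dot7 c (- cross7 a P)" by (simp add: c_def)
    also have "\<dots> = - dot7 (cross7 c a) P" by (simp add: dot7_minus_right dot7_cross7)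
    also have "cross7 c a = - P" using ac cross7_anticomm by metis
    finally show ?thesis using P by (simp add: dot7_minus_left)
  qed
  note t = cross7_triple[OF acd a(1) cc ac]
  note s = cross7_triple[OF a(3,1,2) refl]
  have cab: "dot7 c (cross7 a b) = 0"
  proof -
    have "dot7 c (cross7 a b) = dot7 (cross7 c a) b" by (simp add: dot7_cross7)
    also have "cross7 c a = - P" using ac cross7_anticomm by metis
    finally show ?thesis using P by (simp add: dot7_minus_left)
  qed
  have Pab: "dot7 P (cross7 a b) = 0"
  proof -
    have "dot7 P (cross7 a b) = dot7 (cross7 P a) b" by (simp add: dot7_cross7)
    also have "\<dots> = - dot7 (cross7 b Q) b" using P(6) cross7_anticomm[of P a] by (simp add: dot7_minus_left)
    also have "\<dots> = 0" by (simp add: dot7_commute[of _ b] dot7_cross7_self)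
    finally show ?thesis .
  qed
  have "basic7 c P (cross7 a b)"
    unfolding basic7_def t(1) using cc P(1) s(3) t(5) cab Pab s(4) by blast
  then have g: "aut7 (frame7 c P (cross7 a b))" by (rule aut7_frame7)
  have "cross7 P (cross7 a b) = Q"
  proof -
    have "cross7 P (cross7 a b) = - cross7 a (cross7 P b)" by (rule cross7_swap) (use P a in auto)
    also have "cross7 P b = cross7 a Q" using P(7) cross7_anticomm[of P b] by simp
    also have "- cross7 a (cross7 a Q) = Q" unfolding cross7_cross7_orth[OF P(8)] using a by simp
    finally show ?thesis .
  qed
  then show ?thesis using that[OF g r(1)] t s
    unfolding frame7_axis P_def[symmetric] Q_def[symmetric] by simp
qed

lemma nilpotent_conj_XX:
  assumes X: "X \<in> g2C" and nil: "\<And>z. ((*v) X ^^ n) z = 0"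
  obtains g c1 c2 c3 c4 c5 c6 where "aut7 g" "X = conj7 (cmat g 0) (XX c1 c2 c3 c4 c5 c6)"
proof (cases "X = 0")
  case True
  have "basic7 (axis 0 1) (axis 1 1) (axis 2 (1::real))" unfolding basic7_def by (simp add: dot7_def axis_v7 cross7_v7)
  then have "aut7 (frame7 (axis 0 1) (axis 1 1) (axis 2 (1::real)))" by (rule aut7_frame7)
  moreover have "X = conj7 (cmat (frame7 (axis 0 1) (axis 1 1) (axis 2 (1::real))) 0) (XX 0 0 0 0 0 0)"
    by (simp add: True XX_0 conj7_def)
  ultimately show ?thesis using that by blast
next
  case False
  obtain y where y: "y \<noteq> 0" "X *v y = 0" "dot7 y y = 0" using null_kernel_vector[OF X False nil] by blast
  obtain a0 b0 where yc: "y = cvec a0 b0" using cvec_exists by blast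
  have d0: "dot7 a0 a0 = dot7 b0 b0" "dot7 a0 b0 = 0"
    using y(3) unfolding yc dot7_cvec by (simp_all add: complex_eq_iff dot7_commute[of b0 a0])
  have "a0 \<noteq> 0"
  proof
    assume z: "a0 = 0"
    then have "inner b0 b0 = 0" using d0 by (simp add: dot7_0_left inner_eq_dot7)
    then show False using y(1) z yc by (simp add: cvec_0)
  qed
  then obtain r where r: "r \<noteq> 0" "dot7 (r *s a0) (r *s a0) = 1" using normalized by blast
  define a b where ab: "a = r *s a0" "b = r *s b0"
  define v where "v = cvec a b"
  have a: "dot7 a a = 1" "dot7 b b = 1" "dot7 a b = 0"
    using r d0 by (simp_all add: ab dot7_smult_left dot7_smult_right)
  have vy: "v = of_real r *s y" by (simp add: v_def yc ab cvec_def vec_eq_iff complex_eq_iff)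
  have Xv: "X *v v = 0" by (simp add: vy vector_scalar_commute y)
  obtain c0 where c0: "c0 \<noteq> 0" "dot7 c0 a = 0" "dot7 c0 b = 0" "dot7 c0 (cross7 a b) = 0"
    using exists_orthogonal_triple by blast
  \<comment> \<open>\<open>c0\<close> is orthogonal to the null vector \<open>v\<close>, so
    \<open>v\<close> annihilates this product; orthogonality of \<open>c0\<close> to
    \<open>cross7 a b\<close> keeps \<open>w0\<close> off the line of \<open>v\<close>.\<close>
  define w0 where "w0 = cross7 v (cvec c0 0)"
  have vv: "dot7 v v = 0" unfolding vy by (simp add: dot7_smult_left dot7_smult_right y)
  have vc: "dot7 v (cvec c0 0) = 0" unfolding v_def dot7_cvec using c0
    by (simp add: dot7_0_right dot7_commute[of _ c0] complex_eq_iff)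
  have vw0: "cross7 v w0 = 0" unfolding w0_def cross7_cross7_orth[OF vc] vv by simp
  have w0: "w0 \<noteq> k *s v" for k
  proof
    assume e: "w0 = k *s v"
    have w0e: "w0 = cvec (cross7 a c0) (cross7 b c0)" unfolding w0_def v_def cross7_cvec by (simp add: cross7_0_right)
    have "dot7 w0 (cvec a 0) = 0"
    proof -
      have "dot7 (cross7 a c0) a = 0" by (simp add: dot7_commute[of _ a] dot7_cross7_self)
      moreover have "dot7 (cross7 b c0) a = 0" by (metis c0(4) dot7_commute dot7_cross7)
      ultimately show ?thesis unfolding w0e dot7_cvec by (simp add: dot7_0_right complex_eq_iff)
    qed
    moreover have "dot7 (k *s v) (cvec a 0) = k" unfolding dot7_smult_left v_def dot7_cvec using a
      by (simp add: dot7_0_right dot7_commute[of b a] complex_eq_iff)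
    ultimately have "w0 = 0" using e by simp
    then have "cross7 a c0 = 0" unfolding w0e cvec_eq_0_iff by blast
    then have "c0 = 0" using cross7_cross7_orth[of a c0] a c0 by (simp add: cross7_0_right dot7_commute)
    then show False using c0 by simp
  qed
  have vX: "cross7 v (((*v) X ^^ m) w0) = 0" for m
  proof (induction m)
    case (Suc m)
    have "X *v cross7 v u = cross7 (X *v v) u + cross7 v (X *v u)" for u using g2C_der7[OF X] by (simp add: der7_def)
    from this[of "((*v) X ^^ m) w0"] show ?case by (simp add: Suc Xv cross7_0_left)
  qed (simp add: vw0)
  define m where "m = (LEAST m. \<exists>k. ((*v) X ^^ m) w0 = k *s v)"
  have "\<exists>k. ((*v) X ^^ n) w0 = k *s v" using nil by (intro exI[of _ 0]) simp
  then have mk: "\<exists>k. ((*v) X ^^ m) w0 = k *s v" unfolding m_def by (rule LeastI)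
  have "m \<noteq> 0"
  proof
    assume "m = 0"
    then show False using mk w0 by auto
  qed
  \<comment> \<open>The last iterate of \<open>w0\<close> off the line of \<open>v\<close> is the
    second flag vector: \<open>X\<close> maps it into that line.\<close>
  then obtain m' where m': "m = Suc m'" by (metis not0_implies_Suc)
  define w where "w = ((*v) X ^^ m') w0"
  have "\<not> (\<exists>k. ((*v) X ^^ m') w0 = k *s v)"
    by (rule not_less_Least) (simp add: m_def[symmetric] m')
  then have wn: "w \<noteq> k *s v" for k unfolding w_def by blast
  obtain k where Xw: "X *v w = k *s v" using mk by (auto simp: m' w_def)
  have vw: "cross7 v w = 0" unfolding w_def by (rule vX)
  \<comment> \<open>Subtracting \<open>al *s v\<close> makes the real and imaginary parts orthogonal
    to \<open>a\<close>, as \<open>flag_frame\<close> requires, without changing the flag.\<close>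
  define al where "al = dot7 w (cvec a 0)"
  obtain p q where pq: "w - al *s v = cvec p q" using cvec_exists by metis
  have "dot7 (cvec p q) (cvec a 0) = 0"
  proof -
    have "dot7 v (cvec a 0) = 1" unfolding v_def dot7_cvec using a
      by (simp add: dot7_0_right dot7_commute[of b a] complex_eq_iff)
    then show ?thesis unfolding pq[symmetric] dot7_diff_left dot7_smult_left al_def by simp
  qed
  then have pa: "dot7 a p = 0" "dot7 a q = 0"
    unfolding dot7_cvec by (simp_all add: dot7_0_right dot7_commute[of a] complex_eq_iff)
  have "cross7 v (cvec p q) = 0" unfolding pq[symmetric] cross7_diff_right cross7_smult_right vw cross7_self by simp
  then have "cross7 a p - cross7 b q = 0" "cross7 a q + cross7 b p = 0"
    unfolding v_def cross7_cvec cvec_eq_0_iff by blast+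
  then have kk: "cross7 a p = cross7 b q" "cross7 a q = - cross7 b p" by (simp_all add: eq_neg_iff_add_eq_0)
  have "cvec p q \<noteq> 0" using wn[of al] unfolding pq[symmetric] by simp
  then have nz: "p \<noteq> 0 \<or> q \<noteq> 0" by (auto simp: cvec_0)
  obtain g s where g: "aut7 g" and s: "s \<noteq> 0" and ge: "g *v axis 3 1 = a" "g *v axis 5 1 = b" "g *v axis 1 1 = s *s p" "g *v axis 4 1 = s *s q"
    using flag_frame[OF a pa kk nz] by blast
  have gC: "aut7 (cmat g 0)" by (rule aut7_cmat[OF g])
  define Y where "Y = conj7 (cmat (transpose g) 0) X"
  have tr: "transpose (cmat g 0) = cmat (transpose g) 0" by (simp add: transpose_cmat transpose_def vec_eq_iff cmat_def)
  have Yg: "Y \<in> g2C" unfolding Y_def by (rule cmat_g2C_conj7[OF aut7_transpose[OF g] X])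
  have YX: "conj7 (cmat g 0) Y = X" unfolding Y_def tr[symmetric] by (rule conj7_transpose(1)[OF gC])
  have Ym: "Y *v z = transpose (cmat g 0) *v (X *v (cmat g 0 *v z))" for z
    unfolding Y_def tr[symmetric] conj7_mult_vec(2)[OF aut7_transpose[OF gC]] by (simp add: transpose_transpose)
  have std: "v7 0 0 0 1 0 \<i> 0 = cvec (axis 3 1) (axis 5 1)" "v7 0 1 0 0 \<i> 0 0 = cvec (axis 1 1) (axis 4 1)"
    by (simp_all add: vec_eq_7 cvec_def axis_v7 complex_eq_iff)
  have gv: "cmat g 0 *v v7 0 0 0 1 0 \<i> 0 = v" unfolding std cmat_mult_cvec v_def by (simp add: ge)
  have gw: "cmat g 0 *v v7 0 1 0 0 \<i> 0 0 = of_real s *s (w - al *s v)"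
    unfolding std cmat_mult_cvec pq by (simp add: ge cvec_def vec_eq_iff complex_eq_iff)
  have "Y *v v7 0 0 0 1 0 \<i> 0 = 0" unfolding Ym gv Xv by simp
  moreover have "Y *v v7 0 1 0 0 \<i> 0 0 = (of_real s * k) *s v7 0 0 0 1 0 \<i> 0"
  proof -
    have "X *v (of_real s *s (w - al *s v)) = (of_real s * k) *s v"
      by (simp add: vector_scalar_commute matrix_vector_mult_diff_distrib Xw Xv vec_eq_iff)
    then have "Y *v v7 0 1 0 0 \<i> 0 0 = (of_real s * k) *s (transpose (cmat g 0) *v v)"
      unfolding Ym gw by (simp add: vector_scalar_commute)
    also have "transpose (cmat g 0) *v v = v7 0 0 0 1 0 \<i> 0" unfolding gv[symmetric] by (rule aut7_inverse_vec(1)[OF gC])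
    finally show ?thesis .
  qed
  ultimately obtain c1 c2 c3 c4 c5 c6 where "Y = XX c1 c2 c3 c4 c5 c6" using XX_of_flag[OF Yg] by blast
  then show ?thesis using that[OF g] YX by metis
qed

lemma adj_orbit_closure_invariant:
  assumes g: "aut7 g" and X: "X \<in> closure (adj_orbit N)"
  shows "conj7 g X \<in> closure (adj_orbit N)"
proof -
  have "conj7 g ` adj_orbit N \<subseteq> adj_orbit N"
    using sim7_trans sim7_conj7[OF g] by (auto simp: adj_orbit_iff)
  then have "conj7 g ` adj_orbit N \<subseteq> closure (adj_orbit N)" using closure_subset by blast
  moreover have "continuous_on (closure (adj_orbit N)) (conj7 g)"
    unfolding conj7_def by (rule continuous_on_subset[OF continuous_conj subset_UNIV])
  ultimately have "conj7 g ` closure (adj_orbit N) \<subseteq> closure (adj_orbit N)"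
    by (intro image_closure_subset) auto
  then show ?thesis using X by blast
qed

lemma nilvariety_subset_closure:
  assumes "k1 \<noteq> 0" "k2 \<noteq> 0"
  shows "nilvariety \<subseteq> closure (adj_orbit (XX k1 k2 0 0 0 0))"
proof
  fix X assume "X \<in> nilvariety"
  then have n: "nilpotent_elt X" by (simp add: nilvariety_def)
  then have X: "X \<in> g2C" by (simp add: nilpotent_elt_def)
  obtain m where m: "\<And>z. ((*v) X ^^ m) z = 0" using nilpotent_elt_vec[OF n] by blast
  obtain g c1 c2 c3 c4 c5 c6 where "aut7 g" "X = conj7 (cmat g 0) (XX c1 c2 c3 c4 c5 c6)"
    using nilpotent_conj_XX[OF X m] by blast
  then show "X \<in> closure (adj_orbit (XX k1 k2 0 0 0 0))"
    using adj_orbit_closure_invariant[OF aut7_cmat] XX_in_closure[OF assms] by blast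
qed

section \<open>Ad-nilpotency and the Jordan type of the principal nilpotent\<close>

lemma funpow_mult_vec_0: "((*v) (N::'a::comm_ring_1^7^7) ^^ n) 0 = 0"
  by (induction n) simp_all

lemma funpow_mult_vec_diff: "((*v) (N::'a::comm_ring_1^7^7) ^^ n) (x - y) = ((*v) N ^^ n) x - ((*v) N ^^ n) y"
  by (induction n) (simp_all add: matrix_vector_mult_diff_distrib)

text \<open>\<open>s\<close> measures by how much \<open>Y\<close> shifts the filtration by the kernels of the powers of \<open>N\<close>; bracketing with \<open>N\<close> lowers it.\<close>
lemma lie_lowers_filtration:
  fixes N Y :: "'a::comm_ring_1^7^7"
  assumes Y: "\<And>i z. ((*v) N ^^ i) z = 0 \<Longrightarrow> ((*v) N ^^ nat (int i + s)) (Y *v z) = 0"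
    and z: "((*v) N ^^ i) z = 0"
  shows "((*v) N ^^ nat (int i + (s - 1))) (lie N Y *v z) = 0"
proof (cases i)
  case 0
  then show ?thesis using z by (simp add: funpow_mult_vec_0)
next
  case (Suc j)
  have "((*v) N ^^ j) (N *v z) = 0" using z by (simp add: Suc funpow_swap1)
  from Y[OF this] have 1: "((*v) N ^^ nat (int i + (s - 1))) (Y *v (N *v z)) = 0" by (simp add: Suc algebra_simps)
  have 2: "((*v) N ^^ nat (int i + (s - 1))) (N *v (Y *v z)) = 0"
  proof (cases "int i + s \<ge> 1")
    case True
    then have "nat (int i + s) = Suc (nat (int i + (s - 1)))" by linarith
    then show ?thesis using Y[OF z] by (simp add: funpow_swap1)
  next
    case False
    then show ?thesis using Y[OF z] by (simp add: funpow_mult_vec_0)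
  qed
  show ?thesis unfolding lie_mult_vec funpow_mult_vec_diff 1 2 by simp
qed

text \<open>Any \<open>Y\<close> shifts the filtration by at most \<open>m\<close>, since the
  \<open>m\<close>-th kernel is everything; after \<open>2 * m\<close> brackets the shift is
  \<open>- m\<close>. \<open>nat\<close> truncates negative levels to 0, the level of the zero
  subspace.\<close>

lemma nilpotent_imp_ad_nilpotent:
  fixes N :: "'a::comm_ring_1^7^7"
  assumes nil: "\<And>z. ((*v) N ^^ m) z = 0"
  shows "((lie N) ^^ (2 * m)) Y = 0"
proof (rule matrix_eqI_vec)
  fix z
  have ge: "((*v) N ^^ n) x = 0" if "n \<ge> m" for n x
  proof -
    have "((*v) N ^^ n) x = ((*v) N ^^ (n - m)) (((*v) N ^^ m) x)" using that by (simp add: funpow_add[symmetric, unfolded comp_def, THEN fun_cong])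
    then show ?thesis using nil by (simp add: funpow_mult_vec_0)
  qed
  have "((*v) N ^^ i) x = 0 \<Longrightarrow> ((*v) N ^^ nat (int i + (int m - int k))) (((lie N) ^^ k) Y *v x) = 0" for i x k
  proof (induction k arbitrary: i x)
    case 0
    have "nat (int i + (int m - int 0)) \<ge> m" by simp
    then show ?case using ge by blast
  next
    case (Suc k)
    have "((*v) N ^^ nat (int i + ((int m - int k) - 1))) (lie N (((lie N) ^^ k) Y) *v x) = 0"
      by (rule lie_lowers_filtration[OF Suc.IH Suc.prems])
    moreover have "int i + (int m - int (Suc k)) = int i + ((int m - int k) - 1)" by simp
    ultimately show ?case by (metis comp_apply funpow.simps(2))
  qed
  from this[OF nil, of "2 * m" z] show "((lie N) ^^ (2 * m)) Y *v z = 0 *v z" by simp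
qed

text \<open>A single Jordan chain through seven weight vectors: the seventh power vanishes, the
  sixth does not when \<open>c1\<close> and \<open>c2\<close> are nonzero.\<close>

lemma XX_chain:
  "XX c1 c2 0 0 0 0 *v v7 0 0 0 1 0 (- \<i>) 0 = (2 * \<i> * c1) *s v7 0 1 0 0 (- \<i>) 0 0"
  "XX c1 c2 0 0 0 0 *v v7 0 1 0 0 (- \<i>) 0 0 = (2 * \<i> * c2) *s v7 1 0 0 0 0 0 (- \<i>)"
  "XX c1 c2 0 0 0 0 *v v7 1 0 0 0 0 0 (- \<i>) = (- 4 * c1) *s v7 0 0 1 0 0 0 0"
  "XX c1 c2 0 0 0 0 *v v7 0 0 1 0 0 0 0 = (2 * c1) *s v7 1 0 0 0 0 0 \<i>"
  "XX c1 c2 0 0 0 0 *v v7 1 0 0 0 0 0 \<i> = (- 2 * \<i> * c2) *s v7 0 1 0 0 \<i> 0 0"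
  "XX c1 c2 0 0 0 0 *v v7 0 1 0 0 \<i> 0 0 = (- 2 * \<i> * c1) *s v7 0 0 0 1 0 \<i> 0"
  "XX c1 c2 0 0 0 0 *v v7 0 0 0 1 0 \<i> 0 = 0"
  unfolding XX_mult v7_nth by (simp_all add: algebra_simps ii_mult)

lemma matrix_vector_mult_minus: "(A::'a::comm_ring_1^7^7) *v (- x) = - (A *v x)"
  by (simp add: vec_eq_iff matrix_vector_mult_def sum_negf)

lemma XX_pow6:
  assumes "c1 \<noteq> 0" "c2 \<noteq> 0"
  shows "((*v) (XX c1 c2 0 0 0 0) ^^ 6) (v7 0 0 0 1 0 (- \<i>) 0) \<noteq> 0"
  using assms by (simp add: eval_nat_numeral XX_chain vector_scalar_commute matrix_vector_mult_minus del: v7_smult v7_uminus)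

lemma XX_pow7: "((*v) (XX c1 c2 0 0 0 0) ^^ 7) z = 0"
proof -
  let ?N = "XX c1 c2 0 0 0 0"
  have lin: "((*v) ?N ^^ m) (x + y) = ((*v) ?N ^^ m) x + ((*v) ?N ^^ m) y" "((*v) ?N ^^ m) (r *s x) = r *s ((*v) ?N ^^ m) x" for m x y r
    by (induction m) (simp_all add: matrix_vector_right_distrib vector_scalar_commute)
  have z: "z = ((z$3 + \<i> * z$5) / 2) *s v7 0 0 0 1 0 (- \<i>) 0 + ((z$1 + \<i> * z$4) / 2) *s v7 0 1 0 0 (- \<i>) 0 0
     + ((z$0 + \<i> * z$6) / 2) *s v7 1 0 0 0 0 0 (- \<i>) + z$2 *s v7 0 0 1 0 0 0 0 + ((z$0 - \<i> * z$6) / 2) *s v7 1 0 0 0 0 0 \<i>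
     + ((z$1 - \<i> * z$4) / 2) *s v7 0 1 0 0 \<i> 0 0 + ((z$3 - \<i> * z$5) / 2) *s v7 0 0 0 1 0 \<i> 0"
    by (simp add: vec_eq_7 field_simps ii_mult)
  have "((*v) ?N ^^ 7) (v7 0 0 0 1 0 (- \<i>) 0) = 0" "((*v) ?N ^^ 7) (v7 0 1 0 0 (- \<i>) 0 0) = 0" "((*v) ?N ^^ 7) (v7 1 0 0 0 0 0 (- \<i>)) = 0"
    "((*v) ?N ^^ 7) (v7 0 0 1 0 0 0 0) = 0" "((*v) ?N ^^ 7) (v7 1 0 0 0 0 0 \<i>) = 0" "((*v) ?N ^^ 7) (v7 0 1 0 0 \<i> 0 0) = 0" "((*v) ?N ^^ 7) (v7 0 0 0 1 0 \<i> 0) = 0"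
    by (simp_all add: eval_nat_numeral XX_chain vector_scalar_commute matrix_vector_mult_minus del: v7_smult v7_uminus)
  then show ?thesis by (subst z) (simp add: lin del: v7_smult v7_add)
qed

lemma nilpotent_elt_XX: "nilpotent_elt (XX c1 c2 0 0 0 0)"
  unfolding nilpotent_elt_def using XX_g2C nilpotent_imp_ad_nilpotent[OF XX_pow7] by blast

lemma principal_nilpotent_XX: "k1 \<noteq> 0 \<Longrightarrow> k2 \<noteq> 0 \<Longrightarrow> principal_nilpotent (XX k1 k2 0 0 0 0)"
  unfolding principal_nilpotent_def using nilpotent_elt_XX nilvariety_subset_closure by blast

lemma sim7_funpow:
  assumes "g ** X = Y ** g"
  shows "g *v (((*v) X ^^ n) z) = ((*v) Y ^^ n) (g *v z)"
proof (induction n)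
  case (Suc n)
  have "g *v (X *v u) = Y *v (g *v u)" for u using assms by (simp add: matrix_vector_mul_assoc)
  then show ?case using Suc by simp
qed simp

text \<open>Vanishing of the sixth power is closed and invariant under conjugation. If it held for
  \<open>N\<close>, it would hold on the whole nilpotent variety, in particular for
  \<open>XX 1 1 0 0 0 0\<close>.\<close>

lemma principal_nilpotent_pow6:
  assumes "principal_nilpotent N"
  obtains z where "((*v) N ^^ 6) z \<noteq> 0"
proof -
  have "\<exists>z. ((*v) N ^^ 6) z \<noteq> 0"
  proof (rule ccontr)
    assume "\<nexists>z. ((*v) N ^^ 6) z \<noteq> 0"
    then have N: "((*v) N ^^ 6) z = 0" for z by blast
    define C where "C = (\<Inter>z. {X :: complex^7^7. ((*v) X ^^ 6) z = 0})"
    have mv: "continuous_on UNIV (\<lambda>X::complex^7^7. X *v f X)" if "continuous_on UNIV f" for f :: "complex^7^7 \<Rightarrow> complex^7"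
      unfolding matrix_vector_mult_def using that by (intro continuous_intros) 
    have "continuous_on UNIV (\<lambda>X::complex^7^7. ((*v) X ^^ n) z)" for n z
      by (induction n) (simp_all add: mv)
    then have "closed C" unfolding C_def by (intro closed_INT ballI closed_Collect_eq continuous_on_const)
    moreover have "adj_orbit N \<subseteq> C"
    proof
      fix Y assume "Y \<in> adj_orbit N"
      then obtain g where g: "g \<in> G2C" "g ** N = Y ** g" by (auto simp: adj_orbit_iff sim7_def)
      have "((*v) Y ^^ 6) z = 0" for z
      proof -
        have "z = g *v (matrix_inv g *v z)" by (simp add: matrix_vector_mul_assoc G2C_inverse[OF g(1)])
        then show ?thesis using sim7_funpow[OF g(2), of 6 "matrix_inv g *v z"] N by simp
      qed
      then show "Y \<in> C" by (simp add: C_def)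
    qed
    ultimately have "closure (adj_orbit N) \<subseteq> C" by (intro closure_minimal)
    then have "XX 1 1 0 0 0 0 \<in> C"
      using assms nilpotent_elt_XX unfolding principal_nilpotent_def nilvariety_def by blast
    then show False using XX_pow6[of 1 1] by (simp add: C_def)
  qed
  then show ?thesis using that by blast
qed

section \<open>Principal subalgebras\<close>

lemma lie_add_left: "lie (x + y) z = lie x z + lie y (z::'a::comm_ring_1^7^7)"
  and lie_add_right: "lie x (y + z) = lie x y + lie x (z::'a::comm_ring_1^7^7)"
  and lie_anticomm: "lie x y = - lie y (x::'a::comm_ring_1^7^7)"
  by (simp_all add: lie_def vec_eq_iff matrix_matrix_mult_def algebra_simps sum.distrib)

lemma lie_scaleR_left: "lie (r *\<^sub>R x) y = r *\<^sub>R lie x (y::real^7^7)"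
  and lie_scaleR_right: "lie x (r *\<^sub>R y) = r *\<^sub>R lie x (y::real^7^7)"
  by (simp_all add: lie_def vec_eq_iff matrix_matrix_mult_def sum_distrib_left algebra_simps)

lemma linear_lie: "linear (lie (x::real^7^7))"
  by (rule linearI) (simp_all add: lie_add_right lie_scaleR_right)

lemma scaleR_mult_vec: "(r *\<^sub>R d) *v x = r *\<^sub>R (d *v (x::real^7))"
  by (simp add: scaleR_matrix_vector_assoc)

lemma subspace_g2: "subspace g2"
  unfolding subspace_def g2_def
  by (auto simp: matrix_vector_mult_add_rdistrib scaleR_mult_vec cross7_0_left cross7_0_right cross7_add_left cross7_add_right
     cross7_smult_left cross7_smult_right simp flip: scalar_mult_eq_scaleR)

lemma lie_g2: assumes "d \<in> g2" "e \<in> g2" shows "lie d e \<in> g2"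
proof -
  have d: "d *v cross7 x y = cross7 (d *v x) y + cross7 x (d *v y)" and e: "e *v cross7 x y = cross7 (e *v x) y + cross7 x (e *v y)" for x y
    using assms by (auto simp: g2_def)
  show ?thesis unfolding g2_def mem_Collect_eq lie_mult_vec
    by (simp add: d e matrix_vector_right_distrib cross7_diff_left cross7_diff_right)
qed

section \<open>The grading and its bracket relations\<close>

lemma subspace_MS: "V \<in> MS \<Longrightarrow> subspace V"
  by (simp add: MS_def)

lemma MS_framed:
  assumes "V \<in> MS"
  obtains g where "framed V g"
proof -
  obtain u where u: "u \<in> V" "dot7 u u = 1" using MS_unit_exists[OF assms] by blast
  obtain u2 l where ul: "u2 \<in> V" "dot7 u2 u2 = 1" "dot7 u u2 = 0" "l \<in> perp V" "dot7 l l = 1" using MS_frame_exists[OF assms u] by blast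
  have "framed V (frame7 u u2 l)" unfolding framed_def using frame_V0[OF assms u(1) ul(1) u(2) ul(2-5)] by blast
  then show ?thesis using that by blast
qed

lemma V0_coord7: "V0 = coord7 {0,1,3}"
  unfolding V0_def coord7_def forall_7 by simp

lemma perp_perp:
  assumes "V \<in> MS"
  shows "perp (perp V) = V"
proof -
  obtain g where f: "framed V g" using MS_framed[OF assms] by blast
  then have g: "aut7 g" "V = img g V0" by (auto simp: framed_def)
  show ?thesis unfolding g(2) perp_img[OF g(1)] V0_coord7 perp_coord7 by simp
qed

lemma MS_decompose:
  assumes "V \<in> MS"
  obtains a b where "a \<in> V" "b \<in> perp V" "x = a + b"
proof -
  obtain g where f: "framed V g" using MS_framed[OF assms] by blast
  then have g: "aut7 g" "img g V0 = V" by (auto simp: framed_def)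
  define y where "y = transpose g *v x"
  define a b where "a = v7 (y$0) (y$1) 0 (y$3) 0 0 0" and "b = v7 0 0 (y$2) 0 (y$4) (y$5) (y$6)"
  have "a \<in> V0" by (simp add: a_def V0_def)
  then have "g *v a \<in> V" using g(2) by blast
  moreover have "g *v b \<in> perp V" by (rule framed_perp(5)[OF f]) (simp add: b_def perp_V0)
  moreover have "y = a + b" by (simp add: a_def b_def vec_eq_7)
  then have "x = g *v a + g *v b" using aut7_inverse_vec(2)[OF g(1), of x] by (simp add: y_def[symmetric] matrix_vector_right_distrib)
  ultimately show ?thesis using that by blast
qed

text \<open>\<open>h4\<close> only mentions the complement; skewness carries the invariance over to
  \<open>perp (perp V) = V\<close>.\<close>

lemma h4_preserves:
  assumes V: "V \<in> MS" and d: "d \<in> h4 V" and x: "x \<in> V"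
  shows "d *v x \<in> V"
proof -
  have "inner l (d *v x) = 0" if "l \<in> perp V" for l
  proof -
    have "der7 d" "d *v l \<in> perp V" using d that by (auto simp: h4_def g2_iff_der7)
    then have "dot7 x (d *v l) = 0" using x by (simp add: perp_def inner_eq_dot7)
    then show ?thesis using der7_skew_vec[OF \<open>der7 d\<close>, of x l] by (simp add: inner_eq_dot7 dot7_commute[of l])
  qed
  then have "d *v x \<in> perp (perp V)" by (simp add: perp_def)
  then show ?thesis using perp_perp[OF V] by simp
qed

lemma lie_m4_m4: assumes "V \<in> MS" "d \<in> m4 V" "e \<in> m4 V" shows "lie d e \<in> h4 V"
  using assms lie_g2 subspace_diff[OF perp_subspace] unfolding h4_def m4_def by (auto simp: lie_mult_vec)

lemma lie_h4_m4: assumes V: "V \<in> MS" and d: "d \<in> h4 V" and e: "e \<in> m4 V" shows "lie d e \<in> m4 V"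
proof -
  have dV: "d *v x \<in> V" if "x \<in> V" for x using h4_preserves[OF V d that] .
  have dP: "d *v x \<in> perp V" if "x \<in> perp V" for x using d that by (simp add: h4_def)
  have eV: "e *v x \<in> perp V" if "x \<in> V" for x using e that by (simp add: m4_def)
  have eP: "e *v x \<in> V" if "x \<in> perp V" for x using e that by (simp add: m4_def)
  have "lie d e \<in> g2" using d e lie_g2 by (simp add: h4_def m4_def)
  then show ?thesis unfolding m4_def
    using subspace_diff[OF perp_subspace] subspace_diff[OF subspace_MS[OF V]] dV dP eV eP by (simp add: lie_mult_vec)
qed

lemma subspace_m4: assumes "V \<in> MS" shows "subspace (m4 V)"
proof (rule subspaceI)
  note V = subspace_MS[OF assms]
  show "0 \<in> m4 V" using subspace_0[OF subspace_g2] subspace_0[OF V] subspace_0[OF perp_subspace[of V]] by (simp add: m4_def)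
  show "x + y \<in> m4 V" if "x \<in> m4 V" "y \<in> m4 V" for x y
    using that by (simp add: m4_def matrix_vector_mult_add_rdistrib subspace_add[OF subspace_g2] subspace_add[OF V] subspace_add[OF perp_subspace])
  show "c *\<^sub>R x \<in> m4 V" if "x \<in> m4 V" for c x
    using that by (simp add: m4_def scaleR_mult_vec subspace_scale[OF subspace_g2] subspace_scale[OF V] subspace_scale[OF perp_subspace])
qed

lemma subspace_h4: "subspace (h4 V)"
proof (rule subspaceI)
  show "0 \<in> h4 V" using subspace_0[OF subspace_g2] subspace_0[OF perp_subspace[of V]] by (simp add: h4_def)
  show "x + y \<in> h4 V" if "x \<in> h4 V" "y \<in> h4 V" for x y
    using that by (simp add: h4_def matrix_vector_mult_add_rdistrib subspace_add[OF subspace_g2] subspace_add[OF perp_subspace])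
  show "c *\<^sub>R x \<in> h4 V" if "x \<in> h4 V" for c x
    using that by (simp add: h4_def scaleR_mult_vec subspace_scale[OF subspace_g2] subspace_scale[OF perp_subspace])
qed

lemma subspace_h2: "subspace (h2 u)"
proof (rule subspaceI)
  show "0 \<in> h2 u" using subspace_0[OF subspace_g2] by (simp add: h2_def)
  show "x + y \<in> h2 u" if "x \<in> h2 u" "y \<in> h2 u" for x y
    using that by (simp add: h2_def matrix_vector_mult_add_rdistrib subspace_add[OF subspace_g2])
  show "c *\<^sub>R x \<in> h2 u" if "x \<in> h2 u" for c x
    using that by (simp add: h2_def scaleR_mult_vec subspace_scale[OF subspace_g2])
qed

lemma lie_h4: "d \<in> h4 V \<Longrightarrow> e \<in> h4 V \<Longrightarrow> lie d e \<in> h4 V"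
  using lie_g2 subspace_diff[OF perp_subspace[of V]] unfolding h4_def by (simp add: lie_mult_vec)

lemma lie_h2: "d \<in> h2 u \<Longrightarrow> e \<in> h2 u \<Longrightarrow> lie d e \<in> h2 u"
  using lie_g2 unfolding h2_def by (simp add: lie_mult_vec)

lemma LTS_subalgebra_inter:
  assumes V: "V \<in> MS" and B: "subspace B" "\<And>x y. x \<in> B \<Longrightarrow> y \<in> B \<Longrightarrow> lie x y \<in> B"
  shows "LTS V (B \<inter> m4 V)"
  unfolding LTS_def using subspace_inter[OF B(1) subspace_m4[OF V]] B(2) lie_h4_m4[OF V lie_m4_m4[OF V]] by auto

section \<open>Principal subalgebras, invariant splittings and generation\<close>

lemma principal_nilp:
  assumes "principal_subalgebra h"
  obtains A B n z where "A \<in> h" "B \<in> h" "cmat A B \<in> g2C" "\<And>z. ((*v) (cmat A B) ^^ n) z = 0" "((*v) (cmat A B) ^^ 6) z \<noteq> 0"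
proof -
  obtain N where N: "N \<in> complexify h" "principal_nilpotent N" using assms by (auto simp: principal_subalgebra_def)
  then obtain A B where AB: "N = cmat A B" "A \<in> h" "B \<in> h" by (auto simp: complexify_cmat)
  have n: "nilpotent_elt N" using N by (simp add: principal_nilpotent_def)
  obtain k where k: "\<And>z. ((*v) N ^^ k) z = 0" using nilpotent_elt_vec[OF n] by blast
  obtain z where "((*v) N ^^ 6) z \<noteq> 0" using principal_nilpotent_pow6[OF N(2)] by blast
  then show ?thesis using that[OF AB(2,3), of k z] k n unfolding AB(1) nilpotent_elt_def by blast
qed

lemma cvec_smult: "c *s cvec x y = cvec (Re c *\<^sub>R x - Im c *\<^sub>R y) (Re c *\<^sub>R y + Im c *\<^sub>R x)"
  by (simp add: cvec_def vec_eq_iff complex_eq_iff)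

lemma cvec_add: "cvec x y + cvec x' y' = cvec (x + x') (y + y')"
  by (simp add: cvec_def vec_eq_iff complex_eq_iff)

lemma complex_subspace:
  assumes "subspace U"
  shows "vec.subspace {cvec x y | x y. x \<in> U \<and> y \<in> U}"
proof (rule vec.subspaceI)
  show "0 \<in> {cvec x y | x y. x \<in> U \<and> y \<in> U}" using subspace_0[OF assms] cvec_0[symmetric] by blast
next
  fix a b assume "a \<in> {cvec x y | x y. x \<in> U \<and> y \<in> U}" "b \<in> {cvec x y | x y. x \<in> U \<and> y \<in> U}"
  then obtain x y x' y' where "a = cvec x y" "x \<in> U" "y \<in> U" "b = cvec x' y'" "x' \<in> U" "y' \<in> U" by blast
  then show "a + b \<in> {cvec x y | x y. x \<in> U \<and> y \<in> U}"
    unfolding mem_Collect_eq by (intro exI[of _ "x + x'"] exI[of _ "y + y'"]) (simp add: cvec_add subspace_add assms)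
next
  fix c a assume "a \<in> {cvec x y | x y. x \<in> U \<and> y \<in> U}"
  then obtain x y where "a = cvec x y" "x \<in> U" "y \<in> U" by blast
  then show "c *s a \<in> {cvec x y | x y. x \<in> U \<and> y \<in> U}"
    unfolding mem_Collect_eq
    by (intro exI[of _ "Re c *\<^sub>R x - Im c *\<^sub>R y"] exI[of _ "Re c *\<^sub>R y + Im c *\<^sub>R x"])
      (simp add: cvec_smult subspace_diff subspace_add subspace_scale assms)
qed

lemma principal_no_invariant_splitting:
  assumes h: "principal_subalgebra h" and U: "subspace U" "U \<noteq> UNIV" and W: "subspace W" "W \<noteq> UNIV"
    and sum: "\<And>x. \<exists>a\<in>U. \<exists>b\<in>W. x = a + b"
    and inv: "\<And>d x. d \<in> h \<Longrightarrow> x \<in> U \<Longrightarrow> d *v x \<in> U" "\<And>d x. d \<in> h \<Longrightarrow> x \<in> W \<Longrightarrow> d *v x \<in> W"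
  shows False
proof -
  obtain A B n z where AB: "A \<in> h" "B \<in> h" and nil: "\<And>z. ((*v) (cmat A B) ^^ n) z = 0" and z: "((*v) (cmat A B) ^^ 6) z \<noteq> 0"
    using principal_nilp[OF h] by metis
  let ?C = "\<lambda>U. {cvec x y | x y. x \<in> U \<and> y \<in> U}"
  have invC: "cmat A B *v z \<in> ?C U" if sU: "subspace U" and iU: "\<And>d x. d \<in> h \<Longrightarrow> x \<in> U \<Longrightarrow> d *v x \<in> U" and zU: "z \<in> ?C U" for U z
  proof -
    obtain x y where "z = cvec x y" "x \<in> U" "y \<in> U" using zU by blast
    then show ?thesis unfolding mem_Collect_eq using sU iU AB
      by (intro exI[of _ "A *v x - B *v y"] exI[of _ "A *v y + B *v x"]) (simp add: cmat_mult_cvec subspace_diff subspace_add)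
  qed
  have properC: "?C U \<noteq> UNIV" if pU: "U \<noteq> UNIV" for U
  proof
    assume e: "?C U = UNIV"
    obtain x where "x \<notin> U" using pU by blast
    moreover have "cvec x 0 \<in> ?C U" unfolding e by simp
    then have "x \<in> U" by (auto simp: cvec_eq_iff)
    ultimately show False by blast
  qed
  have "((*v) (cmat A B) ^^ 6) z = 0"
  proof (rule nilpotent_reducible_pow6[OF nil complex_subspace[OF U(1)] invC[OF U(1) inv(1)] properC[OF U(2)]
        complex_subspace[OF W(1)] invC[OF W(1) inv(2)] properC[OF W(2)]])
    fix z :: "complex^7"
    obtain x y where z: "z = cvec x y" using cvec_exists by blast
    obtain a b a' b' where "a \<in> U" "b \<in> W" "x = a + b" "a' \<in> U" "b' \<in> W" "y = a' + b'" using sum by metis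
    then have "z = cvec a a' + cvec b b'" "cvec a a' \<in> ?C U" "cvec b b' \<in> ?C W" unfolding z cvec_add by blast+
    then show "\<exists>a\<in>?C U. \<exists>b\<in>?C W. z = a + b" by blast
  qed
  then show False using z by blast
qed

lemma principal_not_sub_h4:
  assumes h: "principal_subalgebra h" and W: "W \<in> MS"
  shows "\<not> h \<subseteq> h4 W"
proof
  assume s: "h \<subseteq> h4 W"
  obtain u where u: "u \<in> W" "dot7 u u = 1" using MS_unit_exists[OF W] by blast
  obtain l where l: "l \<in> perp W" "dot7 l l = 1" using MS_frame_exists[OF W u] by blast
  have "l \<notin> W"
  proof
    assume "l \<in> W"
    then have "inner l l = 0" using l(1) unfolding perp_def by blast
    then show False using l(2) by (simp add: inner_eq_dot7)
  qed
  then have 1: "W \<noteq> UNIV" by blast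
  have "u \<notin> perp W"
  proof
    assume "u \<in> perp W"
    then have "inner u u = 0" using u(1) unfolding perp_def by blast
    then show False using u(2) by (simp add: inner_eq_dot7)
  qed
  then have 2: "perp W \<noteq> UNIV" by blast
  show False
  proof (rule principal_no_invariant_splitting[OF h subspace_MS[OF W] 1 perp_subspace 2])
    show "\<exists>a\<in>W. \<exists>b\<in>perp W. x = a + b" for x using MS_decompose[OF W] by metis
    show "d *v x \<in> W" if "d \<in> h" "x \<in> W" for d x using h4_preserves[OF W] s that by blast
    show "d *v x \<in> perp W" if "d \<in> h" "x \<in> perp W" for d x using s that by (auto simp: h4_def)
  qed
qed

lemma principal_not_sub_h2:
  assumes h: "principal_subalgebra h" and u: "u \<noteq> 0"
  shows "\<not> h \<subseteq> h2 u"
proof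
  assume s: "h \<subseteq> h2 u"
  have uu: "dot7 u u \<noteq> 0" using u by (simp add: inner_eq_dot7[symmetric])
  let ?U = "range (\<lambda>r. r *s u)" and ?W = "{x. dot7 u x = 0}"
  obtain c where c: "c \<noteq> 0" "dot7 c u = 0" using exists_orthogonal_triple by metis
  have "c \<notin> ?U"
  proof
    assume "c \<in> ?U"
    then obtain r where r: "c = r *s u" by blast
    then have "r * dot7 u u = 0" using c by (simp add: dot7_smult_left)
    then show False using r c uu by simp
  qed
  then have 1: "?U \<noteq> UNIV" by blast
  have 2: "?W \<noteq> UNIV" using uu by blast
  have sU: "subspace ?U"
    unfolding scalar_mult_eq_scaleR by (metis span_singleton subspace_span)
  have sW: "subspace ?W" by (simp add: subspace_def dot7_0_right dot7_add_right dot7_smult_right flip: scalar_mult_eq_scaleR)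
  show False
  proof (rule principal_no_invariant_splitting[OF h sU 1 sW 2])
    show "\<exists>a\<in>?U. \<exists>b\<in>?W. x = a + b" for x
      by (rule bexI[of _ "(dot7 u x / dot7 u u) *s u"], rule bexI[of _ "x - (dot7 u x / dot7 u u) *s u"])
        (use uu in \<open>auto simp: dot7_diff_right dot7_smult_right\<close>)
    show "d *v x \<in> ?U" if "d \<in> h" "x \<in> ?U" for d x
    proof -
      have "d *v x = 0 *s u" using that s by (auto simp: h2_def vector_scalar_commute)
      then show ?thesis by blast
    qed
    show "d *v x \<in> ?W" if "d \<in> h" "x \<in> ?W" for d x
    proof -
      have "der7 d" "d *v u = 0" using s that by (auto simp: h2_def g2_iff_der7)
      then show ?thesis using der7_skew_vec[of d u x] by (simp add: dot7_0_left)
    qed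
  qed
qed

text \<open>The span of \<open>P = h \<inter> m4 V\<close> and its brackets is an ideal of the
  simple algebra \<open>h\<close>. It is not zero, as otherwise \<open>h\<close> would preserve the
  splitting by \<open>V\<close>; so \<open>P\<close> generates \<open>h\<close>. Inclusions of
  triple subsystems thereby become inclusions of subalgebras.\<close>

lemma principal_generated:
  assumes V: "V \<in> MS" and h: "principal_subalgebra h" "adapted h V"
    and B: "subspace B" "\<And>x y. x \<in> B \<Longrightarrow> y \<in> B \<Longrightarrow> lie x y \<in> B" "h \<inter> m4 V \<subseteq> B"
  shows "h \<subseteq> B"
proof -
  have sh: "subspace h" "\<And>x y. x \<in> h \<Longrightarrow> y \<in> h \<Longrightarrow> lie x y \<in> h" and sl: "simple_lie h"
    using h(1) by (auto simp: principal_subalgebra_def subalgebra_def)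
  define P G where "P = h \<inter> m4 V" and "G = P \<union> {lie a b | a b. a \<in> P \<and> b \<in> P}"
  define I where "I = span G"
  have kP: "lie k a \<in> P" if "k \<in> h" "k \<in> h4 V" "a \<in> P" for k a
    using that sh lie_h4_m4[OF V] by (auto simp: P_def)
  have GB: "G \<subseteq> B" using B by (auto simp: G_def P_def)
  have Gh: "G \<subseteq> h" using sh by (auto simp: G_def P_def)
  have IB: "I \<subseteq> B" unfolding I_def by (rule span_minimal[OF GB B(1)])
  have Ih: "I \<subseteq> h" unfolding I_def by (rule span_minimal[OF Gh sh(1)])
  have ideal: "lie x y \<in> I" if x: "x \<in> h" and y: "y \<in> I" for x y
  proof -
    obtain k p where kp: "x = k + p" "k \<in> h" "k \<in> h4 V" "p \<in> P"
      using h(2) x unfolding adapted_def P_def by blast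
    have gen: "lie x y \<in> I" if yG: "y \<in> G" for y
    proof -
      consider "y \<in> P" | a b where "y = lie a b" "a \<in> P" "b \<in> P" using yG unfolding G_def by blast
      then show ?thesis
      proof cases
        case 1
        have "lie k y \<in> G" "lie p y \<in> G" using kP kp 1 by (auto simp: G_def)
        then show ?thesis unfolding kp(1) lie_add_left I_def by (intro span_add span_base)
      next
        case 2
        have "lie k (lie a b) = lie (lie k a) b + lie a (lie k b)"
          using lie_jacobi[of a b k] lie_anticomm[of k "lie a b"] lie_anticomm[of k a] lie_anticomm[of a "lie k b"] lie_anticomm[of k b]
          by (simp add: lie_def matrix_mult_diff_left matrix_mult_diff_right matrix_mul_assoc)
        moreover have "lie (lie k a) b \<in> G" "lie a (lie k b) \<in> G" using kP kp 2 by (auto simp: G_def)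
        moreover have "lie p (lie a b) \<in> P"
        proof -
          have "lie a b \<in> h4 V" "lie a b \<in> h" using 2 lie_m4_m4[OF V] sh by (auto simp: P_def)
          then have "lie (lie a b) p \<in> P" using kP kp by blast
          then show ?thesis using lie_anticomm[of p "lie a b"] subspace_neg[OF sh(1)] subspace_neg[OF subspace_m4[OF V]] by (simp add: P_def)
        qed
        then have "lie p (lie a b) \<in> G" by (simp add: G_def)
        ultimately show ?thesis unfolding kp(1) lie_add_left I_def 2(1) by (metis span_add span_base)
      qed
    qed
    have "lie x ` span G \<subseteq> I" unfolding linear_span_image[OF linear_lie, symmetric]
      by (rule span_minimal) (use gen in \<open>auto simp: I_def\<close>)
    then show ?thesis using y by (auto simp: I_def)
  qed
  have "I = {0} \<or> I = h" using sl ideal Ih unfolding simple_lie_def I_def by (metis subspace_span)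
  then show ?thesis
  proof
    assume "I = h" then show ?thesis using IB by blast
  next
    assume I0: "I = {0}"
    have "P \<subseteq> {0}" using span_superset[of G] I0 by (auto simp: I_def G_def)
    then have "h \<subseteq> h4 V" using h(2) unfolding adapted_def P_def by force
    then show ?thesis using principal_not_sub_h4[OF h(1) V] by blast
  qed
qed

section \<open>A principal subalgebra adapted to \<open>V0\<close>\<close>

locale so3_triple =
  fixes H x y :: "real^7^7" and k :: real
  assumes g2: "H \<in> g2" "x \<in> g2" "y \<in> g2"
    and br: "lie H x = y" "lie H y = - x" "lie x y = k *\<^sub>R H" and k: "k \<noteq> 0"
    and indep: "\<And>a b c. a *\<^sub>R H + b *\<^sub>R x + c *\<^sub>R y = 0 \<Longrightarrow> a = 0 \<and> b = 0 \<and> c = 0"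
begin

definition "f = (\<lambda>(a, b, c). a *\<^sub>R H + b *\<^sub>R x + c *\<^sub>R y)"

lemma linear_f: "linear f"
  by (rule linearI) (auto simp: f_def algebra_simps)

lemma f_simps: "a *\<^sub>R H + b *\<^sub>R x + c *\<^sub>R y = f (a, b, c)"
  by (simp add: f_def)

lemma lie_f: "lie (f (a, b, c)) (f (a', b', c')) = f (k * (b * c' - c * b'), c * a' - a * c', a * b' - b * a')"
proof -
  have "lie x H = - y" "lie y H = x" "lie y x = - (k *\<^sub>R H)" using br lie_anticomm[of x H] lie_anticomm[of y H] lie_anticomm[of y x] by simp_all
  moreover have "lie z z = 0" for z :: "real^7^7" by (simp add: lie_def)
  ultimately show ?thesis
    by (simp add: f_def lie_add_left lie_add_right lie_scaleR_left lie_scaleR_right br) (simp add: algebra_simps)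
qed

lemma subalgebra_f: "subalgebra (range f)"
  unfolding subalgebra_def
proof (intro conjI ballI)
  show "subspace (range f)" by (rule linear_subspace_image[OF linear_f]) simp
  show "range f \<subseteq> g2"
    using g2 by (auto simp: f_def intro!: subspace_add[OF subspace_g2] subspace_scale[OF subspace_g2])
  fix u v assume "u \<in> range f" "v \<in> range f"
  then show "lie u v \<in> range f" by (auto simp: lie_f)
qed

lemma dim_f: "dim (range f) = 3"
proof -
  have "inj f"
    unfolding linear_injective_0[OF linear_f] using indep by (auto simp: f_def zero_prod_def)
  then have "dim (range f) = dim (UNIV :: (real \<times> real \<times> real) set)"
    by (intro dim_image_eq[OF linear_f]) (auto intro: inj_on_subset)
  then show ?thesis by simp
qed

lemma simple_f: "simple_lie (range f)"
  unfolding simple_lie_def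
proof (intro conjI allI impI)
  have e: "H = f (1, 0, 0)" "x = f (0, 1, 0)" "y = f (0, 0, 1)" by (simp_all add: f_def)
  have "y \<noteq> 0" using indep[of 0 0 1] by auto
  then show "\<exists>u\<in>range f. \<exists>v\<in>range f. lie u v \<noteq> 0" using br(1) e by (metis rangeI)
  fix I assume I: "subspace I \<and> I \<subseteq> range f \<and> (\<forall>u\<in>range f. \<forall>v\<in>I. lie u v \<in> I)"
  have sI: "subspace I" and id: "\<And>u v. u \<in> range f \<Longrightarrow> v \<in> I \<Longrightarrow> lie u v \<in> I" and sub: "I \<subseteq> range f" using I by auto
  have fs: "f (r * a, r * b, r * c) = r *\<^sub>R f (a, b, c)" for r a b c by (simp add: f_def algebra_simps)
  have full: "I = range f" if H: "H \<in> I"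
  proof -
    have "lie x H \<in> I" "lie y H \<in> I" using id e H by (metis rangeI)+
    then have "f (0, 0, -1) \<in> I" "f (0, 1, 0) \<in> I" using lie_f[of 0 1 0 1 0 0] lie_f[of 0 0 1 1 0 0] e by simp_all
    then have "f (0, 0, 1) \<in> I" "f (0, 1, 0) \<in> I" using subspace_scale[OF sI, of "f (0,0,-1)" "-1"] fs[of "-1" 0 0 "-1"] by simp_all
    then have "x \<in> I" "y \<in> I" using e by simp_all
    then have "f (a, b, c) \<in> I" for a b c using H unfolding f_simps[symmetric] by (intro subspace_add[OF sI] subspace_scale[OF sI])
    then show ?thesis using sub by auto
  qed
  have Hmult: "H \<in> I" if "f (r, 0, 0) \<in> I" "r \<noteq> 0" for r
    using subspace_scale[OF sI that(1), of "1/r"] that(2) fs[of "1/r" r 0 0] e by simp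
  show "I = {0} \<or> I = range f"
  proof (cases "I \<subseteq> {0}")
    case True then show ?thesis using subspace_0[OF sI] by blast
  next
    case False
    then obtain a b c where w: "f (a, b, c) \<in> I" "f (a, b, c) \<noteq> 0" using sub by (metis (no_types, opaque_lifting) insertI1 prod_cases3 rangeE subset_iff)
    have i: "lie (f t) v \<in> I" if "v \<in> I" for t v using id that by blast
    show ?thesis
    proof (cases "a = 0")
      case False
      \<comment> \<open>Adding the double bracket with \<open>H\<close> to an element leaves its
        \<open>H\<close> component; once \<open>H\<close> is in the ideal, everything is.\<close>
      have "lie (f (1,0,0)) (lie (f (1,0,0)) (f (a, b, c))) \<in> I" using i w by blast
      then have "f (0, -b, -c) \<in> I" by (simp add: lie_f)
      then have "f (a, b, c) + f (0, -b, -c) \<in> I" using w subspace_add[OF sI] by blast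
      then have "f (a, 0, 0) \<in> I" by (simp add: f_def algebra_simps)
      then show ?thesis using Hmult full False by blast
    next
      case True
      have "lie (f (0,1,0)) (f (a, b, c)) \<in> I" "lie (f (0,0,1)) (f (a, b, c)) \<in> I" using i w by blast+
      then have "f (k * c, 0, 0) \<in> I" "f (k * (- b), 0, 0) \<in> I" using True by (simp_all add: lie_f)
      moreover have "b \<noteq> 0 \<or> c \<noteq> 0" using w True by (auto simp: f_def)
      ultimately show ?thesis using Hmult full k by (metis mult_eq_0_iff neg_equal_0_iff_equal)
    qed
  qed
qed

end

text \<open>Both roots involved are 1 or -1 on \<open>H = D2 1 2\<close>, so
  \<open>[H, [H, x]] = - x\<close> and \<open>H\<close>, \<open>x\<close>, \<open>[H, x]\<close>
  close up to a rescaled so(3), with \<open>[H, x]\<close> in \<open>h4 V0\<close>.\<close>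

lemma principal_std:
  assumes c: "c\<^sup>2 = 3/5"
  obtains h where "principal_subalgebra h" "adapted h V0" "h \<inter> m4 V0 = std_family1 c"
proof -
  define x where "x = M8 0 0 c 0 0 0 0 1"
  define y where "y = lie (D2 1 2) x"
  have c0: "c \<noteq> 0" using c by auto
  have cc: "c * c = 3/5" using c by (simp add: power2_eq_square)
  have yG: "y = - G14 0 0 0 0 0 0 0 c 0 0 (- 2 * c) 0 (- 1) 0"
    unfolding y_def x_def lie_anticomm[of "D2 1 2"] lie_M8_D2 by simp
  have y64: "y $ 6 $ 4 = 1" unfolding yG G14_def by simp
  have Hm: "D2 1 2 \<in> m4 V0" and xm: "x \<in> m4 V0" unfolding x_def by (rule M8_in_m4)+
  have yh: "y \<in> h4 V0" unfolding y_def by (rule lie_m4_m4[OF V0_MS Hm xm])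
  interpret so3_triple "D2 1 2" x y "2/5"
  proof
    show "D2 1 2 \<in> g2" "x \<in> g2" "y \<in> g2" using Hm xm yh by (auto simp: m4_def h4_def)
    show "lie (D2 1 2) x = y" by (simp add: y_def)
    have "lie y (D2 1 2) = x" unfolding y_def x_def lie_lie_D2 by simp
    then show "lie (D2 1 2) y = - x" using lie_anticomm[of "D2 1 2" y] by simp
    have "lie x y = lie (lie x (D2 1 2)) x"
      unfolding y_def using lie_anticomm[of x "lie (D2 1 2) x"] lie_anticomm[of "D2 1 2" x] lie_scaleR_left[of "-1"] by simp
    \<comment> \<open>Here \<open>c^2 = 3/5\<close> enters: the diagonal coordinates are
      \<open>4 * c^2 - 2 = 2/5\<close> and \<open>2 - 2 * c^2 = 4/5\<close>.\<close>
    also have "\<dots> = (2/5) *\<^sub>R D2 1 2" unfolding x_def lie_lie_M8 M8_scaleR M8_eq_iff by (simp add: cc)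
    finally show "lie x y = (2/5) *\<^sub>R D2 1 2" .
    fix a b c' assume "a *\<^sub>R D2 1 2 + b *\<^sub>R x + c' *\<^sub>R y = 0"
    then have z: "(a *\<^sub>R D2 1 2 + b *\<^sub>R x + c' *\<^sub>R y) $ i $ j = 0" for i j by simp
    show "a = 0 \<and> b = 0 \<and> c' = 0"
      using z[of 6 0] z[of 4 0] z[of 6 4] unfolding yG x_def M8_def G14_def by simp
  qed simp
  have fe: "f (a, b, d) = a *\<^sub>R D2 1 2 + b *\<^sub>R x + d *\<^sub>R y" for a b d
    by (simp add: f_def)
  have part: "f (a, b, 0) = M8 a (2 * a) (c * b) 0 0 0 0 b" for a b
    unfolding fe unfolding x_def by (simp add: M8_scaleR M8_add mult.commute)
  have m: "range f \<inter> m4 V0 = std_family1 c"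
  proof (intro equalityI subsetI)
    fix u assume "u \<in> range f \<inter> m4 V0"
    then obtain a b d where u: "u = f (a, b, d)" "u \<in> m4 V0" by auto
    have "u $ 6 $ 4 = 0" using u(2) m4_V0 by (auto simp: M8_def)
    moreover have "u $ 6 $ 4 = d" unfolding u(1) fe using y64 by (simp add: x_def M8_def)
    ultimately have "u = M8 a (2 * a) (c * b) 0 0 0 0 b" using u(1) part by simp
    then show "u \<in> std_family1 c" unfolding std_family1_def by blast
  next
    fix u assume "u \<in> std_family1 c"
    then obtain a b where "u = M8 a (2*a) (c*b) 0 0 0 0 b" unfolding std_family1_def by blast
    then show "u \<in> range f \<inter> m4 V0" using part M8_in_m4 by (metis IntI rangeI)
  qed
  have sf: "subspace (range f)" using subalgebra_f by (simp add: subalgebra_def)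
  have ad: "adapted (range f) V0"
    unfolding adapted_def
  proof (intro equalityI subsetI)
    fix u assume "u \<in> range f"
    then obtain a b d where u: "u = f (a, b, d)" by auto
    have "u = f (0, 0, d) + f (a, b, 0)" unfolding u fe by simp
    moreover have "f (0, 0, d) \<in> h4 V0" using yh by (simp add: fe subspace_scale[OF subspace_h4])
    moreover have "f (a, b, 0) \<in> m4 V0" unfolding part by (rule M8_in_m4)
    ultimately show "u \<in> {a + b | a b. a \<in> range f \<inter> h4 V0 \<and> b \<in> range f \<inter> m4 V0}" by blast
  next
    fix u assume "u \<in> {a + b | a b. a \<in> range f \<inter> h4 V0 \<and> b \<in> range f \<inter> m4 V0}"
    then show "u \<in> range f" using subspace_add[OF sf] by blast
  qed
  \<comment> \<open>x + i y is an eigenvector of ad H for -i, and its simple root coordinates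
    \<open>c\<close> and 1 are nonzero; so it is principal.\<close>
  have N: "cmat x y = XX (of_real c) 1 0 0 0 0"
    unfolding yG x_def M8_def XX_def G14_def cmat_def by (simp add: vec_eq_7 complex_eq_iff)
  have "cmat x y \<in> complexify (range f)"
  proof -
    have "x = f (0, 1, 0)" "y = f (0, 0, 1)" by (simp_all add: fe)
    then have "x \<in> range f" "y \<in> range f" by (metis rangeI)+
    then show ?thesis unfolding complexify_cmat by blast
  qed
  then have "principal_subalgebra (range f)"
    unfolding principal_subalgebra_def
    using subalgebra_f dim_f simple_f principal_nilpotent_XX[of "of_real c" 1, folded N] c0 by (simp add: bexI[of _ "cmat x y"])
  then show ?thesis using that ad m by blast
qed

section \<open>Transport of principal subalgebras along real automorphisms\<close>

lemma funpow_conj7: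
  fixes g :: "'a::field^7^7"
  assumes g: "aut7 g"
  shows "((lie (conj7 g N)) ^^ k) (conj7 g Y) = conj7 g (((lie N) ^^ k) Y)"
  by (induction k) (simp_all add: conj7_lie[OF g])

lemma principal_nilpotent_conj7:
  assumes g: "aut7 g" and N: "principal_nilpotent N"
  shows "principal_nilpotent (conj7 (cmat g 0) N)"
proof -
  have gC: "aut7 (cmat g 0)" by (rule aut7_cmat[OF g])
  have tr: "transpose (cmat g 0) = cmat (transpose g) 0" by (simp add: transpose_cmat transpose_def vec_eq_iff cmat_def)
  obtain k where NG: "N \<in> g2C" and k: "\<And>Y. Y \<in> g2C \<Longrightarrow> ((lie N) ^^ k) Y = 0"
    using N by (auto simp: principal_nilpotent_def nilpotent_elt_def)
  have "((lie (conj7 (cmat g 0) N)) ^^ k) Y = 0" if Y: "Y \<in> g2C" for Y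
  proof -
    have "conj7 (transpose (cmat g 0)) Y \<in> g2C" unfolding tr by (rule cmat_g2C_conj7[OF aut7_transpose[OF g] Y])
    from k[OF this] have "((lie (conj7 (cmat g 0) N)) ^^ k) (conj7 (cmat g 0) (conj7 (transpose (cmat g 0)) Y)) = 0"
      unfolding funpow_conj7[OF gC] by (simp add: conj7_def)
    then show ?thesis by (simp add: conj7_transpose[OF gC])
  qed
  then have "nilpotent_elt (conj7 (cmat g 0) N)" unfolding nilpotent_elt_def using cmat_g2C_conj7[OF g NG] by blast
  moreover have "adj_orbit (conj7 (cmat g 0) N) = adj_orbit N"
    unfolding set_eq_iff adj_orbit_iff
    using sim7_trans[OF sim7_conj7[OF gC, of N]] sim7_trans[OF sim7_sym[OF sim7_conj7[OF gC, of N]]] by blast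
  ultimately show ?thesis using N by (simp add: principal_nilpotent_def)
qed

lemma principal_subalgebra_conj7:
  assumes g: "aut7 g" and h: "principal_subalgebra h"
  shows "principal_subalgebra (conj7 g ` h)"
proof -
  have sh: "subspace h" "h \<subseteq> g2" "\<And>x y. x \<in> h \<Longrightarrow> y \<in> h \<Longrightarrow> lie x y \<in> h" "dim h = 3" and sl: "simple_lie h"
    using h by (auto simp: principal_subalgebra_def subalgebra_def)
  have sub: "subalgebra (conj7 g ` h)" unfolding subalgebra_def
    using linear_subspace_image[OF linear_conj7 sh(1)] sh(2,3) by (auto simp: g2_iff_der7 der7_conj7[OF g] conj7_lie[OF g])
  have simple: "simple_lie (conj7 g ` h)" unfolding simple_lie_def
  proof (intro conjI allI impI)
    obtain u v where uv: "u \<in> h" "v \<in> h" "lie u v \<noteq> 0" using sl by (auto simp: simple_lie_def)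
    have "conj7 g (lie u v) \<noteq> 0" using uv conj7_transpose(2)[OF g, of "lie u v"] by (auto simp: conj7_def)
    then show "\<exists>u\<in>conj7 g ` h. \<exists>v\<in>conj7 g ` h. lie u v \<noteq> 0" using uv by (auto simp: conj7_lie[OF g])
    fix I assume I: "subspace I \<and> I \<subseteq> conj7 g ` h \<and> (\<forall>u\<in>conj7 g ` h. \<forall>v\<in>I. lie u v \<in> I)"
    define J where "J = conj7 (transpose g) ` I"
    have IJ: "I = conj7 g ` J" by (simp add: J_def image_image conj7_transpose[OF g])
    have "subspace J" unfolding J_def using I linear_subspace_image[OF linear_conj7] by blast
    moreover have "J \<subseteq> h" unfolding J_def using I by (auto simp: conj7_transpose[OF g] dest!: subsetD)
    moreover have "lie u v \<in> J" if "u \<in> h" "v \<in> J" for u v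
    proof -
      have "lie (conj7 g u) (conj7 g v) \<in> I" using I that unfolding IJ by blast
      then have "conj7 g (lie u v) \<in> I" by (simp add: conj7_lie[OF g])
      then show ?thesis unfolding J_def using conj7_transpose(2)[OF g, of "lie u v"] by (metis image_eqI)
    qed
    ultimately have "J = {0} \<or> J = h" using sl unfolding simple_lie_def by blast
    then show "I = {0} \<or> I = conj7 g ` h" unfolding IJ by (auto simp: conj7_def)
  qed
  obtain N where N: "N \<in> complexify h" "principal_nilpotent N" using h by (auto simp: principal_subalgebra_def)
  then obtain A B where AB: "N = cmat A B" "A \<in> h" "B \<in> h" by (auto simp: complexify_cmat)
  have "conj7 (cmat g 0) N \<in> complexify (conj7 g ` h)" unfolding AB(1) conj7_cmat complexify_cmat using AB by blast
  then show ?thesis unfolding principal_subalgebra_def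
    using sub simple principal_nilpotent_conj7[OF g N(2)] by (auto simp: dim_conj7[OF g] sh(4))
qed

lemma adapted_conj7:
  assumes g: "aut7 g" and h: "adapted h V"
  shows "adapted (conj7 g ` h) (img g V)"
  unfolding adapted_def
proof (intro equalityI subsetI)
  have add: "conj7 g (a + b) = conj7 g a + conj7 g b" for a b by (rule linear_add[OF linear_conj7])
  fix u assume "u \<in> conj7 g ` h"
  then obtain w where w: "w \<in> h" "u = conj7 g w" by blast
  obtain a b where "w = a + b" "a \<in> h \<inter> h4 V" "b \<in> h \<inter> m4 V"
    using equalityD1[OF h[unfolded adapted_def]] w(1) by blast
  then have "u = conj7 g a + conj7 g b" "conj7 g a \<in> conj7 g ` h \<inter> h4 (img g V)" "conj7 g b \<in> conj7 g ` h \<inter> m4 (img g V)"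
    using w(2) by (simp_all add: add conj7_h4[OF g] conj7_m4[OF g])
  then show "u \<in> {a + b | a b. a \<in> conj7 g ` h \<inter> h4 (img g V) \<and> b \<in> conj7 g ` h \<inter> m4 (img g V)}" by blast
next
  have add: "conj7 g (a + b) = conj7 g a + conj7 g b" for a b by (rule linear_add[OF linear_conj7])
  fix u assume "u \<in> {a + b | a b. a \<in> conj7 g ` h \<inter> h4 (img g V) \<and> b \<in> conj7 g ` h \<inter> m4 (img g V)}"
  then obtain a b where u: "u = a + b" "a \<in> conj7 g ` h" "a \<in> h4 (img g V)" "b \<in> conj7 g ` h" "b \<in> m4 (img g V)" by blast
  obtain a' b' where ab: "a = conj7 g a'" "a' \<in> h" "b = conj7 g b'" "b' \<in> h" using u by blast
  then have "a' \<in> h4 V" "b' \<in> m4 V" using u conj7_h4[OF g] conj7_m4[OF g] by simp_all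
  then have "a' + b' \<in> h" using ab equalityD2[OF h[unfolded adapted_def]] by blast
  then show "u \<in> conj7 g ` h" unfolding u(1) ab(1,3) add[symmetric] by blast
qed

section \<open>Classification\<close>

lemma dim_m4:
  assumes "V \<in> MS"
  shows "dim (m4 V) = 8"
proof -
  obtain g where fg: "framed V g" using MS_framed[OF assms] by blast
  then have g: "aut7 g" "img g V0 = V" by (auto simp: framed_def)
  define f where "f = (\<lambda>(s, t, p1, q1, p2, q2, p3, q3). M8 s t p1 q1 p2 q2 p3 q3)"
  have "linear f" by (rule linearI) (auto simp: f_def M8_add M8_scaleR)
  moreover have "inj f" by (rule injI) (auto simp: f_def M8_eq_iff)
  ultimately have "dim (range f) = dim (UNIV :: (real \<times> real \<times> real \<times> real \<times> real \<times> real \<times> real \<times> real) set)"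
    by (intro dim_image_eq) (auto intro: inj_on_subset)
  moreover have "range f = m4 V0"
  proof (intro equalityI subsetI)
    fix d assume "d \<in> m4 V0"
    then obtain s t p1 q1 p2 q2 p3 q3 where "d = f (s, t, p1, q1, p2, q2, p3, q3)" unfolding m4_V0 f_def by auto
    then show "d \<in> range f" by blast
  qed (auto simp: f_def M8_in_m4)
  moreover have "conj7 g ` m4 V0 = m4 V" using conj7_image_eq[OF g(1) conj7_m4[OF g(1)]] g(2) by metis
  ultimately show ?thesis using dim_conj7[OF g(1), of "m4 V0"] by simp
qed

definition family1 :: "(real^7) set \<Rightarrow> (real^7^7) set set" where
  "family1 V = {h \<inter> m4 V | h. principal_subalgebra h \<and> adapted h V}"
definition family2 :: "(real^7) set \<Rightarrow> (real^7^7) set set" where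
  "family2 V = {h2 l \<inter> m4 V | l. l \<noteq> 0 \<and> l \<in> perp V}"
definition family3 :: "(real^7) set \<Rightarrow> (real^7^7) set set" where
  "family3 V = {h2 u \<inter> m4 V | u. u \<noteq> 0 \<and> u \<in> V}"
definition family4 :: "(real^7) set \<Rightarrow> (real^7^7) set set" where
  "family4 V = {h4 W \<inter> m4 V | W. W \<in> MS \<and> W \<inter> V \<noteq> {0} \<and> W \<inter> perp V \<noteq> {0}}"

lemma pull_h2: "aut7 g \<Longrightarrow> conj7 (transpose g) x \<in> h2 u \<Longrightarrow> x \<in> h2 (g *v u)"
  using conj7_h2[of g "conj7 (transpose g) x" u] by (simp add: conj7_transpose)

lemma pull_h4: "aut7 g \<Longrightarrow> conj7 (transpose g) x \<in> h4 W \<Longrightarrow> x \<in> h4 (img g W)"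
  using conj7_h4[of g "conj7 (transpose g) x" W] by (simp add: conj7_transpose)

lemma aut7_nonzero:
  assumes "aut7 (g::real^7^7)" "x \<noteq> 0"
  shows "g *v x \<noteq> 0"
  using assms aut7_inverse_vec(1)[of g x] by auto

lemma family4_of_frame:
  assumes f: "framed V g" and I: "coord7 I \<in> MS" "axis i 1 \<in> V0" "i \<in> I" "2 \<in> I"
  shows "h4 (img g (coord7 I)) \<inter> m4 V \<in> family4 V"
proof -
  have g: "aut7 g" "img g V0 = V" using f by (auto simp: framed_def)
  have i: "axis i (1::real) \<in> coord7 I" "axis 2 (1::real) \<in> coord7 I" using I by (auto simp: coord7_def axis_def)
  have nz: "axis j (1::real) \<noteq> 0" for j :: 7 by (simp add: axis_eq_0_iff)
  have "g *v axis i 1 \<in> img g (coord7 I) \<inter> V" "g *v axis i 1 \<noteq> 0" using i I(2) g(2) aut7_nonzero[OF g(1) nz] by blast+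
  moreover have "g *v axis 2 1 \<in> img g (coord7 I) \<inter> perp V" "g *v axis 2 1 \<noteq> 0"
    using i framed_perp(1)[OF f] aut7_nonzero[OF g(1) nz] by blast+
  ultimately show ?thesis unfolding family4_def using MS_img[OF g(1) I(1)] by blast
qed

lemma lts_in_family:
  assumes V: "V \<in> MS" and S: "LTS V S" and ne: "S \<noteq> m4 V"
  obtains M where "M \<in> family1 V \<union> family2 V \<union> family3 V \<union> family4 V" "S \<subseteq> M"
proof -
  obtain g where f: "framed V g" and c: "lts_conclusion (pull g S)" using lts_reduction[OF assms] by blast
  have g: "aut7 g" "img g V0 = V" using f by (auto simp: framed_def)
  have Sm: "x \<in> m4 V" if "x \<in> S" for x using S that by (auto simp: LTS_def)
  have axV: "axis 0 1 \<in> V0" "axis 1 1 \<in> V0" "axis 3 1 \<in> V0" by (simp_all add: V0_def axis_v7)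
  have nz: "axis j (1::real) \<noteq> 0" for j :: 7 by (simp add: axis_eq_0_iff)
  have h2: "\<exists>M\<in>family1 V \<union> family2 V \<union> family3 V \<union> family4 V. S \<subseteq> M"
    if k: "\<And>x. x \<in> S \<Longrightarrow> x \<in> h2 l" and l: "l \<noteq> 0" "l \<in> V \<or> l \<in> perp V" for l
  proof -
    have "h2 l \<inter> m4 V \<in> family2 V \<union> family3 V" using l unfolding family2_def family3_def by blast
    moreover have "S \<subseteq> h2 l \<inter> m4 V" using k Sm by blast
    ultimately show ?thesis by blast
  qed
  have h4: "\<exists>M\<in>family1 V \<union> family2 V \<union> family3 V \<union> family4 V. S \<subseteq> M"
    if k: "pull g S \<subseteq> h4 (coord7 I) \<inter> m4 V0" and I: "coord7 I \<in> MS" "axis i 1 \<in> V0" "i \<in> I" "2 \<in> I" for i I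
  proof -
    have "S \<subseteq> h4 (img g (coord7 I)) \<inter> m4 V" using k pull_h4[OF g(1)] Sm by blast
    then show ?thesis using family4_of_frame[OF f I] by blast
  qed
  have "\<exists>M\<in>family1 V \<union> family2 V \<union> family3 V \<union> family4 V. S \<subseteq> M"
    using c unfolding lts_conclusion_def
  proof (elim disjE)
    assume a: "pull g S \<subseteq> std_family2"
    have "x \<in> h2 (g *v axis 2 1)" if "x \<in> S" for x using a that unfolding std_family2_eq by (intro pull_h2[OF g(1)]) blast
    then show ?thesis using h2 aut7_nonzero[OF g(1) nz] framed_perp(1)[OF f] by blast
  next
    assume a: "pull g S \<subseteq> std_family3"
    have "x \<in> h2 (g *v axis 0 1)" if "x \<in> S" for x using a that unfolding std_family3_eq by (intro pull_h2[OF g(1)]) blast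
    then show ?thesis using h2 aut7_nonzero[OF g(1) nz] framed_perp(2)[OF f] by blast
  next
    assume "pull g S \<subseteq> std_family4a"
    then show ?thesis unfolding std_family4a_eq by (rule h4[OF _ coord7_MS(1) axV(1)]) auto
  next
    assume "pull g S \<subseteq> std_family4b"
    then show ?thesis using std_family4b_sub by (intro h4[OF _ coord7_MS(2) axV(2)]) auto
  next
    assume "pull g S \<subseteq> std_family4c"
    then show ?thesis using std_family4c_sub by (intro h4[OF _ coord7_MS(3) axV(3)]) auto
  next
    assume "\<exists>c. c\<^sup>2 = 3/5 \<and> pull g S \<subseteq> std_family1 c"
    then obtain c :: real where c: "c\<^sup>2 = 3/5" and a: "pull g S \<subseteq> std_family1 c" by blast
    obtain h where h: "principal_subalgebra h" "adapted h V0" "h \<inter> m4 V0 = std_family1 c" using principal_std[OF c] by blast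
    have "adapted (conj7 g ` h) V" using adapted_conj7[OF g(1) h(2)] unfolding g(2) .
    then have "conj7 g ` h \<inter> m4 V \<in> family1 V" unfolding family1_def using principal_subalgebra_conj7[OF g(1) h(1)] by blast
    moreover have "S \<subseteq> conj7 g ` h \<inter> m4 V"
    proof
      fix x assume x: "x \<in> S"
      then have "conj7 (transpose g) x \<in> h" using a h(3) by blast
      then have "conj7 g (conj7 (transpose g) x) \<in> conj7 g ` h" by blast
      then show "x \<in> conj7 g ` h \<inter> m4 V" using Sm[OF x] by (simp add: conj7_transpose[OF g(1)])
    qed
    ultimately show ?thesis by blast
  next
    assume "\<exists>y z. (y \<noteq> 0 \<or> z \<noteq> 0) \<and> (\<forall>x\<in>pull g S. x *v v7 0 0 y 0 0 0 z = 0)"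
    then obtain y z where k: "\<forall>x\<in>pull g S. x *v v7 0 0 y 0 0 0 z = 0" and yz: "y \<noteq> 0 \<or> z \<noteq> 0" by blast
    have "x \<in> h2 (g *v v7 0 0 y 0 0 0 z)" if "x \<in> S" for x
    proof -
      have "conj7 (transpose g) x \<in> g2" using framed_pull[OF f Sm[OF that]] by (rule m4_in_g2)
      then have "conj7 (transpose g) x \<in> h2 (v7 0 0 y 0 0 0 z)" using k that by (simp add: h2_def)
      then show ?thesis by (rule pull_h2[OF g(1)])
    qed
    moreover have "v7 0 0 y 0 0 0 z \<noteq> 0" using yz by auto
    moreover have "g *v v7 0 0 y 0 0 0 z \<in> perp V" by (rule framed_perp(5)[OF f]) (simp add: perp_V0)
    ultimately show ?thesis using h2 aut7_nonzero[OF g(1)] by blast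
  qed
  then show ?thesis using that by blast
qed

lemma family_dims:
  assumes V: "V \<in> MS"
  shows "M \<in> family1 V \<Longrightarrow> dim M \<le> 3" "M \<in> family2 V \<Longrightarrow> dim M = 5" "M \<in> family3 V \<Longrightarrow> dim M = 4" "M \<in> family4 V \<Longrightarrow> dim M = 4"
proof -
  have d: "dim (conj7 g ` A) = dim A" if "framed V g" for g A using that dim_conj7 by (auto simp: framed_def)
  { assume "M \<in> family1 V"
    then obtain h where "M = h \<inter> m4 V" "dim h = 3" by (auto simp: family1_def principal_subalgebra_def)
    then show "dim M \<le> 3" using dim_subset[of M h] by simp }
  { assume "M \<in> family2 V"
    then obtain l where "M = h2 l \<inter> m4 V" "l \<noteq> 0" "l \<in> perp V" by (auto simp: family2_def)
    then show "dim M = 5" using type2_framed[OF V] d dim_std_family2 by metis }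
  { assume "M \<in> family3 V"
    then obtain l where "M = h2 l \<inter> m4 V" "l \<noteq> 0" "l \<in> V" by (auto simp: family3_def)
    then show "dim M = 4" using type3_framed[OF V] d dim_std_family3 by metis }
  { assume "M \<in> family4 V"
    then obtain W where "M = h4 W \<inter> m4 V" "W \<in> MS" "W \<inter> V \<noteq> {0}" "W \<inter> perp V \<noteq> {0}" by (auto simp: family4_def)
    then show "dim M = 4" using type4_framed[OF V] d dim_std_family4a by metis }
qed

lemma family_LTS:
  assumes V: "V \<in> MS" and M: "M \<in> family1 V \<union> family2 V \<union> family3 V \<union> family4 V"
  shows "LTS V M" "M \<noteq> m4 V"
proof -
  consider "M \<in> family1 V" | "M \<in> family2 V \<union> family3 V" | "M \<in> family4 V" using M by blast
  then show "LTS V M"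
  proof cases
    case 1
    then obtain h where "M = h \<inter> m4 V" "subspace h" "\<And>x y. x \<in> h \<Longrightarrow> y \<in> h \<Longrightarrow> lie x y \<in> h"
      by (auto simp: family1_def principal_subalgebra_def subalgebra_def)
    then show ?thesis using LTS_subalgebra_inter[OF V] by blast
  next
    case 2
    then obtain l where "M = h2 l \<inter> m4 V" unfolding family2_def family3_def by blast
    then show ?thesis using LTS_subalgebra_inter[OF V subspace_h2 lie_h2] by blast
  next
    case 3
    then obtain W where "M = h4 W \<inter> m4 V" unfolding family4_def by blast
    then show ?thesis using LTS_subalgebra_inter[OF V subspace_h4 lie_h4] by blast
  qed
  show "M \<noteq> m4 V" using M family_dims[OF V, of M] dim_m4[OF V] by auto
qed

lemma family1_not_sub:
  assumes V: "V \<in> MS" and M: "M \<in> family1 V" and M': "M' \<in> family2 V \<union> family3 V \<union> family4 V"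
  shows "\<not> M \<subseteq> M'"
proof
  assume s: "M \<subseteq> M'"
  obtain h where h: "M = h \<inter> m4 V" "principal_subalgebra h" "adapted h V" using M unfolding family1_def by blast
  consider l where "M' = h2 l \<inter> m4 V" "l \<noteq> 0" | W where "M' = h4 W \<inter> m4 V" "W \<in> MS"
    using M' unfolding family2_def family3_def family4_def by blast
  then show False
  proof cases
    case 1
    have "h \<subseteq> h2 l" by (rule principal_generated[OF V h(2,3) subspace_h2 lie_h2]) (use s 1 h in auto)
    then show False using principal_not_sub_h2[OF h(2) 1(2)] by blast
  next
    case 2
    have "h \<subseteq> h4 W" by (rule principal_generated[OF V h(2,3) subspace_h4 lie_h4]) (use s 2 h in auto)
    then show False using principal_not_sub_h4[OF h(2) 2(2)] by blast
  qed
qed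

lemma family34_not_sub_family2:
  assumes V: "V \<in> MS" and M: "M \<in> family3 V \<union> family4 V" and M': "M' \<in> family2 V"
  shows "\<not> M \<subseteq> M'"
proof
  assume s: "M \<subseteq> M'"
  obtain l where l: "M' = h2 l \<inter> m4 V" "l \<noteq> 0" "l \<in> perp V" using M' unfolding family2_def by blast
  obtain g where f: "framed V g" and Mg: "M = conj7 g ` std_family3 \<or> M = conj7 g ` std_family4a"
  proof (cases "M \<in> family3 V")
    case True
    then obtain u where "M = h2 u \<inter> m4 V" "u \<noteq> 0" "u \<in> V" unfolding family3_def by blast
    then show ?thesis using type3_framed[OF V] that by metis
  next
    case False
    then obtain W where "M = h4 W \<inter> m4 V" "W \<in> MS" "W \<inter> V \<noteq> {0}" "W \<inter> perp V \<noteq> {0}" using M unfolding family4_def by blast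
    then show ?thesis using type4_framed[OF V] that by metis
  qed
  have g: "aut7 g" using f by (simp add: framed_def)
  have lp: "transpose g *v l \<in> perp V0" by (rule framed_perp(6)[OF f l(3)])
  have d: "d \<in> h2 (transpose g *v l)" if "conj7 g d \<in> M" for d
    using that s l(1) conj7_h2[OF g, of d "transpose g *v l"] by (auto simp: aut7_inverse_vec[OF g])
  have "transpose g *v l = 0"
    using Mg
  proof
    assume "M = conj7 g ` std_family3"
    then have "std_family3 \<subseteq> h2 (transpose g *v l)" using d by blast
    then show ?thesis by (rule std_family3_not_sub_h2[OF lp])
  next
    assume "M = conj7 g ` std_family4a"
    then have "std_family4a \<subseteq> h2 (transpose g *v l)" using d by blast
    then show ?thesis by (rule std_family4a_not_sub_h2[OF lp])
  qed
  then show False using aut7_nonzero[OF aut7_transpose[OF g] l(2)] by blast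
qed

text \<open>Inside family 1, \<open>principal_generated\<close> turns the inclusion into one of
  three-dimensional subalgebras, hence an equality. In the remaining admissible cases the dimensions
  agree, and nested subspaces of equal dimension coincide.\<close>

lemma family_antichain:
  assumes V: "V \<in> MS" and M: "M \<in> family1 V \<union> family2 V \<union> family3 V \<union> family4 V"
    and M': "M' \<in> family1 V \<union> family2 V \<union> family3 V \<union> family4 V" and s: "M \<subseteq> M'"
  shows "M = M'"
proof (cases "M \<in> family1 V")
  case True
  then have "M' \<in> family1 V" using family1_not_sub[OF V True] M' s by blast
  then obtain h' where h': "M' = h' \<inter> m4 V" "principal_subalgebra h'" unfolding family1_def by blast
  obtain h where h: "M = h \<inter> m4 V" "principal_subalgebra h" "adapted h V" using True unfolding family1_def by blast
  have ss: "subspace h" "dim h = 3" "subspace h'" "dim h' = 3" "\<And>x y. x \<in> h' \<Longrightarrow> y \<in> h' \<Longrightarrow> lie x y \<in> h'"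
    using h(2) h'(2) by (auto simp: principal_subalgebra_def subalgebra_def)
  have "h \<subseteq> h'" by (rule principal_generated[OF V h(2,3) ss(3,5)]) (use s h(1) h'(1) in auto)
  then have "h = h'" using subspace_dim_equal[OF ss(1,3)] ss(2,4) by simp
  then show ?thesis using h(1) h'(1) by simp
next
  case False
  note dims = family_dims[OF V]
  have dM: "dim M \<le> dim M'" by (rule dim_subset[OF s])
  have "M' \<notin> family1 V" using False M dims dM by fastforce
  moreover have "\<not> (M \<in> family3 V \<union> family4 V \<and> M' \<in> family2 V)" using family34_not_sub_family2[OF V] s by blast
  moreover have "\<not> (M \<in> family2 V \<and> M' \<in> family3 V \<union> family4 V)" using dims dM by fastforce
  ultimately have "dim M = dim M'" using False M M' dims by auto
  moreover have "subspace M" "subspace M'" using family_LTS(1)[OF V M] family_LTS(1)[OF V M'] by (auto simp: LTS_def)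
  ultimately show ?thesis using subspace_dim_equal[OF _ _ s] by simp
qed

theorem mainTheorem13:
  assumes "V \<in> MS"
  shows "{S. maximal_LTS V S} =
           {h \<inter> m4 V | h. principal_subalgebra h \<and> adapted h V}
         \<union> {h2 l \<inter> m4 V | l. l \<noteq> 0 \<and> l \<in> perp V}
         \<union> {h2 u \<inter> m4 V | u. u \<noteq> 0 \<and> u \<in> V}
         \<union> {h4 W \<inter> m4 V | W. W \<in> MS \<and> W \<inter> V \<noteq> {0} \<and> W \<inter> perp V \<noteq> {0}}"
proof -
  let ?F = "family1 V \<union> family2 V \<union> family3 V \<union> family4 V"
  \<comment> \<open>Every proper triple subsystem lies in a member of \<open>?F\<close>, and the
    members are proper triple subsystems none of which contains another; such a collection is
    exactly the set of maximal ones.\<close>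
  have "{S. maximal_LTS V S} = ?F"
  proof (intro equalityI subsetI)
    fix S assume "S \<in> {S. maximal_LTS V S}"
    then have S: "LTS V S" "S \<noteq> m4 V" and max: "\<And>T. LTS V T \<Longrightarrow> T \<noteq> m4 V \<Longrightarrow> S \<subseteq> T \<Longrightarrow> T = S"
      by (auto simp: maximal_LTS_def)
    obtain M where M: "M \<in> ?F" "S \<subseteq> M" using lts_in_family[OF assms S] by blast
    then have "M = S" using max family_LTS[OF assms M(1)] by blast
    then show "S \<in> ?F" using M(1) by simp
  next
    fix M assume M: "M \<in> ?F"
    have "T = M" if T: "LTS V T" "T \<noteq> m4 V" "M \<subseteq> T" for T
    proof -
      obtain M' where M': "M' \<in> ?F" "T \<subseteq> M'" using lts_in_family[OF assms T(1,2)] by blast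
      then have "M = M'" using family_antichain[OF assms M M'(1)] T(3) by blast
      then show ?thesis using M'(2) T(3) by blast
    qed
    then show "M \<in> {S. maximal_LTS V S}" using family_LTS[OF assms M] by (auto simp: maximal_LTS_def)
  qed
  then show ?thesis unfolding family1_def family2_def family3_def family4_def .
qed

end
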